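(* Consider the problem (P1): find $x\in\mathcal H$ with $0\in\sum_{i=1}^nA_ix+\sum_{j=1}^pB_jx$, and assume that it has at least one solution. Assume: (a) for each $i$, $A_i:\mathcal H\rightrightarrows\mathcal H$ is maximally $(U_i,V_i)$-semimonotone ($U_i,V_i\in\mathcal B(\mathcal H)$ self-adjoint), and for each $j$, $B_j:\mathcal H\to\mathcal H$ is $W_j^{-1}$-cocoercive ($W_j\in\mathcal B(\mathcal H)$ self-adjoint, strongly monotone); (b) $\ker(\mathbf M^* )=\mathbf\Omega$, $\mathbf M$ has closed range, and $\sum_{i=1}^n\sum_{j=1}^nL_{ij}=0$; (c) $\mathbf L_s=\frac12(\mathbf L+\mathbf L^* )$ satisfies $\ker(\mathbf L_s)=\mathbf\Omega$ and is strongly monotone on $\mathbf\Omega^\perp$; (d) either $\mathbf U=0$ or $\mathbf U_{11}$ is strongly monotone; and one of the following holds. Case I: $\mathbf V=0$ (and $\mathbf B$ may be nonzero). Case II: $\mathbf B=0$, $\mathbf V_{22}\succeq0$, $\operatorname{ran}(\mathbf V_{22})$ is closed and $\operatorname{ran}(\mathbf V_{21})\subseteq\operatorname{ran}(\mathbf V_{22})$. Let $\gamma\in\Lambda\cap\Gamma$, let $\beta_\gamma=\left\|(\widehat{\mathbf\Xi}_\gamma^{1/2})^\dagger\mathbf M\right\|^{-2}$, and let $\{\lambda_k\}\subset[0,2\beta_\gamma]$ (finite values) satisfy $\sum_{k=0}^\infty\lambda_k(2\beta_\gamma-\lambda_k)=+\infty$. Let $\mathbf z^0=(z_1^0,\dots,z_m^0)\in\mathcal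 H^m$ and let $\mathbf x^k=(x_1^k,\dots,x_n^k)$, $\mathbf z^k=(z_1^k,\dots,z_m^k)$ be generated, for $k\in\mathbb N$, by $$x_i^k\in J_{\gamma D_i^{-1}A_i}\Big(D_i^{-1}\sum_{j=1}^mM_{ij}z_j^k+D_i^{-1}\sum_{j=1}^nN_{ij}x_j^k-\gamma D_i^{-1}\sum_{j=1}^pP_{ij}B_j\Big(\sum_{l=1}^nR_{jl}x_l^k\Big)\Big),\quad i=1,\dots,n,$$ $$z_i^{k+1}=z_i^k-\lambda_k\sum_{j=1}^nM_{ji}^*x_j^k,\quad i=1,\dots,m.$$ Then: (i) $\{\mathbf z^k\}$ is bounded and converges weakly to some $\mathbf z^*\in\operatorname{zer}(\Psi_\gamma)$. (ii) If $A_i$ is maximally $V_i$-comonotone and $U_i=0$ for all $i\in\{1,\dots,n\}$, and $\{\mathbf x^k\}$ is bounded, then there exists a solution $x^*$ of (P1) such that $x_i^k\rightharpoonup x^*$ for all $i\in\{1,\dots,n\}$. Moreover, the boundedness of $\{\mathbf x^k\}$ is automatic if the first (block) rows of $\mathbf N$ and $\mathbf P$ are zero and $J_{\gamma D_1^{-1}A_1}$ is Lipschitz continuous. (iii) If $\mathbf U$ is strongly monotone on $\mathbf\Omega$, then there exists a solution $x^*$ of (P1) such that $x_i^k\to x^*$ strongly for all $i\in\{1,\dots,n\}$.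
   Context: All Hilbert spaces are real. $\mathcal B(\mathcal X,\mathcal Y)$ is the set of bounded linear operators, $\mathcal B(\mathcal X)=\mathcal B(\mathcal X,\mathcal X)$; $T^*$ adjoint, $T^\dagger$ Moore–Penrose inverse; $T\succeq0$ means $\langle Tx,x\rangle\ge0$ for all $x$. $T$ is strongly monotone on $D$ if there is $\alpha>0$ with $\langle Tx,x\rangle\ge\alpha\|x\|^2$ for all $x\in D$ (no $D$: whole space). $\lambda_{\max}(T)=\sup_{\|x\|=1}\langle Tx,x\rangle$ for self-adjoint $T$. $\rightharpoonup$ is weak convergence. $a/0=+\infty$ for $a>0$. $J_A=(\mathrm{Id}+A)^{-1}$ is the resolvent; $\operatorname{zer}(F)=\{x:0\in F(x)\}$. For self-adjoint bounded $U,V$, a set-valued operator $A$ is $(U,V)$-semimonotone if $\langle x-x',y-y'\rangle\ge\langle x-x',U(x-x')\rangle+\langle y-y',V(y-y')\rangle$ for all $(x,y),(x',y')\in\operatorname{gra}A$; maximally so if no $(U,V)$-semimonotone operator has a strictly larger graph; $V$-comonotone means $(0,V)$-semimonotone. A single-valued $B$ is $W^{-1}$-cocoercive if $\langle x-x',Bx-Bx'\rangle\ge\langle Bx-Bx',W^{-1}(Bx-Bx')\rangle$ for all $x,x'$. Product space setting: $\mathcal H$ is a real Hilbert space; $\mathbf\Omega=\{(x,\dots,x):x\in\mathcal H\}\subseteq\mathcal H^n$. $\mathbf A=\operatorname{diag}(A_1,\dots,A_n)$, i.e. $\mathbf A\mathbf x=A_1x_1\times\cdots\times A_nx_n$; $\mathbf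 B=\operatorname{diag}(B_1,\dots,B_p)$ on $\mathcal H^p$; $\mathbf U=\operatorname{diag}(U_1,\dots,U_n)$, $\mathbf V=\operatorname{diag}(V_1,\dots,V_n)$, $\mathbf W=\operatorname{diag}(W_1,\dots,W_p)$. $\mathbf P=[P_{ij}]\in\mathcal B(\mathcal H^p,\mathcal H^n)$ and $\mathbf R=[R_{ij}]\in\mathcal B(\mathcal H^n,\mathcal H^p)$ satisfy $\mathbf P^*(x,\dots,x)=\mathbf R(x,\dots,x)=(x,\dots,x)\in\mathcal H^p$ for all $x\in\mathcal H$. $m\ge n-1$, $\mathbf M=[M_{ij}]\in\mathcal B(\mathcal H^m,\mathcal H^n)$, $\mathbf L=[L_{ij}]\in\mathcal B(\mathcal H^n)$ with $M_{ij},L_{ij}\in\mathcal B(\mathcal H)$. $\mathbf D=\operatorname{diag}(D_1,\dots,D_n)$ with $D_i=L_{ii}$ assumed self-adjoint and strongly monotone, and $\mathbf N=[N_{ij}]=\mathbf D-\mathbf L$. For $\gamma>0$, $\Phi_\gamma(\mathbf w)=(\gamma\mathbf A+\gamma\mathbf P\mathbf B\mathbf R+\mathbf L)^{-1}(\mathbf w)$ for $\mathbf w\in\mathbf\Omega^\perp$ (a set in general), $\Psi_\gamma(\mathbf z)=\mathbf M^*\Phi_\gamma(\mathbf M\mathbf z)$ for $\mathbf z\in\mathcal H^m$. $\Lambda$ is the set of $\gamma>0$ such that $\Phi_\gamma(\mathbf w)$ is nonempty and single-valued for every $\mathbf w\in\mathbf\Omega^\perp$. Blocks: for $T\in\mathcal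 B(\mathcal H^n)$, with $\Pi$ denoting orthogonal projectors, $T_{11}=\Pi_{\mathbf\Omega}T\Pi_{\mathbf\Omega}$, $T_{12}=\Pi_{\mathbf\Omega}T\Pi_{\mathbf\Omega^\perp}$, $T_{21}=\Pi_{\mathbf\Omega^\perp}T\Pi_{\mathbf\Omega}$, $T_{22}=\Pi_{\mathbf\Omega^\perp}T\Pi_{\mathbf\Omega^\perp}$ (for $T=\mathbf U,\mathbf V$ this notation always refers to these blocks). Properties of $T_{11}$ (resp. $T_{22}$) are understood on $\mathbf\Omega$ (resp. $\mathbf\Omega^\perp$), and their (Moore–Penrose) inverses are extended by zero. $T/T_{11}=T_{22}-T_{21}T_{11}^\dagger T_{12}$, $T/T_{22}=T_{11}-T_{12}T_{22}^\dagger T_{21}$. Let $\mathbf X=\mathbf U/\mathbf U_{11}$; $\mathbf\Theta_\gamma=\frac\gamma4(\mathbf P-\mathbf R^* )\mathbf W(\mathbf P^*-\mathbf R)$ in Case I and $\mathbf\Theta_\gamma=-\frac1\gamma\mathbf L^*(\mathbf V/\mathbf V_{22})\mathbf L$ in Case II; $\widehat{\mathbf\Xi}_\gamma=\mathbf L_s-\mathbf\Theta_\gamma+\gamma\mathbf X$; and $\Gamma=\{\gamma>0:\lambda_{\max}((\mathbf L_s^{1/2})^\dagger(\mathbf\Theta_\gamma-\gamma\mathbf X)(\mathbf L_s^{1/2})^\dagger)<1\}$. *)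

theory Defs
  imports "HOL-Analysis.Analysis" "HOL-Library.Set_Algebras"
begin

section \<open>Bounded operators on real Hilbert spaces\<close>

text \<open>
  A real Hilbert space is a type of sort \<open>{real_inner, banach}\<close>; \<open>\<H>\<^sup>n\<close> is the type \<open>'h ^ 'n\<close>
  with the library's (\<open>l\<^sub>2\<close>) inner product.
\<close>

definition adjoint_op ::
  "('a::{real_inner,banach} \<Rightarrow>\<^sub>L 'b::{real_inner,banach}) \<Rightarrow> ('b \<Rightarrow>\<^sub>L 'a)" where
  "adjoint_op T = Blinfun (adjoint (blinfun_apply T))"

definition self_adjoint :: "('a::{real_inner,banach} \<Rightarrow>\<^sub>L 'a) \<Rightarrow> bool" where
  "self_adjoint T \<longleftrightarrow> adjoint_op T = T"

definition psd_on :: "'a set \<Rightarrow> ('a::{real_inner,banach} \<Rightarrow>\<^sub>L 'a) \<Rightarrow> bool" where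
  "psd_on S T \<longleftrightarrow> (\<forall>x\<in>S. blinfun_apply T x \<bullet> x \<ge> 0)"

definition strongly_monotone_on :: "'a set \<Rightarrow> ('a::{real_inner,banach} \<Rightarrow>\<^sub>L 'a) \<Rightarrow> bool" where
  "strongly_monotone_on S T \<longleftrightarrow>
     (\<exists>\<alpha>>0. \<forall>x\<in>S. blinfun_apply T x \<bullet> x \<ge> \<alpha> * (norm x)\<^sup>2)"

definition kernel :: "('a::real_normed_vector \<Rightarrow>\<^sub>L 'b::real_normed_vector) \<Rightarrow> 'a set" where
  "kernel T = {x. blinfun_apply T x = 0}"

definition ran :: "('a::real_normed_vector \<Rightarrow>\<^sub>L 'b::real_normed_vector) \<Rightarrow> 'b set" where
  "ran T = range (blinfun_apply T)"

text \<open>The Penrose equations; a bounded solution exists (and is unique) iff \<open>T\<close> has closed range.\<close>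

definition pseudo_inverse ::
  "('a::{real_inner,banach} \<Rightarrow>\<^sub>L 'b::{real_inner,banach}) \<Rightarrow> ('b \<Rightarrow>\<^sub>L 'a)" where
  "pseudo_inverse T = (THE S. T o\<^sub>L S o\<^sub>L T = T \<and> S o\<^sub>L T o\<^sub>L S = S \<and>
                              self_adjoint (T o\<^sub>L S) \<and> self_adjoint (S o\<^sub>L T))"

definition sqrt_op :: "('a::{real_inner,banach} \<Rightarrow>\<^sub>L 'a) \<Rightarrow> ('a \<Rightarrow>\<^sub>L 'a)" where
  "sqrt_op T = (THE S. self_adjoint S \<and> psd_on UNIV S \<and> S o\<^sub>L S = T)"

text \<open>Extended-real valued, so that the supremum over an empty unit sphere is \<open>-\<infinity>\<close>.\<close>

definition lambda_max :: "('a::{real_inner,banach} \<Rightarrow>\<^sub>L 'a) \<Rightarrow> ereal" where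
  "lambda_max T = (SUP x\<in>{x. norm x = 1}. ereal (blinfun_apply T x \<bullet> x))"

definition orth_proj :: "'a set \<Rightarrow> ('a::{real_inner,banach} \<Rightarrow>\<^sub>L 'a)" where
  "orth_proj S = (THE Q. \<forall>x. blinfun_apply Q x \<in> S \<and> x - blinfun_apply Q x \<in> S\<^sup>\<bottom>)"

definition weakly_converges :: "(nat \<Rightarrow> 'a::{real_inner,banach}) \<Rightarrow> 'a \<Rightarrow> bool" where
  "weakly_converges f l \<longleftrightarrow> (\<forall>y. (\<lambda>k. f k \<bullet> y) \<longlonglongrightarrow> l \<bullet> y)"


section \<open>Set-valued operators\<close>

definition graph :: "('a \<Rightarrow> 'b set) \<Rightarrow> ('a \<times> 'b) set" where
  "graph F = {(x, y). y \<in> F x}"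

definition inv_op :: "('a \<Rightarrow> 'b set) \<Rightarrow> 'b \<Rightarrow> 'a set" where
  "inv_op F w = {x. w \<in> F x}"

definition zer :: "('a \<Rightarrow> 'b::zero set) \<Rightarrow> 'a set" where
  "zer F = {x. 0 \<in> F x}"

definition resolvent :: "('a::ab_group_add \<Rightarrow> 'a set) \<Rightarrow> 'a \<Rightarrow> 'a set" where
  "resolvent F = inv_op (\<lambda>x. {x} + F x)"

definition semimonotone ::
  "('h::{real_inner,banach} \<Rightarrow>\<^sub>L 'h) \<Rightarrow> ('h \<Rightarrow>\<^sub>L 'h) \<Rightarrow> ('h \<Rightarrow> 'h set) \<Rightarrow> bool" where
  "semimonotone U V A \<longleftrightarrow>
     (\<forall>(x, y)\<in>graph A. \<forall>(x', y')\<in>graph A.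
        (x - x') \<bullet> (y - y') \<ge> (x - x') \<bullet> blinfun_apply U (x - x') + (y - y') \<bullet> blinfun_apply V (y - y'))"

definition max_semimonotone ::
  "('h::{real_inner,banach} \<Rightarrow>\<^sub>L 'h) \<Rightarrow> ('h \<Rightarrow>\<^sub>L 'h) \<Rightarrow> ('h \<Rightarrow> 'h set) \<Rightarrow> bool" where
  "max_semimonotone U V A \<longleftrightarrow>
     semimonotone U V A \<and> \<not> (\<exists>A'. semimonotone U V A' \<and> graph A \<subset> graph A')"

abbreviation max_comonotone :: "('h::{real_inner,banach} \<Rightarrow>\<^sub>L 'h) \<Rightarrow> ('h \<Rightarrow> 'h set) \<Rightarrow> bool" where
  "max_comonotone V A \<equiv> max_semimonotone 0 V A"

definition cocoercive :: "('h \<Rightarrow> 'h) \<Rightarrow> ('h::{real_inner,banach} \<Rightarrow> 'h) \<Rightarrow> bool" where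
  "cocoercive C B \<longleftrightarrow> (\<forall>x x'. (x - x') \<bullet> (B x - B x') \<ge> (B x - B x') \<bullet> C (B x - B x'))"

text \<open>In particular a Lipschitz set-valued operator is at most single-valued; its domain need not be
  the whole space.\<close>

definition lipschitz_op :: "('a::metric_space \<Rightarrow> 'b::metric_space set) \<Rightarrow> bool" where
  "lipschitz_op F \<longleftrightarrow> (\<exists>C\<ge>0. \<forall>(x, y)\<in>graph F. \<forall>(x', y')\<in>graph F. dist y y' \<le> C * dist x x')"


section \<open>Product spaces and block operators\<close>

lift_definition block ::
  "('n::finite \<Rightarrow> 'm::finite \<Rightarrow> ('a::real_normed_vector \<Rightarrow>\<^sub>L 'b::real_normed_vector)) \<Rightarrow> (('a ^ 'm) \<Rightarrow>\<^sub>L ('b ^ 'n))"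
  is "\<lambda>T x. \<chi> i. \<Sum>j\<in>UNIV. T i j (x $ j)"
proof -
  fix T :: "'n \<Rightarrow> 'm \<Rightarrow> 'a \<Rightarrow> 'b"
  assume T: "\<And>i j. bounded_linear (T i j)"
  define f where "f = (\<lambda>i (x :: 'a ^ 'm). \<Sum>j\<in>UNIV. T i j (x $ j))"
  have f: "bounded_linear (f i)" for i
    unfolding f_def
    by (intro bounded_linear_sum bounded_linear_compose[OF T] bounded_linear_vec_nth)
  have "bounded_linear (\<lambda>x. \<chi> i. f i x)"
  proof (rule bounded_linear_intro)
    show "(\<chi> i. f i (x + y)) = (\<chi> i. f i x) + (\<chi> i. f i y)" for x y
      by (simp add: vec_eq_iff bounded_linear.linear[OF f] linear_add)
    show "(\<chi> i. f i (r *\<^sub>R x)) = r *\<^sub>R (\<chi> i. f i x)" for r x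
      by (simp add: vec_eq_iff bounded_linear.linear[OF f] linear_scale)
    show "norm (\<chi> i. f i x) \<le> norm x * (\<Sum>i\<in>UNIV. onorm (f i))" for x
    proof -
      have "norm (\<chi> i. f i x) \<le> (\<Sum>i\<in>UNIV. norm (f i x))"
        unfolding norm_vec_def by (simp add: L2_set_le_sum)
      also have "\<dots> \<le> (\<Sum>i\<in>UNIV. onorm (f i) * norm x)"
        by (intro sum_mono onorm f)
      finally show ?thesis by (simp add: sum_distrib_left mult.commute)
    qed
  qed
  then show "bounded_linear (\<lambda>x. \<chi> i. \<Sum>j\<in>UNIV. T i j (x $ j))"
    by (simp add: f_def)
qed

definition diag_entries :: "('n \<Rightarrow> 'a::zero) \<Rightarrow> 'n \<Rightarrow> 'n \<Rightarrow> 'a" where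
  "diag_entries T i j = (if i = j then T i else 0)"

definition diag_op :: "('n::finite \<Rightarrow> ('h::real_normed_vector \<Rightarrow>\<^sub>L 'h)) \<Rightarrow> (('h ^ 'n) \<Rightarrow>\<^sub>L ('h ^ 'n))" where
  "diag_op T = block (diag_entries T)"

definition diag_set :: "('n \<Rightarrow> 'h \<Rightarrow> 'h set) \<Rightarrow> 'h ^ 'n \<Rightarrow> ('h ^ 'n) set" where
  "diag_set A x = {y. \<forall>i. y $ i \<in> A i (x $ i)}"

definition diag_fun :: "('p \<Rightarrow> 'h \<Rightarrow> 'h) \<Rightarrow> 'h ^ 'p \<Rightarrow> 'h ^ 'p" where
  "diag_fun B x = (\<chi> j. B j (x $ j))"

text \<open>The entries \<open>N\<^sub>i\<^sub>j\<close> of \<open>N = D - L\<close>, where \<open>D = diag(L\<^sub>1\<^sub>1, \<dots>, L\<^sub>n\<^sub>n)\<close>.\<close>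

definition N_entries :: "('n \<Rightarrow> 'n \<Rightarrow> 'a::ab_group_add) \<Rightarrow> 'n \<Rightarrow> 'n \<Rightarrow> 'a" where
  "N_entries L i j = diag_entries (\<lambda>i. L i i) i j - L i j"

definition Omega :: "('h ^ 'n) set" where
  "Omega = range vec"

definition blk11 :: "(('h::{real_inner,banach} ^ 'n) \<Rightarrow>\<^sub>L ('h ^ 'n)) \<Rightarrow> (('h ^ 'n) \<Rightarrow>\<^sub>L ('h ^ 'n))" where
  "blk11 T = orth_proj Omega o\<^sub>L T o\<^sub>L orth_proj Omega"

definition blk12 :: "(('h::{real_inner,banach} ^ 'n) \<Rightarrow>\<^sub>L ('h ^ 'n)) \<Rightarrow> (('h ^ 'n) \<Rightarrow>\<^sub>L ('h ^ 'n))" where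
  "blk12 T = orth_proj Omega o\<^sub>L T o\<^sub>L orth_proj (Omega\<^sup>\<bottom>)"

definition blk21 :: "(('h::{real_inner,banach} ^ 'n) \<Rightarrow>\<^sub>L ('h ^ 'n)) \<Rightarrow> (('h ^ 'n) \<Rightarrow>\<^sub>L ('h ^ 'n))" where
  "blk21 T = orth_proj (Omega\<^sup>\<bottom>) o\<^sub>L T o\<^sub>L orth_proj Omega"

definition blk22 :: "(('h::{real_inner,banach} ^ 'n) \<Rightarrow>\<^sub>L ('h ^ 'n)) \<Rightarrow> (('h ^ 'n) \<Rightarrow>\<^sub>L ('h ^ 'n))" where
  "blk22 T = orth_proj (Omega\<^sup>\<bottom>) o\<^sub>L T o\<^sub>L orth_proj (Omega\<^sup>\<bottom>)"

text \<open>The Schur complements \<open>T/T\<^sub>1\<^sub>1\<close> and \<open>T/T\<^sub>2\<^sub>2\<close>. The blocks are operators on the whole product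
  space, so the pseudo-inverse of a block is automatically extended by zero.\<close>

definition schur11 :: "(('h::{real_inner,banach} ^ 'n) \<Rightarrow>\<^sub>L ('h ^ 'n)) \<Rightarrow> (('h ^ 'n) \<Rightarrow>\<^sub>L ('h ^ 'n))" where
  "schur11 T = blk22 T - (blk21 T o\<^sub>L pseudo_inverse (blk11 T) o\<^sub>L blk12 T)"

definition schur22 :: "(('h::{real_inner,banach} ^ 'n) \<Rightarrow>\<^sub>L ('h ^ 'n)) \<Rightarrow> (('h ^ 'n) \<Rightarrow>\<^sub>L ('h ^ 'n))" where
  "schur22 T = blk11 T - (blk12 T o\<^sub>L pseudo_inverse (blk22 T) o\<^sub>L blk21 T)"


section \<open>The splitting framework\<close>

definition P1_solutions ::
  "('n::finite \<Rightarrow> 'h::real_normed_vector \<Rightarrow> 'h set) \<Rightarrow> ('p::finite \<Rightarrow> 'h \<Rightarrow> 'h) \<Rightarrow> 'h set" where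
  "P1_solutions A B = zer (\<lambda>x. (\<Sum>i\<in>UNIV. A i x) + {\<Sum>j\<in>UNIV. B j x})"

definition Phi ::
  "('n::finite \<Rightarrow> 'h \<Rightarrow> 'h::{real_inner,banach} set) \<Rightarrow> ('p::finite \<Rightarrow> 'h \<Rightarrow> 'h) \<Rightarrow>
   (('h ^ 'p) \<Rightarrow>\<^sub>L ('h ^ 'n)) \<Rightarrow> (('h ^ 'n) \<Rightarrow>\<^sub>L ('h ^ 'p)) \<Rightarrow> (('h ^ 'n) \<Rightarrow>\<^sub>L ('h ^ 'n)) \<Rightarrow>
   real \<Rightarrow> 'h ^ 'n \<Rightarrow> ('h ^ 'n) set" where
  "Phi A B P R L \<gamma> =
     inv_op (\<lambda>x. (\<lambda>a. \<gamma> *\<^sub>R a) ` diag_set A x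
                 + {\<gamma> *\<^sub>R blinfun_apply P (diag_fun B (blinfun_apply R x))}
                 + {blinfun_apply L x})"

definition Psi ::
  "('n::finite \<Rightarrow> 'h \<Rightarrow> 'h::{real_inner,banach} set) \<Rightarrow> ('p::finite \<Rightarrow> 'h \<Rightarrow> 'h) \<Rightarrow>
   (('h ^ 'p) \<Rightarrow>\<^sub>L ('h ^ 'n)) \<Rightarrow> (('h ^ 'n) \<Rightarrow>\<^sub>L ('h ^ 'p)) \<Rightarrow> (('h ^ 'n) \<Rightarrow>\<^sub>L ('h ^ 'n)) \<Rightarrow>
   (('h ^ 'm) \<Rightarrow>\<^sub>L ('h ^ 'n)) \<Rightarrow> real \<Rightarrow> 'h ^ 'm \<Rightarrow> ('h ^ 'm) set" where
  "Psi A B P R L M \<gamma> z = blinfun_apply (adjoint_op M) ` Phi A B P R L \<gamma> (blinfun_apply M z)"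

definition Lambda_set ::
  "('n::finite \<Rightarrow> 'h \<Rightarrow> 'h::{real_inner,banach} set) \<Rightarrow> ('p::finite \<Rightarrow> 'h \<Rightarrow> 'h) \<Rightarrow>
   (('h ^ 'p) \<Rightarrow>\<^sub>L ('h ^ 'n)) \<Rightarrow> (('h ^ 'n) \<Rightarrow>\<^sub>L ('h ^ 'p)) \<Rightarrow> (('h ^ 'n) \<Rightarrow>\<^sub>L ('h ^ 'n)) \<Rightarrow>
   real set" where
  "Lambda_set A B P R L = {\<gamma>. \<gamma> > 0 \<and> (\<forall>w\<in>Omega\<^sup>\<bottom>. \<exists>x. Phi A B P R L \<gamma> w = {x})}"

definition sym_part :: "('a::{real_inner,banach} \<Rightarrow>\<^sub>L 'a) \<Rightarrow> ('a \<Rightarrow>\<^sub>L 'a)" where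
  "sym_part L = (1/2) *\<^sub>R (L + adjoint_op L)"

definition caseI :: "('n::finite \<Rightarrow> ('h::{real_inner,banach} \<Rightarrow>\<^sub>L 'h)) \<Rightarrow> bool" where
  "caseI V \<longleftrightarrow> diag_op V = 0"

definition caseII ::
  "('p::finite \<Rightarrow> 'h \<Rightarrow> 'h) \<Rightarrow> ('n::finite \<Rightarrow> ('h::{real_inner,banach} \<Rightarrow>\<^sub>L 'h)) \<Rightarrow> bool" where
  "caseII B V \<longleftrightarrow>
     (\<forall>x. diag_fun B x = 0) \<and>
     psd_on (Omega\<^sup>\<bottom>) (blk22 (diag_op V)) \<and>
     closed (ran (blk22 (diag_op V))) \<and>
     ran (blk21 (diag_op V)) \<subseteq> ran (blk22 (diag_op V))"

definition Theta_I ::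
  "(('h::{real_inner,banach} ^ 'p) \<Rightarrow>\<^sub>L ('h ^ 'n)) \<Rightarrow> (('h ^ 'n) \<Rightarrow>\<^sub>L ('h ^ 'p)) \<Rightarrow>
   (('h ^ 'p) \<Rightarrow>\<^sub>L ('h ^ 'p)) \<Rightarrow> real \<Rightarrow> (('h ^ 'n) \<Rightarrow>\<^sub>L ('h ^ 'n))" where
  "Theta_I P R W \<gamma> = (\<gamma> / 4) *\<^sub>R ((P - adjoint_op R) o\<^sub>L W o\<^sub>L (adjoint_op P - R))"

definition Theta_II ::
  "(('h::{real_inner,banach} ^ 'n) \<Rightarrow>\<^sub>L ('h ^ 'n)) \<Rightarrow> (('h ^ 'n) \<Rightarrow>\<^sub>L ('h ^ 'n)) \<Rightarrow>
   real \<Rightarrow> (('h ^ 'n) \<Rightarrow>\<^sub>L ('h ^ 'n))" where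
  "Theta_II L V \<gamma> = - ((1 / \<gamma>) *\<^sub>R (adjoint_op L o\<^sub>L schur22 V o\<^sub>L L))"

definition Xi_hat ::
  "(('h::{real_inner,banach} ^ 'n) \<Rightarrow>\<^sub>L ('h ^ 'n)) \<Rightarrow> (real \<Rightarrow> (('h ^ 'n) \<Rightarrow>\<^sub>L ('h ^ 'n))) \<Rightarrow>
   (('h ^ 'n) \<Rightarrow>\<^sub>L ('h ^ 'n)) \<Rightarrow> real \<Rightarrow> (('h ^ 'n) \<Rightarrow>\<^sub>L ('h ^ 'n))" where
  "Xi_hat L \<Theta> U \<gamma> = sym_part L - \<Theta> \<gamma> + \<gamma> *\<^sub>R schur11 U"

definition Gamma_set ::
  "(('h::{real_inner,banach} ^ 'n) \<Rightarrow>\<^sub>L ('h ^ 'n)) \<Rightarrow> (real \<Rightarrow> (('h ^ 'n) \<Rightarrow>\<^sub>L ('h ^ 'n))) \<Rightarrow>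
   (('h ^ 'n) \<Rightarrow>\<^sub>L ('h ^ 'n)) \<Rightarrow> real set" where
  "Gamma_set L \<Theta> U =
     {\<gamma>. \<gamma> > 0 \<and>
         lambda_max (pseudo_inverse (sqrt_op (sym_part L)) o\<^sub>L (\<Theta> \<gamma> - \<gamma> *\<^sub>R schur11 U)
                     o\<^sub>L pseudo_inverse (sqrt_op (sym_part L))) < 1}"

text \<open>Extended-real valued: \<open>\<beta> = \<infinity>\<close> iff the norm vanishes (which happens for \<open>M = 0\<close>).\<close>

definition beta ::
  "(('h::{real_inner,banach} ^ 'n) \<Rightarrow>\<^sub>L ('h ^ 'n)) \<Rightarrow> (('h ^ 'm) \<Rightarrow>\<^sub>L ('h ^ 'n)) \<Rightarrow> ereal" where
  "beta \<Xi> M = 1 / ereal ((norm (pseudo_inverse (sqrt_op \<Xi>) o\<^sub>L M))\<^sup>2)"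

text \<open>The resolvent \<open>J\<close> of \<open>\<gamma> D\<^sup>-\<^sup>1 A\<close>.\<close>

definition J_scaled ::
  "real \<Rightarrow> ('h::{real_inner,banach} \<Rightarrow>\<^sub>L 'h) \<Rightarrow> ('h \<Rightarrow> 'h set) \<Rightarrow> 'h \<Rightarrow> 'h set" where
  "J_scaled \<gamma> D A = resolvent (\<lambda>x. (\<lambda>a. \<gamma> *\<^sub>R inv (blinfun_apply D) a) ` A x)"

end

theory Submission
  imports Defs
begin

text \<open>
Write \<open>w = M z\<close> and let \<open>x\<close> be the unique element of \<open>\<Phi>\<^sub>\<gamma> w\<close>. The \<open>x\<close>-update of the method solves
exactly this inclusion with \<open>w = M z\<^sup>k\<close>, so the \<open>z\<close>-update is the relaxed iteration
\<open>z\<^sup>k\<^sup>+\<^sup>1 = z\<^sup>k - \<lambda>\<^sub>k \<Psi>\<^sub>\<gamma> z\<^sup>k\<close>, and the whole theorem rests on one inequality: if \<open>x \<in> \<Phi>\<^sub>\<gamma> w\<close>, \<open>x' \<in> \<Phi>\<^sub>\<gamma> w'\<close>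
with \<open>w, w'\<close> orthogonal to the diagonal \<open>\<Omega>\<close>, then
\<open>\<langle>x - x', w - w'\<rangle> \<ge> \<langle>x - x', \<Xi> (x - x')\<rangle>\<close> (\<open>resolvent_estimate_\<Xi>\<close>).

It is obtained by adding up the semimonotonicity inequalities of the \<open>A\<^sub>i\<close> and disposing of everything
that is not a quadratic form in \<open>d = x - x'\<close>. In Case I the forward term is evaluated at \<open>R x\<close> but
re-enters through \<open>P\<close>; the mismatch \<open>P\<^sup>* d - R d\<close> is absorbed by cocoercivity after completing a square,
which costs \<open>\<Theta>\<close>. In Case II the difference \<open>e\<close> of the \<open>A\<close>-outputs enters through \<open>\<langle>e, V e\<rangle>\<close>. Only the
diagonal component of \<open>e\<close> is determined by \<open>d\<close>, because \<open>w - w'\<close> is orthogonal to \<open>\<Omega>\<close>; minimising over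
the other component leaves the Schur complement \<open>V/V\<^sub>2\<^sub>2\<close> (\<open>inner_schur22_le\<close>). Likewise minimising \<open>\<langle>d, U d\<rangle>\<close>
over the diagonal component of \<open>d\<close> leaves \<open>U/U\<^sub>1\<^sub>1\<close> (\<open>inner_schur11_le\<close>).

The operator \<open>\<Xi>\<close> vanishes on \<open>\<Omega>\<close>, and the condition \<open>\<gamma> \<in> \<Gamma>\<close> makes it strongly monotone on
\<open>\<Omega>\<^sup>\<bottom>\<close> (\<open>\<Xi>_mono\<close>). Since \<open>M\<^sup>*\<close> ignores \<open>\<Omega>\<close>, the inequality makes \<open>\<Psi>\<^sub>\<gamma>\<close> cocoercive with
modulus \<open>\<beta>\<^sub>\<gamma>\<close> (\<open>Psi_cocoercive\<close>), and the classical theory of relaxed iterations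
(\<open>cocoercive_iteration_weakly_converges\<close>) gives \<open>\<Psi>\<^sub>\<gamma> z\<^sup>k \<rightarrow> 0\<close> and weak convergence of \<open>z\<^sup>k\<close> to a zero \<open>z\<^sup>*\<close>.
A zero of \<open>\<Psi>\<^sub>\<gamma>\<close> has \<open>\<Phi>\<^sub>\<gamma> (M z\<^sup>*) = {(u, \<dots>, u)}\<close>, and summing the components of the inclusion shows
that \<open>u\<close> solves the problem.

For the \<open>x\<^sup>k\<close>, the same inequality against \<open>z\<^sup>*\<close> forces the components orthogonal to \<open>\<Omega>\<close> to zero. If \<open>U\<close>
is strongly monotone on \<open>\<Omega>\<close>, the square discarded when \<open>\<langle>d, U d\<rangle>\<close> was minimised controls the diagonal
component too, so convergence is strong (\<open>strong_convergence\<close>). In the comonotone case every weak cluster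
point of \<open>x\<^sup>k\<close> again belongs to \<open>\<Phi>\<^sub>\<gamma> (M z\<^sup>*)\<close> (\<open>Phi_weakly_closed\<close>): the pairings of the inputs with the
outputs of the \<open>A\<^sub>i\<close> and \<open>B\<^sub>j\<close> converge to the right limit as a sum, which is all that is needed, and
maximality recovers each inclusion. Uniqueness of the cluster point gives weak convergence.

Adjoints, pseudo-inverses, square roots and orthogonal projectors are given by description, so the
existence theorems behind them (projection theorem, Riesz representation, uniform boundedness,
existence and uniqueness of positive square roots) are proved first.
\<close>

section \<open>Projections, adjoints and bounded inverses in Hilbert space\<close>

text \<open>The projection theorem: a minimising sequence for the distance to \<open>S\<close> is Cauchy by the
  parallelogram law, and its limit is the foot of the perpendicular.\<close>

lemma closed_subspace_decomposition:
  fixes S :: "'a::{real_inner,banach} set"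
  assumes "subspace S" "closed S"
  obtains p where "p \<in> S" "x - p \<in> S\<^sup>\<bottom>"
proof -
  define d where "d = infdist x S"
  have "S \<noteq> {}"
    using assms(1) subspace_0 by blast
  have d_le: "d \<le> norm (x - s)" if "s \<in> S" for s
    using infdist_le[OF that, of x] by (simp add: d_def dist_norm)
  have d0: "0 \<le> d"
    by (simp add: d_def infdist_nonneg)
  have "\<exists>s\<in>S. norm (x - s) < d + inverse (real (Suc n))" for n
  proof (rule ccontr)
    assume "\<not> ?thesis"
    then have "d + inverse (real (Suc n)) \<le> infdist x S"
      using \<open>S \<noteq> {}\<close> by (auto simp: infdist_def dist_norm not_less intro!: cINF_greatest)
    then show False
      by (simp add: d_def)
  qed
  then obtain p where p: "\<And>n. p n \<in> S" "\<And>n. norm (x - p n) < d + inverse (real (Suc n))"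
    by metis
  have lim_bound: "(\<lambda>n. (d + inverse (real (Suc n)))\<^sup>2) \<longlonglongrightarrow> (d + 0)\<^sup>2"
    by (intro tendsto_intros LIMSEQ_inverse_real_of_nat)
  \<comment> \<open>The parallelogram law turns almost-minimality into the Cauchy property.\<close>
  have parallelogram: "(norm (p m - p n))\<^sup>2 \<le> 2 * (norm (x - p m))\<^sup>2 + 2 * (norm (x - p n))\<^sup>2 - 4 * d\<^sup>2" for m n
  proof -
    let ?q = "(1/2) *\<^sub>R (p m + p n)"
    have "?q \<in> S"
      using p assms(1) by (intro subspace_scale subspace_add)
    then have "d\<^sup>2 \<le> (norm (x - ?q))\<^sup>2"
      using d_le d0 by (intro power_mono) auto
    moreover have "(norm (p m - p n))\<^sup>2 + 4 * (norm (x - ?q))\<^sup>2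
        = 2 * (norm (x - p m))\<^sup>2 + 2 * (norm (x - p n))\<^sup>2"
      unfolding power2_norm_eq_inner
      by (simp add: inner_simps inner_commute algebra_simps)
    ultimately show ?thesis by linarith
  qed
  have "Cauchy p"
  proof (rule CauchyI)
    fix e :: real assume "0 < e"
    have "\<forall>\<^sub>F n in sequentially. (d + inverse (real (Suc n)))\<^sup>2 < d\<^sup>2 + e\<^sup>2 / 4"
      using lim_bound \<open>0 < e\<close> by (intro order_tendstoD) auto
    then obtain N where N: "\<And>n. n \<ge> N \<Longrightarrow> (d + inverse (real (Suc n)))\<^sup>2 < d\<^sup>2 + e\<^sup>2 / 4"
      by (auto simp: eventually_sequentially)
    have small: "(norm (x - p n))\<^sup>2 < d\<^sup>2 + e\<^sup>2 / 4" if "n \<ge> N" for n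
      using N[OF that] power_mono[OF less_imp_le[OF p(2)[of n]] norm_ge_zero, of 2]
      by linarith
    have "norm (p m - p n) < e" if "m \<ge> N" "n \<ge> N" for m n
    proof -
      have "(norm (p m - p n))\<^sup>2 < e\<^sup>2"
        using parallelogram[of m n] small[OF that(1)] small[OF that(2)] by linarith
      then show ?thesis
        using \<open>0 < e\<close> by (simp add: power_less_imp_less_base)
    qed
    then show "\<exists>M. \<forall>m\<ge>M. \<forall>n\<ge>M. norm (p m - p n) < e" by blast
  qed
  then obtain q where q: "p \<longlonglongrightarrow> q"
    using Cauchy_convergent convergent_def by blast
  have "q \<in> S"
    using closed_sequentially[OF assms(2) _ q] p(1) by blast
  have "(\<lambda>n. (norm (x - p n))\<^sup>2) \<longlonglongrightarrow> (norm (x - q))\<^sup>2"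
    by (intro tendsto_intros q)
  then have q_min: "(norm (x - q))\<^sup>2 \<le> d\<^sup>2"
    using lim_bound power_mono[OF less_imp_le[OF p(2)] norm_ge_zero, of _ 2]
    by (intro LIMSEQ_le[where X = "\<lambda>n. (norm (x - p n))\<^sup>2"]) auto
  have "s \<bullet> (x - q) = 0" if "s \<in> S" for s
  proof -
    \<comment> \<open>the step along \<open>s\<close> that would reduce the distance most\<close>
    define t where "t = (s \<bullet> (x - q)) / (s \<bullet> s)"
    have "q + t *\<^sub>R s \<in> S"
      using assms(1) \<open>q \<in> S\<close> that by (simp add: subspace_add subspace_scale)
    then have "d\<^sup>2 \<le> (norm (x - q - t *\<^sub>R s))\<^sup>2"
      using d_le d0 by (intro power_mono) (auto simp: diff_diff_eq)
    then have "0 \<le> - 2 * t * (s \<bullet> (x - q)) + t\<^sup>2 * (s \<bullet> s)"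
      using q_min unfolding power2_norm_eq_inner
      by (simp add: inner_simps inner_commute algebra_simps power2_eq_square)
    also have "\<dots> = - ((s \<bullet> (x - q))\<^sup>2 / (s \<bullet> s))"
      by (cases "s = 0") (auto simp: t_def power2_eq_square field_simps)
    finally have "(s \<bullet> (x - q))\<^sup>2 / (s \<bullet> s) \<le> 0" by simp
    then show ?thesis
      using inner_gt_zero_iff[of s] by (cases "s = 0") (auto simp: divide_le_0_iff simp del: inner_gt_zero_iff)
  qed
  then have "x - q \<in> S\<^sup>\<bottom>"
    by (auto simp: orthogonal_comp_def orthogonal_def)
  with \<open>q \<in> S\<close> show thesis by (rule that)
qed

lemma orthogonal_comp_iff: "x \<in> S\<^sup>\<bottom> \<longleftrightarrow> (\<forall>s\<in>S. s \<bullet> x = 0)"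
  by (auto simp: orthogonal_comp_def orthogonal_def)

lemma closed_orthogonal_comp: "closed (S\<^sup>\<bottom>)"
proof -
  have "S\<^sup>\<bottom> = (\<Inter>s\<in>S. {x. s \<bullet> x = 0})"
    by (auto simp: orthogonal_comp_iff)
  then show ?thesis
    by (auto intro!: closed_INT closed_Collect_eq continuous_intros)
qed

lemma orthogonal_comp_comp:
  fixes S :: "'a::{real_inner,banach} set"
  assumes "subspace S" "closed S"
  shows "S\<^sup>\<bottom>\<^sup>\<bottom> = S"
proof (intro equalityI orthogonal_comp_subset subsetI)
  fix x assume x: "x \<in> S\<^sup>\<bottom>\<^sup>\<bottom>"
  obtain p where p: "p \<in> S" "x - p \<in> S\<^sup>\<bottom>"
    by (rule closed_subspace_decomposition[OF assms])
  have "(x - p) \<bullet> (x - p) = (x - p) \<bullet> x - p \<bullet> (x - p)"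
    by (simp add: inner_simps inner_commute)
  also have "\<dots> = 0"
    using x p by (simp add: orthogonal_comp_iff)
  finally show "x \<in> S"
    using p by simp
qed

text \<open>A nonzero functional is determined by its value on one vector \<open>v\<close> orthogonal to its kernel, since the
  kernel and \<open>v\<close> span the space.\<close>

theorem riesz_representation:
  fixes f :: "'a::{real_inner,banach} \<Rightarrow> real"
  assumes "bounded_linear f"
  obtains r where "\<And>y. f y = r \<bullet> y"
proof (cases "\<forall>y. f y = 0")
  case True
  then show thesis by (intro that[of 0]) simp
next
  case False
  then obtain u where u: "f u \<noteq> 0" by blast
  interpret bounded_linear f by fact
  have "subspace {x. f x = 0}"
    by (simp add: subspace_def add scaleR zero)
  moreover have "closed {x. f x = 0}"
    by (intro closed_Collect_eq continuous_intros linear_continuous_on assms)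
  ultimately obtain p where p: "f p = 0" "u - p \<in> {x. f x = 0}\<^sup>\<bottom>"
    by (rule closed_subspace_decomposition[of _ u]) auto
  define v where "v = u - p"
  have fv: "f v \<noteq> 0"
    using p u by (simp add: v_def diff)
  then have "v \<noteq> 0"
    using zero by auto
  have "f y = ((f v / (v \<bullet> v)) *\<^sub>R v) \<bullet> y" for y
  proof -
    have "f (y - (f y / f v) *\<^sub>R v) = 0"
      using fv by (simp add: diff scaleR)
    then have "(y - (f y / f v) *\<^sub>R v) \<bullet> v = 0"
      using p(2) by (auto simp: orthogonal_comp_iff v_def)
    then have "y \<bullet> v = (f y / f v) * (v \<bullet> v)"
      by (simp add: inner_simps)
    then show ?thesis
      using fv \<open>v \<noteq> 0\<close> by (simp add: inner_commute field_simps)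
  qed
  then show thesis by (rule that)
qed

text \<open>Riesz representation turns the description of the adjoint into its defining identity, on which
  all later computations with \<^const>\<open>adjoint_op\<close> rest.\<close>

lemma adjoint_op_inner:
  fixes T :: "'a::{real_inner,banach} \<Rightarrow>\<^sub>L 'b::{real_inner,banach}"
  shows "blinfun_apply (adjoint_op T) y \<bullet> x = y \<bullet> T x"
proof -
  have "\<exists>r. \<forall>x. y \<bullet> T x = r \<bullet> x" for y
    by (rule riesz_representation[of "\<lambda>x. y \<bullet> T x"])
      (auto intro: bounded_linear_compose[OF bounded_linear_inner_right blinfun.bounded_linear_right])
  then obtain g where g: "\<And>y x. y \<bullet> T x = g y \<bullet> x"
    by metis
  have eq: "adjoint (blinfun_apply T) = g"
    by (rule adjoint_unique) (simp add: inner_commute g)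
  have "bounded_linear g"
  proof (rule bounded_linear_intro[where K = "norm T"])
    show "g (a + b) = g a + g b" for a b
      by (rule vector_eq_rdot[THEN iffD1]) (simp add: inner_simps flip: g)
    show "g (r *\<^sub>R a) = r *\<^sub>R g a" for r a
      by (rule vector_eq_rdot[THEN iffD1]) (simp add: inner_simps flip: g)
    show "norm (g a) \<le> norm a * norm T" for a
    proof -
      have "norm (g a) * norm (g a) = a \<bullet> T (g a)"
        by (simp add: g power2_eq_square flip: power2_norm_eq_inner)
      also have "\<dots> \<le> norm a * (norm T * norm (g a))"
        by (meson Cauchy_Schwarz_ineq2 abs_le_D1 order_trans mult_left_mono norm_blinfun norm_ge_zero)
      finally show ?thesis
        by (cases "g a = 0") auto
    qed
  qed
  then show ?thesis
    by (simp add: adjoint_op_def eq bounded_linear_Blinfun_apply g)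
qed

lemma adjoint_op_inner': "x \<bullet> blinfun_apply (adjoint_op T) y = T x \<bullet> y"
  by (metis adjoint_op_inner inner_commute)

lemma adjoint_op_eqI:
  assumes "\<And>x y. blinfun_apply S y \<bullet> x = y \<bullet> blinfun_apply T x"
  shows "adjoint_op T = S"
  by (rule blinfun_eqI, rule vector_eq_rdot[THEN iffD1]) (simp add: adjoint_op_inner assms)

lemma self_adjointI:
  assumes "\<And>x y. blinfun_apply T y \<bullet> x = y \<bullet> blinfun_apply T x"
  shows "self_adjoint T"
  using adjoint_op_eqI[of T T] assms by (simp add: self_adjoint_def)

lemma self_adjointD: "self_adjoint T \<Longrightarrow> blinfun_apply T y \<bullet> x = y \<bullet> blinfun_apply T x"
  by (metis adjoint_op_inner self_adjoint_def)

lemma self_adjoint_add: "self_adjoint S \<Longrightarrow> self_adjoint T \<Longrightarrow> self_adjoint (S + T)"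
  by (intro self_adjointI) (simp add: blinfun.bilinear_simps inner_simps self_adjointD)

lemma self_adjoint_diff: "self_adjoint S \<Longrightarrow> self_adjoint T \<Longrightarrow> self_adjoint (S - T)"
  by (intro self_adjointI) (simp add: blinfun.bilinear_simps inner_simps self_adjointD)

lemma self_adjoint_scaleR: "self_adjoint T \<Longrightarrow> self_adjoint (c *\<^sub>R T)"
  by (intro self_adjointI) (simp add: blinfun.bilinear_simps self_adjointD)

lemma self_adjoint_id: "self_adjoint id_blinfun"
  by (intro self_adjointI) simp

lemma self_adjoint_zero: "self_adjoint 0"
  by (intro self_adjointI) simp

lemma self_adjoint_compose_commuting:
  "self_adjoint S \<Longrightarrow> self_adjoint T \<Longrightarrow> S o\<^sub>L T = T o\<^sub>L S \<Longrightarrow> self_adjoint (S o\<^sub>L T)"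
  by (intro self_adjointI) (metis blinfun_apply_blinfun_compose self_adjointD)

lemma self_adjoint_conj:
  "self_adjoint S \<Longrightarrow> self_adjoint T \<Longrightarrow> self_adjoint (S o\<^sub>L T o\<^sub>L S)"
  by (intro self_adjointI) (simp add: self_adjointD)

text \<open>Evaluate the nonnegative form at \<open>x - t T x\<close> with \<open>t = 1 / \<parallel>T\<parallel>\<close>. This replaces the Cauchy--Schwarz
  inequality for the form of \<open>T\<close>.\<close>

lemma norm_sq_le_psd:
  assumes "self_adjoint T" "psd_on UNIV T"
  shows "(norm (blinfun_apply T x))\<^sup>2 \<le> norm T * (blinfun_apply T x \<bullet> x)"
proof -
  define t where "t = inverse (norm T)"
  have nn: "0 \<le> T (x - t *\<^sub>R T x) \<bullet> (x - t *\<^sub>R T x)"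
    using assms(2) by (auto simp: psd_on_def)
  have "T (T x) \<bullet> T x \<le> norm T * (norm (T x))\<^sup>2"
    unfolding power2_eq_square
    by (metis (no_types, opaque_lifting) norm_cauchy_schwarz norm_blinfun norm_ge_zero
        mult.assoc mult_right_mono order_trans)
  then have "t * t * (T (T x) \<bullet> T x) \<le> t * t * (norm T * (norm (T x))\<^sup>2)"
    by (rule mult_left_mono) simp
  also have "\<dots> \<le> t * (norm (T x))\<^sup>2"
    by (cases "T = 0") (auto simp: t_def field_simps)
  finally have "0 \<le> T x \<bullet> x - t * (norm (T x))\<^sup>2"
    using nn self_adjointD[OF assms(1), of "T x" x]
    by (simp add: blinfun.bilinear_simps inner_simps inner_commute power2_norm_eq_inner algebra_simps)
  then show ?thesis
    by (cases "T = 0") (auto simp: t_def field_simps)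
qed

lemma psd_form_zero:
  assumes "self_adjoint T" "psd_on UNIV T" "blinfun_apply T x \<bullet> x = 0"
  shows "blinfun_apply T x = 0"
  using norm_sq_le_psd[OF assms(1,2), of x] assms(3) by simp

text \<open>For small \<open>t\<close> the map \<open>x \<mapsto> x - t (T x - y)\<close> is a contraction, and its fixed point solves \<open>T x = y\<close>.\<close>

lemma strongly_monotone_bij:
  assumes "strongly_monotone_on UNIV T"
  shows "bij (blinfun_apply T)"
proof -
  obtain \<alpha> where \<alpha>: "\<alpha> > 0" "\<And>x. T x \<bullet> x \<ge> \<alpha> * (norm x)\<^sup>2"
    using assms by (auto simp: strongly_monotone_on_def)
  define K where "K = norm T + \<alpha>"
  have K: "K > 0" "\<alpha> \<le> K"
    using \<alpha> by (auto simp: K_def add_nonneg_pos)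
  \<comment> \<open>this step length minimises the bound \<open>1 - 2 t \<alpha> + t\<^sup>2 K\<^sup>2\<close> on the squared contraction factor\<close>
  define t where "t = \<alpha> / K\<^sup>2"
  define q where "q = sqrt (1 - \<alpha>\<^sup>2 / K\<^sup>2)"
  have q01: "\<alpha>\<^sup>2 / K\<^sup>2 \<le> 1" "\<alpha>\<^sup>2 / K\<^sup>2 > 0"
    using K \<alpha> by (auto simp: divide_le_eq_1 power_mono)
  then have q: "0 \<le> q" "q < 1" "q\<^sup>2 = 1 - \<alpha>\<^sup>2 / K\<^sup>2"
    by (auto simp: q_def)
  have contr: "norm (x - t *\<^sub>R T x) \<le> q * norm x" for x
  proof -
    have "norm (T x) \<le> K * norm x"
      using norm_blinfun[of T x] \<alpha>(1) unfolding K_def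
      by (smt (verit) mult_right_mono norm_ge_zero)
    then have "(norm (T x))\<^sup>2 \<le> K\<^sup>2 * (norm x)\<^sup>2"
      by (metis norm_ge_zero power_mono power_mult_distrib)
    then have "t\<^sup>2 * (norm (T x))\<^sup>2 \<le> t\<^sup>2 * (K\<^sup>2 * (norm x)\<^sup>2)"
      by (rule mult_left_mono) simp
    moreover have "t * (\<alpha> * (norm x)\<^sup>2) \<le> t * (T x \<bullet> x)"
      using \<alpha> K by (intro mult_left_mono) (auto simp: t_def)
    moreover have "(norm (x - t *\<^sub>R T x))\<^sup>2 = (norm x)\<^sup>2 - 2 * (t * (T x \<bullet> x)) + t\<^sup>2 * (norm (T x))\<^sup>2"
      unfolding power2_norm_eq_inner
      by (simp add: inner_simps inner_commute algebra_simps power2_eq_square)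
    ultimately have "(norm (x - t *\<^sub>R T x))\<^sup>2
        \<le> (norm x)\<^sup>2 - 2 * (t * (\<alpha> * (norm x)\<^sup>2)) + t\<^sup>2 * (K\<^sup>2 * (norm x)\<^sup>2)"
      by linarith
    also have "\<dots> = q\<^sup>2 * (norm x)\<^sup>2"
      using K unfolding q(3) by (simp add: t_def field_simps power2_eq_square)
    finally show ?thesis
      using q(1) by (metis mult_nonneg_nonneg norm_ge_zero power2_le_imp_le power_mult_distrib)
  qed
  have "\<exists>!x. x - t *\<^sub>R (T x - y) = x" for y
  proof (rule banach_fix_type[of q])
    show "\<forall>a b. dist (a - t *\<^sub>R (T a - y)) (b - t *\<^sub>R (T b - y)) \<le> q * dist a b"
    proof (intro allI)
      fix a b
      have "(a - t *\<^sub>R (T a - y)) - (b - t *\<^sub>R (T b - y)) = (a - b) - t *\<^sub>R T (a - b)"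
        by (simp add: blinfun.bilinear_simps algebra_simps)
      then show "dist (a - t *\<^sub>R (T a - y)) (b - t *\<^sub>R (T b - y)) \<le> q * dist a b"
        using contr[of "a - b"] by (simp only: dist_norm)
    qed
  qed (use q in auto)
  moreover have "t \<noteq> 0"
    using \<alpha> K by (simp add: t_def)
  ultimately have "\<exists>!x. T x = y" for y
    by simp
  then show ?thesis
    by (metis bij_iff)
qed

lemma strongly_monotone_inverse:
  assumes "strongly_monotone_on UNIV T"
  obtains G where "T o\<^sub>L G = id_blinfun" "G o\<^sub>L T = id_blinfun" "blinfun_apply G = inv (blinfun_apply T)"
proof -
  obtain \<alpha> where \<alpha>: "\<alpha> > 0" "\<And>x. T x \<bullet> x \<ge> \<alpha> * (norm x)\<^sup>2"
    using assms by (auto simp: strongly_monotone_on_def)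
  define g where "g = inv (blinfun_apply T)"
  have bij: "bij (blinfun_apply T)"
    by (rule strongly_monotone_bij[OF assms])
  then have Tg: "T (g y) = y" and gT: "g (T x) = x" for x y
    by (simp_all add: g_def bij_is_surj surj_f_inv_f bij_is_inj)
  have lin: "bounded_linear g"
  proof (rule bounded_linear_intro[where K = "1 / \<alpha>"])
    show "g (a + b) = g a + g b" for a b
      by (metis Tg gT blinfun.add_right)
    show "g (r *\<^sub>R a) = r *\<^sub>R g a" for r a
      by (metis Tg gT blinfun.scaleR_right)
    show "norm (g a) \<le> norm a * (1 / \<alpha>)" for a
    proof -
      have "\<alpha> * (norm (g a))\<^sup>2 \<le> norm a * norm (g a)"
        using \<alpha>(2)[of "g a"] norm_cauchy_schwarz[of a "g a"] by (simp add: Tg)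
      then show ?thesis
        using \<alpha>(1) by (cases "g a = 0") (auto simp: field_simps power2_eq_square)
    qed
  qed
  show thesis
    by (rule that[of "Blinfun g"])
      (auto intro!: blinfun_eqI simp: bounded_linear_Blinfun_apply lin Tg gT g_def[symmetric])
qed

text \<open>Uniform boundedness for functionals \<open>\<langle>y, \<cdot>\<rangle>\<close>: by Baire's theorem, one of the closed sets on which they
  are bounded by \<open>n\<close> contains a ball.\<close>

lemma weakly_bounded_imp_bounded:
  fixes Y :: "'a::{real_inner,banach} set"
  assumes "\<And>v. \<exists>B. \<forall>y\<in>Y. \<bar>y \<bullet> v\<bar> \<le> B"
  shows "bounded Y"
proof -
  define F where "F n = {v. \<forall>y\<in>Y. \<bar>y \<bullet> v\<bar> \<le> real n}" for n
  have clF: "closed (F n)" for n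
  proof -
    have "F n = (\<Inter>y\<in>Y. {v. \<bar>y \<bullet> v\<bar> \<le> real n})"
      by (auto simp: F_def)
    then show ?thesis
      by (auto intro!: closed_INT closed_Collect_le continuous_intros)
  qed
  have cover: "\<Union>(range F) = UNIV"
  proof -
    have "\<exists>n. v \<in> F n" for v
    proof -
      obtain B where "\<forall>y\<in>Y. \<bar>y \<bullet> v\<bar> \<le> B"
        using assms by blast
      moreover obtain n where "B \<le> real n"
        using real_arch_simple by blast
      ultimately show ?thesis
        unfolding F_def by (blast intro: order_trans)
    qed
    then show ?thesis by blast
  qed
  have "\<exists>n. interior (F n) \<noteq> {}"
  proof (rule ccontr)
    assume "\<not> ?thesis"
    then have "euclidean interior_of \<Union>(range F) = {}"
      by (intro Baire_category_alt) (auto simp: clF completely_metrizable_space_euclidean)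
    then show False
      by (simp add: cover)
  qed
  then obtain n c e where e: "e > 0" "cball c e \<subseteq> F n"
    by (metis all_not_in_conv mem_interior_cball)
  have "norm y \<le> 2 * real n / e" if "y \<in> Y" for y
  proof (cases "y = 0")
    case False
    define v where "v = (e / norm y) *\<^sub>R y"
    have "c + v \<in> F n" "c \<in> F n"
      using e False by (auto simp: v_def subset_iff dist_norm)
    then have "\<bar>y \<bullet> (c + v)\<bar> \<le> n" "\<bar>y \<bullet> c\<bar> \<le> n"
      using that by (auto simp: F_def)
    moreover have "y \<bullet> v = e * norm y"
      using False by (simp add: v_def power2_norm_eq_inner[symmetric] power2_eq_square)
    ultimately have "e * norm y \<le> 2 * real n"
      by (simp add: inner_simps)
    then show ?thesis
      using e by (simp add: field_simps)
  qed (use e in auto)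
  then show ?thesis
    by (auto simp: bounded_iff)
qed

section \<open>Orthogonal projectors and pseudo-inverses\<close>

lemma orthogonal_comp_disjoint: "x \<in> S \<Longrightarrow> x \<in> S\<^sup>\<bottom> \<Longrightarrow> x = 0"
  by (metis inner_eq_zero_iff orthogonal_comp_iff)

text \<open>The projections onto a closed subspace given by the projection theorem are linear, because the
  decomposition is unique; this makes the description in \<^const>\<open>orth_proj\<close> proper.\<close>

lemma orth_proj:
  fixes S :: "'a::{real_inner,banach} set"
  assumes S: "subspace S" "closed S"
  shows "blinfun_apply (orth_proj S) x \<in> S" "x - orth_proj S x \<in> S\<^sup>\<bottom>"
proof -
  have "\<exists>p. p \<in> S \<and> x - p \<in> S\<^sup>\<bottom>" for x
    using closed_subspace_decomposition[OF S] by metis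
  then obtain q where q: "\<And>x. q x \<in> S" "\<And>x. x - q x \<in> S\<^sup>\<bottom>"
    by metis
  have uniq: "q x = p" if p: "p \<in> S" "x - p \<in> S\<^sup>\<bottom>" for x p
  proof -
    have "p - q x \<in> S"
      using S(1) p q subspace_diff by blast
    moreover have "(x - q x) - (x - p) \<in> S\<^sup>\<bottom>"
      by (rule subspace_diff[OF subspace_orthogonal_comp q(2) p(2)])
    ultimately have "p - q x = 0"
      by (intro orthogonal_comp_disjoint) auto
    then show ?thesis by simp
  qed
  have "bounded_linear q"
  proof (rule bounded_linear_intro[where K = 1])
    show "q (a + b) = q a + q b" for a b
    proof (rule uniq)
      have "(a - q a) + (b - q b) \<in> S\<^sup>\<bottom>"
        using q by (intro subspace_add subspace_orthogonal_comp)
      then show "a + b - (q a + q b) \<in> S\<^sup>\<bottom>"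
        by (simp add: algebra_simps)
    qed (use q S in \<open>auto intro: subspace_add\<close>)
    show "q (r *\<^sub>R a) = r *\<^sub>R q a" for r a
    proof (rule uniq)
      have "r *\<^sub>R (a - q a) \<in> S\<^sup>\<bottom>"
        using q by (intro subspace_scale subspace_orthogonal_comp)
      then show "r *\<^sub>R a - r *\<^sub>R q a \<in> S\<^sup>\<bottom>"
        by (simp add: algebra_simps)
    qed (use q S in \<open>auto intro: subspace_scale\<close>)
    show "norm (q a) \<le> norm a * 1" for a
    proof -
      have "(norm (q a))\<^sup>2 = q a \<bullet> a"
        using q(1,2)[of a] by (auto simp: orthogonal_comp_iff inner_diff power2_norm_eq_inner)
      also have "\<dots> \<le> norm (q a) * norm a"
        by (rule norm_cauchy_schwarz)
      finally show ?thesis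
        by (cases "q a = 0") (auto simp: power2_eq_square)
    qed
  qed
  then have q': "blinfun_apply (Blinfun q) = q"
    by (rule bounded_linear_Blinfun_apply)
  have "orth_proj S = Blinfun q"
    unfolding orth_proj_def
  proof (rule the_equality)
    show "\<forall>x. blinfun_apply (Blinfun q) x \<in> S \<and> x - blinfun_apply (Blinfun q) x \<in> S\<^sup>\<bottom>"
      by (simp add: q q')
    show "Q = Blinfun q" if "\<forall>x. blinfun_apply Q x \<in> S \<and> x - blinfun_apply Q x \<in> S\<^sup>\<bottom>" for Q
      using that by (intro blinfun_eqI) (metis q' uniq)
  qed
  then show "orth_proj S x \<in> S" "x - orth_proj S x \<in> S\<^sup>\<bottom>"
    by (simp_all add: q q')
qed

lemma orth_proj_eqI:
  assumes S: "subspace S" "closed S" and p: "p \<in> S" "x - p \<in> S\<^sup>\<bottom>"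
  shows "blinfun_apply (orth_proj S) x = p"
proof -
  have "orth_proj S x - p \<in> S"
    using orth_proj[OF S] p S subspace_diff by blast
  moreover have "(x - p) - (x - orth_proj S x) \<in> S\<^sup>\<bottom>"
    by (rule subspace_diff[OF subspace_orthogonal_comp p(2) orth_proj(2)[OF S]])
  ultimately have "orth_proj S x - p = 0"
    by (intro orthogonal_comp_disjoint) auto
  then show ?thesis by simp
qed

lemma orth_proj_orthogonal_comp:
  assumes S: "subspace S" "closed S"
  shows "blinfun_apply (orth_proj (S\<^sup>\<bottom>)) x = x - orth_proj S x"
  using orth_proj[OF S, of x] S
  by (intro orth_proj_eqI) (auto simp: subspace_orthogonal_comp closed_orthogonal_comp orthogonal_comp_comp)

lemma self_adjoint_orth_proj:
  assumes S: "subspace S" "closed S"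
  shows "self_adjoint (orth_proj S)"
proof (rule self_adjointI)
  fix x y
  have "orth_proj S y \<bullet> (x - orth_proj S x) = 0" "orth_proj S x \<bullet> (y - orth_proj S y) = 0"
    using orth_proj[OF S] by (auto simp: orthogonal_comp_iff)
  then show "orth_proj S y \<bullet> x = y \<bullet> orth_proj S x"
    by (simp add: inner_simps inner_commute)
qed

lemma subspace_kernel: "subspace (kernel T)"
  by (simp add: kernel_def subspace_def blinfun.bilinear_simps)

lemma closed_kernel: "closed (kernel T)"
  unfolding kernel_def by (intro closed_Collect_eq continuous_intros)

text \<open>Both \<open>T S\<close> and \<open>T S'\<close> are the orthogonal projector onto the range of \<open>T\<close>, and \<open>S T\<close> and \<open>S' T\<close> that onto
  the orthogonal complement of its kernel.\<close>

lemma penrose_unique: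
  fixes T :: "'a::{real_inner,banach} \<Rightarrow>\<^sub>L 'a"
  assumes "T o\<^sub>L S o\<^sub>L T = T" "S o\<^sub>L T o\<^sub>L S = S" "self_adjoint (T o\<^sub>L S)" "self_adjoint (S o\<^sub>L T)"
    and "T o\<^sub>L S' o\<^sub>L T = T" "S' o\<^sub>L T o\<^sub>L S' = S'" "self_adjoint (T o\<^sub>L S')" "self_adjoint (S' o\<^sub>L T)"
  shows "S = S'"
proof -
  have e: "T (S (T x)) = T x" "S (T (S x)) = S x" "T (S' (T x)) = T x" "S' (T (S' x)) = S' x" for x
    using assms by (metis blinfun_apply_blinfun_compose)+
  have sa: "T (S y) \<bullet> x = y \<bullet> T (S x)" "S (T y) \<bullet> x = y \<bullet> S (T x)"
    "T (S' y) \<bullet> x = y \<bullet> T (S' x)" "S' (T y) \<bullet> x = y \<bullet> S' (T x)" for x y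
    using self_adjointD[OF assms(3), of y x] self_adjointD[OF assms(4), of y x]
      self_adjointD[OF assms(7), of y x] self_adjointD[OF assms(8), of y x] by simp_all
  have TS: "T (S x) = T (S' x)" for x
  proof (rule vector_eq_rdot[THEN iffD1], rule allI)
    fix y
    have "T (S x) \<bullet> y = T (S' (T (S x))) \<bullet> y" by (simp add: e)
    also have "\<dots> = x \<bullet> T (S (T (S' y)))" by (simp only: sa)
    also have "\<dots> = T (S' x) \<bullet> y" by (simp add: e sa)
    finally show "T (S x) \<bullet> y = T (S' x) \<bullet> y" .
  qed
  have ST: "S (T x) = S' (T x)" for x
  proof (rule vector_eq_rdot[THEN iffD1], rule allI)
    fix y
    have "S (T x) \<bullet> y = S (T (S' (T x))) \<bullet> y" by (simp add: e)
    also have "\<dots> = x \<bullet> S' (T (S (T y)))" by (simp only: sa)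
    also have "\<dots> = S' (T x) \<bullet> y" by (simp add: e sa)
    finally show "S (T x) \<bullet> y = S' (T x) \<bullet> y" .
  qed
  show ?thesis
    by (rule blinfun_eqI) (metis ST TS e(2,4))
qed

text \<open>Let \<open>Q\<close> be the projector onto \<open>(kernel T)\<^sup>\<bottom>\<close>. Then \<open>T\<^sup>2 + (1 - Q)\<close> is strongly monotone, hence
  boundedly invertible, and commutes with \<open>T\<close>. Multiplying its inverse by \<open>T\<close> gives a solution of the
  Penrose equations.\<close>

lemma pseudo_inverse_self_adjoint:
  fixes T :: "'a::{real_inner,banach} \<Rightarrow>\<^sub>L 'a"
  assumes T: "self_adjoint T" and "c > 0"
    and below: "\<And>x. x \<in> (kernel T)\<^sup>\<bottom> \<Longrightarrow> c * norm x \<le> norm (T x)"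
  shows "self_adjoint (pseudo_inverse T)"
    and "T (pseudo_inverse T x) = pseudo_inverse T (T x)"
    and "T (pseudo_inverse T (T x)) = T x"
    and "pseudo_inverse T (T (pseudo_inverse T x)) = pseudo_inverse T x"
    and "x \<in> (kernel T)\<^sup>\<bottom> \<Longrightarrow> pseudo_inverse T (T x) = x"
    and "pseudo_inverse T x \<in> (kernel T)\<^sup>\<bottom>"
proof -
  define Q where "Q = orth_proj ((kernel T)\<^sup>\<bottom>)"
  have Qx: "Q x = x - orth_proj (kernel T) x" for x
    by (simp add: Q_def orth_proj_orthogonal_comp subspace_kernel closed_kernel)
  have Qsa: "self_adjoint Q"
    by (simp add: Q_def self_adjoint_orth_proj subspace_orthogonal_comp closed_orthogonal_comp)
  have Qin: "Q x \<in> (kernel T)\<^sup>\<bottom>" for x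
    by (simp add: Q_def orth_proj subspace_orthogonal_comp closed_orthogonal_comp)
  have TQ: "T (Q x) = T x" for x
    using orth_proj(1)[OF subspace_kernel closed_kernel, of T x]
    by (simp add: Qx blinfun.bilinear_simps kernel_def)
  have QT: "Q (T x) = T x" for x
    by (rule vector_eq_rdot[THEN iffD1]) (metis Qsa T TQ self_adjointD)
  have QQ: "Q x = x" if "x \<in> (kernel T)\<^sup>\<bottom>" for x
    unfolding Q_def using that
    by (intro orth_proj_eqI)
      (auto simp: subspace_orthogonal_comp closed_orthogonal_comp orthogonal_comp_iff)
  define K where "K = (T o\<^sub>L T) + (id_blinfun - Q)"
  have Kx: "K x = T (T x) + x - Q x" for x
    by (simp add: K_def blinfun.bilinear_simps)
  have "strongly_monotone_on UNIV K"
    unfolding strongly_monotone_on_def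
  proof (intro exI[of _ "min (c\<^sup>2) 1"] conjI ballI)
    fix x
    have orth: "Q x \<bullet> (x - Q x) = 0"
      using Qsa QQ[OF Qin] by (simp add: inner_diff_right) (metis self_adjointD)
    have "(norm x)\<^sup>2 = (norm (Q x))\<^sup>2 + (norm (x - Q x))\<^sup>2"
      using orth unfolding power2_norm_eq_inner by (simp add: inner_simps inner_commute)
    moreover have "K x \<bullet> x = (norm (T x))\<^sup>2 + (norm (x - Q x))\<^sup>2"
      using orth self_adjointD[OF T, of "T x" x] unfolding power2_norm_eq_inner
      by (simp add: Kx inner_simps inner_commute)
    moreover have "c\<^sup>2 * (norm (Q x))\<^sup>2 \<le> (norm (T x))\<^sup>2"
      using below[OF Qin, of x] \<open>c > 0\<close> power_mono[of "c * norm (Q x)" "norm (T x)" 2]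
      by (simp add: TQ power_mult_distrib)
    moreover have "min (c\<^sup>2) 1 * (norm (Q x))\<^sup>2 \<le> c\<^sup>2 * (norm (Q x))\<^sup>2"
      "min (c\<^sup>2) 1 * (norm (x - Q x))\<^sup>2 \<le> 1 * (norm (x - Q x))\<^sup>2"
      by (intro mult_right_mono; simp)+
    ultimately show "min (c\<^sup>2) 1 * (norm x)\<^sup>2 \<le> K x \<bullet> x"
      by (simp add: distrib_left)
  qed (use \<open>c > 0\<close> in auto)
  then obtain G where G: "K o\<^sub>L G = id_blinfun" "G o\<^sub>L K = id_blinfun"
    by (rule strongly_monotone_inverse)
  have KG: "K (G x) = x" and GK: "G (K x) = x" for x
    by (metis G blinfun_apply_blinfun_compose blinfun_apply_id_blinfun id_apply)+
  have KT: "K (T x) = T (K x)" for x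
    by (simp add: Kx blinfun.bilinear_simps QT TQ)
  have GT: "G (T x) = T (G x)" for x
    by (metis GK KG KT)
  have Ksa: "K y \<bullet> x = y \<bullet> K x" for x y
    by (simp add: Kx inner_simps self_adjointD[OF T] self_adjointD[OF Qsa])
  have Gsa: "G y \<bullet> x = y \<bullet> G x" for x y
    by (metis KG Ksa)
  define S where "S = T o\<^sub>L G"
  have Sx: "S x = T (G x)" for x by (simp add: S_def)
  have TTG: "T (T (G x)) = Q x" for x
  proof -
    have "Q (K (G x)) = T (T (G x))"
      by (simp add: Kx blinfun.bilinear_simps QT QQ[OF Qin])
    then show ?thesis by (simp add: KG)
  qed
  have TS: "T (S x) = Q x" and ST: "S (T x) = Q x" for x
    by (simp_all add: Sx GT TTG)
  have SQ: "Q (S x) = S x" for x by (simp add: Sx QT)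
  have SQ2: "S (Q x) = S x" for x by (metis SQ ST TS)
  have comp: "T o\<^sub>L S = Q" "S o\<^sub>L T = Q"
    by (auto intro!: blinfun_eqI simp: TS ST)
  have pen: "T o\<^sub>L S o\<^sub>L T = T" "S o\<^sub>L T o\<^sub>L S = S" "self_adjoint (T o\<^sub>L S)" "self_adjoint (S o\<^sub>L T)"
    unfolding comp by (auto intro!: blinfun_eqI simp: Qsa QT SQ)
  have S: "pseudo_inverse T = S"
    unfolding pseudo_inverse_def
    by (rule the_equality) (use pen in \<open>auto intro: penrose_unique[OF _ _ _ _ pen]\<close>)
  show "self_adjoint (pseudo_inverse T)"
    unfolding S by (intro self_adjointI) (simp add: Sx Gsa self_adjointD[OF T] flip: GT)
  show "T (pseudo_inverse T x) = pseudo_inverse T (T x)"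
    "T (pseudo_inverse T (T x)) = T x"
    "pseudo_inverse T (T (pseudo_inverse T x)) = pseudo_inverse T x"
    "pseudo_inverse T x \<in> (kernel T)\<^sup>\<bottom>"
    using Qin[of "S x"] by (simp_all add: S TS ST TQ SQ SQ2)
  show "pseudo_inverse T (T x) = x" if "x \<in> (kernel T)\<^sup>\<bottom>"
    using that by (simp add: S ST QQ)
qed

lemma subspace_ran: "subspace (ran T)"
  unfolding ran_def subspace_def
  by (auto simp flip: blinfun.add_right blinfun.scaleR_right) (metis blinfun.zero_right rangeI)

text \<open>The vectors \<open>y\<close> orthogonal to the kernel with \<open>\<parallel>T y\<parallel> \<le> 1\<close> are weakly bounded: a vector \<open>v\<close> differs
  from some \<open>T u\<close> by an element of the kernel, so that \<open>\<langle>y, v\<rangle> = \<langle>T y, u\<rangle>\<close>.\<close>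

lemma closed_range_bounded_below:
  fixes T :: "'a::{real_inner,banach} \<Rightarrow>\<^sub>L 'a"
  assumes T: "self_adjoint T" and cl: "closed (ran T)"
  obtains c where "c > 0" "\<And>x. x \<in> (kernel T)\<^sup>\<bottom> \<Longrightarrow> c * norm x \<le> norm (T x)"
proof -
  note sub = subspace_ran[of T]
  define Y where "Y = {y \<in> (kernel T)\<^sup>\<bottom>. norm (T y) \<le> 1}"
  have "bounded Y"
  proof (rule weakly_bounded_imp_bounded)
    fix v
    obtain p where p: "p \<in> ran T" "v - p \<in> (ran T)\<^sup>\<bottom>"
      by (rule closed_subspace_decomposition[OF sub cl])
    then obtain u where u: "p = T u" by (auto simp: ran_def)
    have "x \<bullet> T (v - p) = 0" for x
      using p(2) by (simp add: orthogonal_comp_iff ran_def flip: self_adjointD[OF T])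
    then have "v - p \<in> kernel T"
      by (metis inner_eq_zero_iff kernel_def mem_Collect_eq)
    then have "y \<bullet> v = T y \<bullet> u" if "y \<in> Y" for y
      using that self_adjointD[OF T, of y u]
      by (auto simp: Y_def orthogonal_comp_iff inner_diff u inner_commute)
    moreover have "\<bar>T y \<bullet> u\<bar> \<le> norm u" if "y \<in> Y" for y
      using that Cauchy_Schwarz_ineq2[of "T y" u] mult_right_mono[of "norm (T y)" 1 "norm u"]
      by (auto simp: Y_def)
    ultimately show "\<exists>B. \<forall>y\<in>Y. \<bar>y \<bullet> v\<bar> \<le> B"
      by auto
  qed
  then obtain B where B: "B > 0" "\<And>y. y \<in> Y \<Longrightarrow> norm y \<le> B"
    by (auto simp: bounded_pos)
  show thesis
  proof (rule that[of "inverse B"])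
    fix x assume x: "x \<in> (kernel T)\<^sup>\<bottom>"
    show "inverse B * norm x \<le> norm (T x)"
    proof (cases "T x = 0")
      case True
      then have "x = 0"
        using x by (intro orthogonal_comp_disjoint[of _ "kernel T"]) (auto simp: kernel_def)
      then show ?thesis by simp
    next
      case False
      have "inverse (norm (T x)) *\<^sub>R x \<in> Y"
        using False x by (auto simp: Y_def blinfun.bilinear_simps intro: subspace_scale subspace_orthogonal_comp)
      then show ?thesis
        using B(1) B(2)[of "inverse (norm (T x)) *\<^sub>R x"] False by (simp add: field_simps)
    qed
  qed (use B in simp)
qed

section \<open>The positive square root\<close>

text \<open>The operator \<open>1 - Y\<close> is a square root of \<open>1 - R\<close>. The iteration \<open>Y \<mapsto> (R + Y\<^sup>2) / 2\<close> from \<open>0\<close> is dominated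
  step by step by the scalar iteration \<open>t \<mapsto> (1 + t\<^sup>2) / 2\<close>, which increases to \<open>1\<close>; hence it converges in
  operator norm. Its members are polynomials in \<open>R\<close>, so the limit commutes with whatever commutes with \<open>R\<close>.\<close>

lemma contraction_sqrt:
  fixes R :: "'a::{real_inner,banach} \<Rightarrow>\<^sub>L 'a"
  assumes R: "self_adjoint R" "norm R \<le> 1"
  obtains Y where "self_adjoint Y" "norm Y \<le> 1" "2 *\<^sub>R Y = R + (Y o\<^sub>L Y)"
    "\<And>C. C o\<^sub>L R = R o\<^sub>L C \<Longrightarrow> C o\<^sub>L Y = Y o\<^sub>L C"
proof -
  define Y where "Y = rec_nat 0 (\<lambda>_ Y. (1/2) *\<^sub>R (R + (Y o\<^sub>L Y)))"
  define t :: "nat \<Rightarrow> real" where "t = rec_nat 0 (\<lambda>_ t. (1/2) * (1 + t * t))"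
  have Y: "Y 0 = 0" "Y (Suc n) = (1/2) *\<^sub>R (R + (Y n o\<^sub>L Y n))" for n
    by (simp_all add: Y_def)
  have t: "t 0 = 0" "t (Suc n) = (1/2) * (1 + t n * t n)" for n
    by (simp_all add: t_def)
  have t01: "0 \<le> t n \<and> t n \<le> 1" for n
    by (induction n) (auto simp: t mult_le_one)
  have normY: "norm (Y n) \<le> t n" for n
  proof (induction n)
    case (Suc n)
    have "norm (Y n o\<^sub>L Y n) \<le> t n * t n"
      using Suc t01 by (meson mult_mono norm_blinfun_compose norm_ge_zero order_trans)
    then show ?case
      using R(2) norm_triangle_ineq[of R "Y n o\<^sub>L Y n"] by (simp add: Y t)
  qed (simp add: Y t)
  have t_mono: "t n \<le> t (Suc n)" for n
    using zero_le_power2[of "1 - t n"] by (simp add: t power2_eq_square algebra_simps)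
  have Y_step: "norm (Y (Suc n) - Y n) \<le> t (Suc n) - t n" for n
  proof (induction n)
    case 0
    then show ?case using R(2) by (simp add: Y t)
  next
    case (Suc n)
    let ?D = "Y (Suc n) - Y n"
    have "Y (Suc (Suc n)) - Y (Suc n) = (1/2) *\<^sub>R ((?D o\<^sub>L Y (Suc n)) + (Y n o\<^sub>L ?D))"
      by (intro blinfun_eqI) (simp add: Y(2)[of "Suc n"] Y(2)[of n] blinfun.bilinear_simps algebra_simps)
    moreover have "norm (?D o\<^sub>L Y (Suc n)) \<le> (t (Suc n) - t n) * t (Suc n)"
      using Suc normY t01 t_mono
      by (intro order_trans[OF norm_blinfun_compose] mult_mono) auto
    moreover have "norm (Y n o\<^sub>L ?D) \<le> t n * (t (Suc n) - t n)"
      using Suc normY t01 by (intro order_trans[OF norm_blinfun_compose] mult_mono) auto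
    ultimately have "norm (Y (Suc (Suc n)) - Y (Suc n)) \<le> (1/2) * ((t (Suc n) - t n) * t (Suc n) + t n * (t (Suc n) - t n))"
      using norm_triangle_ineq[of "?D o\<^sub>L Y (Suc n)" "Y n o\<^sub>L ?D"] by simp
    also have "\<dots> = t (Suc (Suc n)) - t (Suc n)"
      by (simp add: t(2)[of "Suc n"] t(2)[of n] algebra_simps)
    finally show ?case .
  qed
  have Y_dist: "norm (Y (n + k) - Y n) \<le> t (n + k) - t n" for n k
  proof (induction k)
    case (Suc k)
    then show ?case
      using Y_step[of "n + k"] norm_triangle_ineq[of "Y (Suc (n + k)) - Y (n + k)" "Y (n + k) - Y n"]
      by simp
  qed simp
  have "incseq t" using t_mono by (rule incseq_SucI)
  then have "convergent t"
    using t01 by (metis incseq_convergent convergent_def)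
  then have "Cauchy t" by (simp add: convergent_Cauchy)
  have "Cauchy Y"
  proof (rule CauchyI)
    fix e :: real assume "e > 0"
    then obtain N where N: "\<And>m n. m \<ge> N \<Longrightarrow> n \<ge> N \<Longrightarrow> norm (t m - t n) < e"
      using CauchyD[OF \<open>Cauchy t\<close>] by blast
    have le: "norm (Y m - Y n) < e" if "n \<ge> N" "m \<ge> n" for m n
      using Y_dist[of n "m - n"] N[of m n] that by simp
    show "\<exists>M. \<forall>m\<ge>M. \<forall>n\<ge>M. norm (Y m - Y n) < e"
      by (metis le norm_minus_commute linear)
  qed
  then obtain Z where Z: "Y \<longlonglongrightarrow> Z"
    using Cauchy_convergent convergent_def by blast
  have comm: "C o\<^sub>L Y n = Y n o\<^sub>L C" if "C o\<^sub>L R = R o\<^sub>L C" for C n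
  proof (induction n)
    case (Suc n)
    have "C (Y n x) = Y n (C x)" "C (R x) = R (C x)" for x
      using Suc that by (metis blinfun_apply_blinfun_compose)+
    then show ?case
      by (intro blinfun_eqI) (simp add: Y blinfun.bilinear_simps)
  qed (simp add: Y)
  have saY: "self_adjoint (Y n)" for n
    by (induction n) (auto simp: Y self_adjoint_zero intro!: self_adjoint_scaleR self_adjoint_add R self_adjoint_compose_commuting)
  show thesis
  proof (rule that[of Z])
    show "self_adjoint Z"
    proof (rule self_adjointI)
      fix x y
      have "(\<lambda>n. Y n y \<bullet> x) \<longlonglongrightarrow> Z y \<bullet> x" "(\<lambda>n. y \<bullet> Y n x) \<longlonglongrightarrow> y \<bullet> Z x"
        by (intro tendsto_intros Z)+
      then show "Z y \<bullet> x = y \<bullet> Z x"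
        using self_adjointD[OF saY] LIMSEQ_unique by fastforce
    qed
    show "norm Z \<le> 1"
      using normY t01 by (intro LIMSEQ_le_const2[OF tendsto_norm[OF Z]]) (metis order_trans)
    have "(\<lambda>n. 2 *\<^sub>R Y (Suc n)) \<longlonglongrightarrow> 2 *\<^sub>R Z"
      by (intro tendsto_intros LIMSEQ_Suc Z)
    moreover have "(\<lambda>n. R + (Y n o\<^sub>L Y n)) \<longlonglongrightarrow> R + (Z o\<^sub>L Z)"
      by (intro tendsto_intros bounded_bilinear.tendsto[OF bounded_bilinear_blinfun_compose] Z)
    ultimately show "2 *\<^sub>R Z = R + (Z o\<^sub>L Z)"
      by (simp add: Y LIMSEQ_unique)
    show "C o\<^sub>L Z = Z o\<^sub>L C" if "C o\<^sub>L R = R o\<^sub>L C" for C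
    proof -
      have "(\<lambda>n. C o\<^sub>L Y n) \<longlonglongrightarrow> (C o\<^sub>L Z)" "(\<lambda>n. Y n o\<^sub>L C) \<longlonglongrightarrow> (Z o\<^sub>L C)"
        by (intro tendsto_intros bounded_bilinear.tendsto[OF bounded_bilinear_blinfun_compose] Z)+
      then show ?thesis
        by (simp add: comm[OF that] LIMSEQ_unique)
    qed
  qed
qed

text \<open>After scaling, \<open>R = 1 - T / k\<close> is a contraction by the estimate \<open>\<parallel>T x\<parallel>\<^sup>2 \<le> \<parallel>T\<parallel> \<langle>T x, x\<rangle>\<close>. The commutation
  property is what uniqueness needs.\<close>

lemma sqrt_exists:
  fixes T :: "'a::{real_inner,banach} \<Rightarrow>\<^sub>L 'a"
  assumes T: "self_adjoint T" "psd_on UNIV T"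
  obtains S where "self_adjoint S" "psd_on UNIV S" "S o\<^sub>L S = T"
    "\<And>C. C o\<^sub>L T = T o\<^sub>L C \<Longrightarrow> C o\<^sub>L S = S o\<^sub>L C"
proof -
  define k where "k = norm T + 1"
  have k: "k > 0" "norm T \<le> k"
    by (auto simp: k_def add_nonneg_pos)
  define R where "R = id_blinfun - (1 / k) *\<^sub>R T"
  have Rx: "R x = x - (1/k) *\<^sub>R T x" for x
    by (simp add: R_def blinfun.bilinear_simps)
  have "self_adjoint R"
    by (simp add: R_def T self_adjoint_diff self_adjoint_id self_adjoint_scaleR)
  have "norm R \<le> 1"
  proof (rule norm_blinfun_bound)
    fix x
    have nn: "0 \<le> T x \<bullet> x"
      using T(2) by (auto simp: psd_on_def)
    have "(norm (T x))\<^sup>2 \<le> k * (T x \<bullet> x)"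
      using norm_sq_le_psd[OF T, of x] mult_right_mono[OF k(2) nn] by linarith
    then have "(1/k)\<^sup>2 * (norm (T x))\<^sup>2 \<le> (1/k) * (T x \<bullet> x)"
      using k by (simp add: field_simps power2_eq_square)
    moreover have "(norm (R x))\<^sup>2 = (norm x)\<^sup>2 - 2 * ((1/k) * (T x \<bullet> x)) + (1/k)\<^sup>2 * (norm (T x))\<^sup>2"
      unfolding power2_norm_eq_inner Rx
      by (simp add: inner_simps inner_commute power2_eq_square)
    moreover have "0 \<le> (1/k) * (T x \<bullet> x)"
      using nn k by simp
    ultimately have "(norm (R x))\<^sup>2 \<le> (norm x)\<^sup>2"
      by linarith
    then have "norm (R x) \<le> norm x"
      by (rule power2_le_imp_le) simp
    then show "norm (R x) \<le> 1 * norm x" by simp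
  qed simp
  with \<open>self_adjoint R\<close> obtain Y where Y: "self_adjoint Y" "norm Y \<le> 1" "2 *\<^sub>R Y = R + (Y o\<^sub>L Y)"
    "\<And>C. C o\<^sub>L R = R o\<^sub>L C \<Longrightarrow> C o\<^sub>L Y = Y o\<^sub>L C"
    by (rule contraction_sqrt) blast
  define S where "S = sqrt k *\<^sub>R (id_blinfun - Y)"
  have Sx: "S x = sqrt k *\<^sub>R (x - Y x)" for x
    by (simp add: S_def blinfun.bilinear_simps)
  show thesis
  proof (rule that[of S])
    show "self_adjoint S"
      by (simp add: S_def Y self_adjoint_diff self_adjoint_id self_adjoint_scaleR)
    show "psd_on UNIV S"
      unfolding psd_on_def
    proof
      fix x
      have "Y x \<bullet> x \<le> norm (Y x) * norm x"
        by (rule norm_cauchy_schwarz)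
      also have "\<dots> \<le> norm x * norm x"
        using norm_blinfun[of Y x] mult_right_mono[OF Y(2), of "norm x"]
        by (intro mult_right_mono) auto
      finally show "0 \<le> S x \<bullet> x"
        using k by (simp add: Sx inner_simps power2_norm_eq_inner[symmetric] power2_eq_square)
    qed
    show "S o\<^sub>L S = T"
    proof (rule blinfun_eqI)
      fix x
      have "2 *\<^sub>R Y x = R x + Y (Y x)"
        using arg_cong[OF Y(3), of "\<lambda>Z. blinfun_apply Z x"] by (simp add: blinfun.bilinear_simps)
      then have e: "Y (Y x) = Y x + Y x - x + (1/k) *\<^sub>R T x"
        by (simp add: Rx scaleR_2 algebra_simps)
      have "(S o\<^sub>L S) x = k *\<^sub>R (x - Y x - Y x + Y (Y x))"
        using k by (simp add: Sx blinfun.bilinear_simps algebra_simps)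
      also have "\<dots> = T x"
        using k by (simp add: e)
      finally show "(S o\<^sub>L S) x = T x" .
    qed
    show "C o\<^sub>L S = S o\<^sub>L C" if "C o\<^sub>L T = T o\<^sub>L C" for C
    proof -
      have "C (T x) = T (C x)" for x
        using that by (metis blinfun_apply_blinfun_compose)
      then have "C o\<^sub>L R = R o\<^sub>L C"
        by (intro blinfun_eqI) (simp add: Rx blinfun.bilinear_simps)
      then have "C o\<^sub>L Y = Y o\<^sub>L C" by (rule Y(4))
      then have "C (Y x) = Y (C x)" for x
        by (metis blinfun_apply_blinfun_compose)
      then show ?thesis
        by (intro blinfun_eqI) (simp add: Sx blinfun.bilinear_simps)
    qed
  qed
qed

text \<open>Uniqueness: another positive root \<open>Q\<close> commutes with \<open>T = Q\<^sup>2\<close>, hence with the root \<open>S\<close> constructed above.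
  On \<open>y = S x - Q x\<close> the sum \<open>S + Q\<close> vanishes, and therefore so do both nonnegative summands.\<close>

lemma sqrt_op:
  fixes T :: "'a::{real_inner,banach} \<Rightarrow>\<^sub>L 'a"
  assumes T: "self_adjoint T" "psd_on UNIV T"
  shows "self_adjoint (sqrt_op T)" "psd_on UNIV (sqrt_op T)" "sqrt_op T o\<^sub>L sqrt_op T = T"
proof -
  obtain S where S: "self_adjoint S" "psd_on UNIV S" "S o\<^sub>L S = T"
    "\<And>C. C o\<^sub>L T = T o\<^sub>L C \<Longrightarrow> C o\<^sub>L S = S o\<^sub>L C"
    by (rule sqrt_exists[OF T]) blast
  have "Q = S" if Q: "self_adjoint Q \<and> psd_on UNIV Q \<and> Q o\<^sub>L Q = T" for Q
  proof (rule blinfun_eqI)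
    fix x
    have "Q o\<^sub>L T = T o\<^sub>L Q"
      using Q by (intro blinfun_eqI) (metis blinfun_apply_blinfun_compose)
    then have "Q o\<^sub>L S = S o\<^sub>L Q" by (rule S(4))
    then have QS: "Q (S u) = S (Q u)" for u
      by (metis blinfun_apply_blinfun_compose)
    have SS: "S (S u) = T u" "Q (Q u) = T u" for u
      using S Q by (metis blinfun_apply_blinfun_compose)+
    define y where "y = S x - Q x"
    have "S y + Q y = S (S x) - Q (Q x) + (Q (S x) - S (Q x))"
      by (simp only: y_def blinfun.diff_right algebra_simps)
    then have "S y + Q y = 0"
      by (simp add: SS QS)
    then have "S y \<bullet> y + Q y \<bullet> y = 0"
      by (metis inner_add_left inner_zero_left)
    moreover have "S y \<bullet> y \<ge> 0" "Q y \<bullet> y \<ge> 0"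
      using S(2) Q unfolding psd_on_def by blast+
    ultimately have "S y \<bullet> y = 0" "Q y \<bullet> y = 0"
      by linarith+
    then have "S y = 0" "Q y = 0"
      using psd_form_zero[OF S(1,2)] psd_form_zero[of Q y] Q by simp_all
    then have "y \<bullet> y = 0"
      using self_adjointD[OF S(1), of x y] self_adjointD[of Q x y] Q
      by (metis inner_diff_left inner_zero_right y_def right_minus_eq)
    then show "Q x = S x"
      by (simp add: y_def)
  qed
  then have "sqrt_op T = S"
    unfolding sqrt_op_def by (intro the_equality conjI S(1-3)) blast
  then show "self_adjoint (sqrt_op T)" "psd_on UNIV (sqrt_op T)" "sqrt_op T o\<^sub>L sqrt_op T = T"
    using S(1-3) by (simp_all only:)
qed

lemma norm_sqrt_op:
  assumes T: "self_adjoint T" "psd_on UNIV T"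
  shows "(norm (blinfun_apply (sqrt_op T) x))\<^sup>2 = T x \<bullet> x"
  using sqrt_op[OF T] self_adjointD[of "sqrt_op T" "sqrt_op T x" x]
  by (metis blinfun_apply_blinfun_compose power2_norm_eq_inner)

lemma kernel_sqrt_op:
  assumes T: "self_adjoint T" "psd_on UNIV T"
  shows "kernel (sqrt_op T) = kernel T"
proof -
  have "sqrt_op T x = 0 \<longleftrightarrow> T x = 0" for x
    using norm_sqrt_op[OF T, of x] psd_form_zero[OF T, of x] by auto
  then show ?thesis by (simp add: kernel_def)
qed

lemma pseudo_inverse_sqrt_op:
  assumes T: "self_adjoint T" "psd_on UNIV T" and mono: "strongly_monotone_on ((kernel T)\<^sup>\<bottom>) T"
  shows "self_adjoint (pseudo_inverse (sqrt_op T))"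
    and "x \<in> (kernel T)\<^sup>\<bottom> \<Longrightarrow> blinfun_apply (pseudo_inverse (sqrt_op T)) (sqrt_op T x) = x"
proof -
  obtain \<alpha> where \<alpha>: "\<alpha> > 0" "\<And>x. x \<in> (kernel T)\<^sup>\<bottom> \<Longrightarrow> T x \<bullet> x \<ge> \<alpha> * (norm x)\<^sup>2"
    using mono by (auto simp: strongly_monotone_on_def)
  have below: "sqrt \<alpha> * norm x \<le> norm (sqrt_op T x)" if "x \<in> (kernel T)\<^sup>\<bottom>" for x
    using \<alpha>(1) \<alpha>(2)[OF that]
    by (intro power2_le_imp_le[OF _ norm_ge_zero]) (simp add: norm_sqrt_op[OF T] power_mult_distrib)
  note pi = pseudo_inverse_self_adjoint[OF sqrt_op(1)[OF T], of "sqrt \<alpha>", unfolded kernel_sqrt_op[OF T]]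
  show "self_adjoint (pseudo_inverse (sqrt_op T))"
    using \<alpha>(1) below by (intro pi(1)) auto
  show "pseudo_inverse (sqrt_op T) (sqrt_op T x) = x" if "x \<in> (kernel T)\<^sup>\<bottom>"
    using \<alpha>(1) below that by (intro pi(5)) auto
qed

section \<open>Weak convergence\<close>

text \<open>Weak compactness, in terms of filters so that no subsequences have to be chosen. The functions
  \<open>y \<mapsto> \<langle>f k, y\<rangle>\<close> lie in a product of compact intervals; a cluster point there is a bounded linear
  functional, because limits along a proper filter are unique, and Riesz representation turns it into a vector.\<close>

lemma bounded_weak_cluster_point:
  fixes f :: "'i \<Rightarrow> 'a::{real_inner,banach}"
  assumes F: "F \<noteq> bot" and bd: "bounded (range f)"
  obtains G l where "G \<noteq> bot" "G \<le> F" "\<And>y. ((\<lambda>k. f k \<bullet> y) \<longlongrightarrow> l \<bullet> y) G"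
proof -
  obtain C where C: "\<And>k. norm (f k) \<le> C"
    using bd by (auto simp: bounded_iff)
  define \<phi> where "\<phi> k y = f k \<bullet> y" for k y
  define K :: "('a \<Rightarrow> real) set" where "K = PiE UNIV (\<lambda>y. cball 0 (C * norm y))"
  have "compactin (product_topology (\<lambda>y. euclidean) UNIV) K"
    unfolding K_def by (subst compactin_PiE) auto
  then have "compact K"
    by (simp add: euclidean_product_topology)
  moreover have "filtermap \<phi> F \<noteq> bot"
    using F by (simp add: filtermap_bot_iff)
  moreover have "eventually (\<lambda>g. g \<in> K) (filtermap \<phi> F)"
  proof -
    have "\<bar>f k \<bullet> y\<bar> \<le> C * norm y" for k y
      using Cauchy_Schwarz_ineq2[of "f k" y] mult_right_mono[OF C, of "norm y" k] by simp
    then show ?thesis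
      unfolding eventually_filtermap K_def
      by (intro always_eventually allI) (simp add: PiE_iff \<phi>_def)
  qed
  ultimately obtain g where g: "g \<in> K" "inf (nhds g) (filtermap \<phi> F) \<noteq> bot"
    unfolding compact_filter by blast
  define G where "G = inf F (filtercomap \<phi> (nhds g))"
  have "G \<noteq> bot"
  proof
    assume "G = bot"
    then have "eventually (\<lambda>_. False) G" by simp
    then obtain P Q where PQ: "eventually P F" "eventually Q (nhds g)" "\<And>k. P k \<Longrightarrow> Q (\<phi> k) \<Longrightarrow> False"
      by (auto simp: G_def eventually_inf eventually_filtercomap)
    have "eventually (\<lambda>g. \<not> Q g) (filtermap \<phi> F)"
      unfolding eventually_filtermap using PQ(1) by (rule eventually_mono) (use PQ(3) in blast)
    with PQ(2) have "eventually (\<lambda>_. False) (inf (nhds g) (filtermap \<phi> F))"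
      by (auto simp: eventually_inf)
    with g(2) show False
      by (simp add: trivial_limit_def)
  qed
  have "filterlim \<phi> (nhds g) (filtercomap \<phi> (nhds g))"
    by (rule filterlim_filtercomap)
  then have lim: "filterlim \<phi> (nhds g) G"
    by (rule filterlim_mono) (auto simp: G_def)
  have coord: "((\<lambda>k. f k \<bullet> y) \<longlongrightarrow> g y) G" for y
  proof -
    have cont: "continuous_on UNIV (\<lambda>h::'a \<Rightarrow> real. h y)"
      by (rule continuous_on_product_coordinates)
    show ?thesis
    proof (rule topological_tendstoI)
      fix S :: "real set" assume "open S" "g y \<in> S"
      then have "open ((\<lambda>h. h y) -` S)" "g \<in> (\<lambda>h. h y) -` S"
        using open_vimage[OF \<open>open S\<close> cont] by auto
      then have "eventually (\<lambda>h. h \<in> (\<lambda>h. h y) -` S) (nhds g)"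
        by (rule eventually_nhds_in_open)
      then have "eventually (\<lambda>k. \<phi> k \<in> (\<lambda>h. h y) -` S) G"
        using lim by (rule eventually_compose_filterlim)
      then show "\<forall>\<^sub>F k in G. f k \<bullet> y \<in> S"
        by (simp add: \<phi>_def)
    qed
  qed
  have "bounded_linear g"
  proof (rule bounded_linear_intro[where K = C])
    show "g (a + b) = g a + g b" for a b
      using tendsto_add[OF coord[of a] coord[of b]] coord[of "a + b"] \<open>G \<noteq> bot\<close>
      by (auto simp: inner_add_right intro: tendsto_unique)
    show "g (r *\<^sub>R a) = r *\<^sub>R g a" for r a
      using tendsto_scaleR[OF tendsto_const[of r] coord[of a]] coord[of "r *\<^sub>R a"] \<open>G \<noteq> bot\<close>
      by (auto intro: tendsto_unique)
    show "norm (g a) \<le> norm a * C" for a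
      using g(1) by (auto simp: K_def PiE_iff mult.commute)
  qed
  then obtain l where "\<And>y. g y = l \<bullet> y"
    by (rule riesz_representation) blast
  with coord have "\<And>y. ((\<lambda>k. f k \<bullet> y) \<longlongrightarrow> l \<bullet> y) G" by simp
  moreover have "G \<le> F" by (simp add: G_def)
  ultimately show thesis
    using that \<open>G \<noteq> bot\<close> by blast
qed

text \<open>If convergence failed against some \<open>y\<close>, weak compactness along the bad indices would produce another
  cluster point.\<close>

lemma weakly_converges_of_unique_cluster_point:
  assumes bd: "bounded (range f)"
    and uniq: "\<And>G l'. G \<noteq> bot \<Longrightarrow> G \<le> sequentially \<Longrightarrow> (\<And>y. ((\<lambda>k. f k \<bullet> y) \<longlongrightarrow> l' \<bullet> y) G) \<Longrightarrow> l' = l"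
  shows "weakly_converges f l"
  unfolding weakly_converges_def
proof (rule allI, rule ccontr)
  fix y
  assume "\<not> (\<lambda>k. f k \<bullet> y) \<longlonglongrightarrow> l \<bullet> y"
  then obtain e where e: "e > 0" "\<not> (\<forall>\<^sub>F k in sequentially. dist (f k \<bullet> y) (l \<bullet> y) < e)"
    by (auto simp: tendsto_iff)
  define F where "F = inf sequentially (principal {k. \<not> dist (f k \<bullet> y) (l \<bullet> y) < e})"
  have "F \<noteq> bot"
    using e(2) by (simp add: F_def trivial_limit_def eventually_inf_principal)
  then obtain G l' where G: "G \<noteq> bot" "G \<le> F" "\<And>y. ((\<lambda>k. f k \<bullet> y) \<longlongrightarrow> l' \<bullet> y) G"
    by (rule bounded_weak_cluster_point[OF _ bd]) blast
  then have "l' = l"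
    by (intro uniq) (auto simp: F_def)
  then have "\<forall>\<^sub>F k in G. dist (f k \<bullet> y) (l \<bullet> y) < e"
    using G(3)[of y] e(1) by (auto simp: tendsto_iff)
  moreover have "\<forall>\<^sub>F k in G. \<not> dist (f k \<bullet> y) (l \<bullet> y) < e"
    using G(2) by (auto simp: F_def le_principal)
  ultimately have "\<forall>\<^sub>F k in G. False"
    by eventually_elim simp
  with G(1) show False
    by (simp add: trivial_limit_def)
qed

lemma tendsto_inner_weak_strong:
  fixes f g :: "'i \<Rightarrow> 'a::real_inner"
  assumes bd: "bounded (range f)" and f: "\<And>y. ((\<lambda>k. f k \<bullet> y) \<longlongrightarrow> a \<bullet> y) G" and g: "(g \<longlongrightarrow> b) G"
  shows "((\<lambda>k. f k \<bullet> g k) \<longlongrightarrow> a \<bullet> b) G"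
proof -
  have 0: "((\<lambda>k. g k - b) \<longlongrightarrow> 0) G"
    using tendsto_diff[OF g tendsto_const[of b]] by simp
  have "((\<lambda>k. f k \<bullet> (g k - b)) \<longlongrightarrow> 0) G"
  proof -
    obtain C where C: "\<And>k. norm (f k) \<le> C"
      using bd by (auto simp: bounded_iff)
    show ?thesis
    proof (rule Lim_null_comparison)
    have "\<bar>f k \<bullet> (g k - b)\<bar> \<le> C * norm (g k - b)" for k
      using Cauchy_Schwarz_ineq2[of "f k" "g k - b"] mult_right_mono[OF C, of "norm (g k - b)" k] by simp
    then show "\<forall>\<^sub>F k in G. norm (f k \<bullet> (g k - b)) \<le> C * norm (g k - b)"
      by simp
    show "((\<lambda>k. C * norm (g k - b)) \<longlongrightarrow> 0) G"
      using tendsto_mult[OF tendsto_const[of C] tendsto_norm[OF 0]] by simp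
    qed
  qed
  from tendsto_add[OF this f[of b]] show ?thesis
    by (simp add: inner_diff_right)
qed

lemma tendsto_inner_blinfun:
  fixes T :: "'a::{real_inner,banach} \<Rightarrow>\<^sub>L 'b::{real_inner,banach}"
  assumes "\<And>y. ((\<lambda>k. f k \<bullet> y) \<longlongrightarrow> l \<bullet> y) G"
  shows "((\<lambda>k. blinfun_apply T (f k) \<bullet> y) \<longlongrightarrow> T l \<bullet> y) G"
  using assms[of "adjoint_op T y"] by (simp add: adjoint_op_inner')

lemma bounded_range_blinfun:
  assumes "bounded (range f)"
  shows "bounded (range (\<lambda>k. blinfun_apply T (f k)))"
  using bounded_linear_image[OF assms blinfun.bounded_linear_right[of T]]
  by (simp add: image_image)

lemma bounded_range_add:
  fixes f g :: "'i \<Rightarrow> 'a::real_normed_vector"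
  assumes "bounded (range f)" "bounded (range g)"
  shows "bounded (range (\<lambda>k. f k + g k))"
proof -
  obtain C D where "\<And>k. norm (f k) \<le> C" "\<And>k. norm (g k) \<le> D"
    using assms by (auto simp: bounded_iff)
  then have "norm (f k + g k) \<le> C + D" for k
    by (meson add_mono norm_triangle_ineq order_trans)
  then show ?thesis
    by (auto simp: bounded_iff)
qed

lemma bounded_range_scaleR:
  fixes f :: "'i \<Rightarrow> 'a::real_normed_vector"
  assumes "bounded (range f)"
  shows "bounded (range (\<lambda>k. c *\<^sub>R f k))"
  using bounded_scaling[OF assms, of c] by (simp add: image_image)

lemma tendsto_zero_sandwich:
  fixes f g :: "'i \<Rightarrow> real"
  assumes "\<And>k. 0 \<le> f k" "\<And>k. f k \<le> g k" "(g \<longlongrightarrow> 0) F"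
  shows "(f \<longlongrightarrow> 0) F"
  by (rule tendsto_sandwich[of "\<lambda>_. 0" f F g]) (use assms in auto)

lemma tendsto_zero_of_norm_sq:
  fixes v :: "'i \<Rightarrow> 'a::real_normed_vector"
  assumes "c > 0" "\<And>k. c * (norm (v k))\<^sup>2 \<le> g k" "(g \<longlongrightarrow> 0) F"
  shows "(v \<longlongrightarrow> 0) F"
proof -
  have "((\<lambda>k. c * (norm (v k))\<^sup>2) \<longlongrightarrow> 0) F"
    by (rule tendsto_zero_sandwich[OF _ assms(2,3)]) (use assms(1) in simp)
  then have "((\<lambda>k. sqrt ((1 / c) * (c * (norm (v k))\<^sup>2))) \<longlongrightarrow> sqrt ((1 / c) * 0)) F"
    by (intro tendsto_intros)
  then have "((\<lambda>k. norm (v k)) \<longlongrightarrow> 0) F"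
    using assms(1) by simp
  then show ?thesis
    by (rule tendsto_norm_zero_cancel)
qed

section \<open>Relaxed iterations of cocoercive maps\<close>

text \<open>Distances to every zero decrease by at least \<open>\<lambda>\<^sub>k (2 \<beta> - \<lambda>\<^sub>k) \<parallel>T z\<^sup>k\<parallel>\<^sup>2\<close>, and \<open>\<parallel>T z\<^sup>k\<parallel>\<close> is itself
  decreasing, so that divergence of the series of weights forces \<open>T z\<^sup>k \<rightarrow> 0\<close>. Cocoercivity makes weak cluster
  points zeros of \<open>T\<close>, and two of them coincide because the distance to each converges along the whole
  sequence (Opial's argument).\<close>

lemma cocoercive_iteration_weakly_converges:
  fixes T :: "'a::{real_inner,banach} \<Rightarrow> 'a"
  assumes \<beta>: "\<beta> > 0"
    and coco: "\<And>u v. (u - v) \<bullet> (T u - T v) \<ge> \<beta> * (norm (T u - T v))\<^sup>2"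
    and step: "\<And>k. z (Suc k) = z k - lam k *\<^sub>R T (z k)"
    and lam: "\<And>k. 0 \<le> lam k" "\<And>k. lam k \<le> 2 * \<beta>"
    and div: "\<not> summable (\<lambda>k. lam k * (2 * \<beta> - lam k))"
    and p: "T p = 0"
  shows "bounded (range z)" and "(\<lambda>k. T (z k)) \<longlonglongrightarrow> 0"
    and "\<exists>l. T l = 0 \<and> weakly_converges z l"
proof -
  have fejer: "(norm (z (Suc k) - q))\<^sup>2 \<le> (norm (z k - q))\<^sup>2 - lam k * (2 * \<beta> - lam k) * (norm (T (z k)))\<^sup>2"
    if "T q = 0" for q k
  proof -
    have "(norm (z (Suc k) - q))\<^sup>2
        = (norm (z k - q))\<^sup>2 - 2 * (lam k * ((z k - q) \<bullet> T (z k))) + (lam k)\<^sup>2 * (norm (T (z k)))\<^sup>2"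
      unfolding power2_norm_eq_inner step
      by (simp add: inner_simps inner_commute algebra_simps power2_eq_square)
    moreover have "lam k * (\<beta> * (norm (T (z k)))\<^sup>2) \<le> lam k * ((z k - q) \<bullet> T (z k))"
      using coco[of "z k" q] lam(1) that by (intro mult_left_mono) auto
    ultimately show ?thesis
      by (simp add: algebra_simps power2_eq_square)
  qed
  have dec: "decseq (\<lambda>k. (norm (z k - q))\<^sup>2)" if "T q = 0" for q
  proof (rule decseq_SucI)
    fix k
    have "0 \<le> lam k * (2 * \<beta> - lam k) * (norm (T (z k)))\<^sup>2"
      using lam[of k] by simp
    then show "(norm (z (Suc k) - q))\<^sup>2 \<le> (norm (z k - q))\<^sup>2"
      using fejer[OF that, of k] by linarith
  qed
  show bd: "bounded (range z)"
  proof -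
    have "norm (z k - p) \<le> norm (z 0 - p)" for k
      using decseqD[OF dec[OF p], of 0 k] by (intro power2_le_imp_le[OF _ norm_ge_zero]) simp
    then have "norm (z k) \<le> norm (z 0 - p) + norm p" for k
      using norm_triangle_ineq[of "z k - p" p] by (smt (verit) diff_add_cancel)
    then show ?thesis
      by (auto simp: bounded_iff)
  qed
  have T_dec: "norm (T (z (Suc k))) \<le> norm (T (z k))" for k
  proof (cases "lam k = 0")
    case False
    let ?d = "T (z (Suc k)) - T (z k)"
    have "\<beta> * (norm ?d)\<^sup>2 \<le> - lam k * (T (z k) \<bullet> ?d)"
      using coco[of "z (Suc k)" "z k"] by (simp add: step)
    moreover have "lam k * (norm ?d)\<^sup>2 \<le> 2 * (\<beta> * (norm ?d)\<^sup>2)"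
      using lam(2)[of k] by (simp add: mult_right_mono flip: mult.assoc)
    ultimately have "lam k * (norm ?d)\<^sup>2 \<le> lam k * (- 2 * (T (z k) \<bullet> ?d))"
      by linarith
    then have "(norm ?d)\<^sup>2 \<le> - 2 * (T (z k) \<bullet> ?d)"
      by (rule mult_left_le_imp_le) (use False lam(1)[of k] in linarith)
    moreover have "(norm (T (z (Suc k))))\<^sup>2 = (norm (T (z k)))\<^sup>2 + 2 * (T (z k) \<bullet> ?d) + (norm ?d)\<^sup>2"
      unfolding power2_norm_eq_inner by (simp add: inner_simps inner_commute)
    ultimately have "(norm (T (z (Suc k))))\<^sup>2 \<le> (norm (T (z k)))\<^sup>2"
      by linarith
    then show ?thesis
      by (rule power2_le_imp_le) simp
  qed (simp add: step)
  then have Tdec: "decseq (\<lambda>k. norm (T (z k)))"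
    by (rule decseq_SucI)
  show T0: "(\<lambda>k. T (z k)) \<longlonglongrightarrow> 0"
  proof -
    obtain t where t: "(\<lambda>k. norm (T (z k))) \<longlonglongrightarrow> t" "\<And>k. t \<le> norm (T (z k))"
      using decseq_convergent[OF Tdec, of 0] by auto
    then have "t \<ge> 0"
      using LIMSEQ_le_const[OF t(1), of 0] by auto
    have "t = 0"
    proof (rule ccontr)
      assume "t \<noteq> 0"
      then have "t > 0" using \<open>t \<ge> 0\<close> by simp
      have bound: "(\<Sum>k<n. lam k * (2 * \<beta> - lam k)) \<le> (norm (z 0 - p))\<^sup>2 / t\<^sup>2" for n
      proof -
        have "t\<^sup>2 * (\<Sum>k<n. lam k * (2 * \<beta> - lam k)) \<le> (norm (z 0 - p))\<^sup>2 - (norm (z n - p))\<^sup>2"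
        proof (induction n)
          case (Suc n)
          have "t\<^sup>2 * (lam n * (2 * \<beta> - lam n)) \<le> (norm (T (z n)))\<^sup>2 * (lam n * (2 * \<beta> - lam n))"
            using t(2)[of n] \<open>t > 0\<close> lam[of n] by (intro mult_right_mono power_mono) auto
          then show ?case
            using Suc fejer[OF p, of n] by (simp add: algebra_simps)
        qed simp
        also have "\<dots> \<le> (norm (z 0 - p))\<^sup>2" by simp
        finally show ?thesis
          using \<open>t > 0\<close> by (simp add: field_simps)
      qed
      have "summable (\<lambda>k. lam k * (2 * \<beta> - lam k))"
        using lam by (intro bounded_imp_summable[of _ "(norm (z 0 - p))\<^sup>2 / t\<^sup>2"])
          (auto simp: bound simp del: sum.lessThan_Suc simp flip: lessThan_Suc_atMost)
      with div show False by simp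
    qed
    with t(1) show ?thesis
      by (simp add: tendsto_norm_zero_iff)
  qed
  have zero: "T l = 0" if G: "G \<noteq> bot" "G \<le> sequentially" "\<And>y. ((\<lambda>k. z k \<bullet> y) \<longlongrightarrow> l \<bullet> y) G" for G l
  proof -
    have TG: "((\<lambda>k. T (z k)) \<longlongrightarrow> 0) G"
      using T0 G(2) by (rule tendsto_mono[rotated])
    have "((\<lambda>k. z k \<bullet> (T (z k) - T l) - l \<bullet> (T (z k) - T l) - \<beta> * (norm (T (z k) - T l))\<^sup>2)
        \<longlongrightarrow> l \<bullet> (0 - T l) - l \<bullet> (0 - T l) - \<beta> * (norm (0 - T l))\<^sup>2) G"
      by (intro tendsto_intros tendsto_inner_weak_strong[OF bd G(3)] TG)
    moreover have "0 \<le> z k \<bullet> (T (z k) - T l) - l \<bullet> (T (z k) - T l) - \<beta> * (norm (T (z k) - T l))\<^sup>2" for k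
      using coco[of "z k" l] by (simp add: inner_diff_left)
    ultimately have "0 \<le> l \<bullet> (0 - T l) - l \<bullet> (0 - T l) - \<beta> * (norm (0 - T l))\<^sup>2"
      using G(1) by (intro tendsto_lowerbound) auto
    then show ?thesis
      using \<beta> by (simp add: mult_le_0_iff)
  qed
  obtain G l where G: "G \<noteq> bot" "G \<le> sequentially" "\<And>y. ((\<lambda>k. z k \<bullet> y) \<longlongrightarrow> l \<bullet> y) G"
    by (rule bounded_weak_cluster_point[OF _ bd]) auto
  have "weakly_converges z l"
  proof (rule weakly_converges_of_unique_cluster_point[OF bd])
    fix G' l'
    assume G': "G' \<noteq> bot" "G' \<le> sequentially" "\<And>y. ((\<lambda>k. z k \<bullet> y) \<longlongrightarrow> l' \<bullet> y) G'"
    obtain c where c: "(\<lambda>k. (norm (z k - l))\<^sup>2) \<longlonglongrightarrow> c"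
      using decseq_convergent[OF dec[OF zero[OF G]], of 0] by auto
    obtain c' where c': "(\<lambda>k. (norm (z k - l'))\<^sup>2) \<longlonglongrightarrow> c'"
      using decseq_convergent[OF dec[OF zero[OF G']], of 0] by auto
    have "(\<lambda>k. (1/2) * ((norm (z k - l'))\<^sup>2 - (norm (z k - l))\<^sup>2 + (norm l)\<^sup>2 - (norm l')\<^sup>2))
        \<longlonglongrightarrow> (1/2) * (c' - c + (norm l)\<^sup>2 - (norm l')\<^sup>2)"
      by (intro tendsto_intros c c')
    moreover have "(1/2) * ((norm (z k - l'))\<^sup>2 - (norm (z k - l))\<^sup>2 + (norm l)\<^sup>2 - (norm l')\<^sup>2) = z k \<bullet> (l - l')" for k
      unfolding power2_norm_eq_inner by (simp add: inner_simps inner_commute algebra_simps)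
    ultimately obtain e where e: "(\<lambda>k. z k \<bullet> (l - l')) \<longlonglongrightarrow> e"
      by auto
    have "l \<bullet> (l - l') = e"
      using G(1) tendsto_unique[OF _ G(3) tendsto_mono[OF G(2) e]] by blast
    moreover have "l' \<bullet> (l - l') = e"
      using G'(1) tendsto_unique[OF _ G'(3) tendsto_mono[OF G'(2) e]] by blast
    ultimately have "(l - l') \<bullet> (l - l') = 0"
      by (simp add: inner_diff_left)
    then show "l' = l" by simp
  qed
  with zero[OF G] show "\<exists>l. T l = 0 \<and> weakly_converges z l"
    by blast
qed

section \<open>The diagonal and block operators\<close>

lemma inner_vec_left: "(vec u :: 'h::real_inner ^ 'n) \<bullet> w = u \<bullet> (\<Sum>i\<in>UNIV. w $ i)"
  by (simp add: inner_vec_def inner_sum_right)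

lemma subspace_Omega: "subspace (Omega :: ('h::real_vector ^ 'n) set)"
  unfolding subspace_def Omega_def
proof (intro conjI ballI allI)
  show "(0 :: 'h ^ 'n) \<in> range vec"
    by (rule range_eqI[of _ _ 0]) (simp add: vec_eq_iff)
  show "x + y \<in> range vec" if "x \<in> range vec" "y \<in> range vec" for x y :: "'h ^ 'n"
    using that by (auto simp: vec_eq_iff)
  show "c *\<^sub>R x \<in> range vec" if "x \<in> range vec" for c and x :: "'h ^ 'n"
    using that by (auto simp: vec_eq_iff)
qed

lemma Omega_iff: "x \<in> (Omega :: ('h ^ 'n) set) \<longleftrightarrow> (\<forall>i j. x $ i = x $ j)"
proof
  assume "\<forall>i j. x $ i = x $ j"
  then have "x = vec (x $ undefined)"
    by (simp add: vec_eq_iff)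
  then show "x \<in> Omega" by (auto simp: Omega_def)
qed (auto simp: Omega_def)

lemma closed_Omega: "closed (Omega :: ('h::real_inner ^ 'n) set)"
proof -
  have eq: "(Omega :: ('h ^ 'n) set) = (\<Inter>i. \<Inter>j. {x. x $ i = x $ j})"
    by (auto simp: Omega_iff)
  show ?thesis
    unfolding eq by (intro closed_INT ballI closed_Collect_eq continuous_intros)
qed

lemma vec_in_Omega [simp]: "vec u \<in> Omega"
  by (simp add: Omega_def)

lemma OmegaE: assumes "x \<in> Omega" obtains u where "x = vec u"
  using assms by (auto simp: Omega_def)

lemma Omega_orth_iff:
  "(w :: 'h::real_inner ^ 'n) \<in> Omega\<^sup>\<bottom> \<longleftrightarrow> (\<Sum>i\<in>UNIV. w $ i) = 0"
proof -
  have "w \<in> Omega\<^sup>\<bottom> \<longleftrightarrow> (\<forall>u. u \<bullet> (\<Sum>i\<in>UNIV. w $ i) = 0)"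
    by (simp add: orthogonal_comp_iff Omega_def inner_vec_left)
  then show ?thesis
    by (metis inner_eq_zero_iff inner_zero_right)
qed

lemmas orth_proj_Omega = orth_proj[OF subspace_Omega closed_Omega]
lemmas orth_proj_Omega_orth = orth_proj_orthogonal_comp[OF subspace_Omega closed_Omega]
lemmas Omega_comp_comp = orthogonal_comp_comp[OF subspace_Omega closed_Omega]

lemma self_adjoint_orth_proj_Omega: "self_adjoint (orth_proj Omega)" "self_adjoint (orth_proj (Omega\<^sup>\<bottom>))"
  by (auto intro!: self_adjoint_orth_proj subspace_Omega closed_Omega subspace_orthogonal_comp closed_orthogonal_comp)

lemma orth_proj_Omega_id:
  "x \<in> Omega \<Longrightarrow> blinfun_apply (orth_proj Omega) x = x"
  by (rule orth_proj_eqI[OF subspace_Omega closed_Omega]) (auto simp: orthogonal_comp_iff)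

lemma orth_proj_Omega_0:
  "x \<in> Omega\<^sup>\<bottom> \<Longrightarrow> blinfun_apply (orth_proj Omega) x = 0"
  by (rule orth_proj_eqI[OF subspace_Omega closed_Omega]) (auto simp: subspace_0[OF subspace_Omega])

lemma block_nth: "blinfun_apply (block T) x $ i = (\<Sum>j\<in>UNIV. T i j (x $ j))"
  by transfer simp

lemma adjoint_block: "adjoint_op (block T) = block (\<lambda>i j. adjoint_op (T j i))"
proof (rule adjoint_op_eqI)
  fix x y
  have "block (\<lambda>i j. adjoint_op (T j i)) y \<bullet> x = (\<Sum>i\<in>UNIV. \<Sum>j\<in>UNIV. y $ j \<bullet> T j i (x $ i))"
    by (simp add: inner_vec_def block_nth inner_sum_left adjoint_op_inner)
  also have "\<dots> = y \<bullet> block T x"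
    by (subst sum.swap) (simp add: inner_vec_def block_nth inner_sum_right)
  finally show "block (\<lambda>i j. adjoint_op (T j i)) y \<bullet> x = y \<bullet> block T x" .
qed

lemma diag_op_nth: "blinfun_apply (diag_op T) x $ i = T i (x $ i)"
proof -
  have "(\<Sum>j\<in>UNIV. blinfun_apply (diag_entries T i j) (x $ j)) = (\<Sum>j\<in>UNIV. if i = j then T i (x $ i) else 0)"
    by (intro sum.cong) (auto simp: diag_entries_def)
  then show ?thesis
    by (simp add: diag_op_def block_nth)
qed

lemma inner_diag_op: "x \<bullet> blinfun_apply (diag_op T) y = (\<Sum>i\<in>UNIV. x $ i \<bullet> T i (y $ i))"
  by (simp add: inner_vec_def diag_op_nth)

lemma self_adjoint_diag_op: "(\<And>i. self_adjoint (T i)) \<Longrightarrow> self_adjoint (diag_op T)"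
  by (intro self_adjointI) (simp add: inner_vec_def diag_op_nth self_adjointD)

lemma inner_sym_part: "x \<bullet> blinfun_apply (sym_part L) x = x \<bullet> L x"
  by (simp add: sym_part_def blinfun.bilinear_simps inner_add_right adjoint_op_inner' inner_commute)

lemma self_adjoint_sym_part: "self_adjoint (sym_part L)"
  by (intro self_adjointI)
    (simp add: sym_part_def blinfun.bilinear_simps inner_add_right inner_add_left adjoint_op_inner adjoint_op_inner')

lemma form_vanishing_on_Omega:
  fixes T :: "('h::{real_inner,banach} ^ 'n) \<Rightarrow>\<^sub>L ('h ^ 'n)"
  assumes T: "self_adjoint T" and vec: "\<And>u. T (vec u) = 0"
  shows "T x = T (orth_proj (Omega\<^sup>\<bottom>) x)"
    and "x \<bullet> T x = orth_proj (Omega\<^sup>\<bottom>) x \<bullet> T (orth_proj (Omega\<^sup>\<bottom>) x)"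
proof -
  have "T (orth_proj Omega x) = 0" for x
    using orth_proj_Omega(1)[of x] vec by (metis OmegaE)
  then show 1: "T x = T (orth_proj (Omega\<^sup>\<bottom>) x)" for x
    by (simp add: orth_proj_Omega_orth blinfun.diff_right)
  show "x \<bullet> T x = orth_proj (Omega\<^sup>\<bottom>) x \<bullet> T (orth_proj (Omega\<^sup>\<bottom>) x)"
    using self_adjointD[OF T, of x x] self_adjointD[OF T, of "orth_proj (Omega\<^sup>\<bottom>) x" x]
    by (metis 1 inner_commute self_adjointD[OF T])
qed

section \<open>Schur complements\<close>

text \<open>Completing the square in the \<open>P\<close>-component. The hypothesis on \<open>S\<close> states that \<open>S\<close> inverts the block \<open>P T P\<close>
  on the range of the off-diagonal block \<open>P T Q\<close>. Instantiating \<open>P\<close> by the projector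
  onto \<open>\<Omega>\<close> or onto \<open>\<Omega>\<^sup>\<bottom>\<close> gives the two Schur complements.\<close>

lemma schur_complete_square:
  fixes T P Q S :: "'a::{real_inner,banach} \<Rightarrow>\<^sub>L 'a"
  assumes sa: "self_adjoint T" "self_adjoint P" "self_adjoint Q"
    and PQ: "\<And>x. P x + Q x = x"
    and S: "\<And>x. P (T (P (S (P (T (Q x)))))) = P (T (Q x))"
  defines "y \<equiv> \<lambda>x. x + S (P (T (Q x)))"
  shows "x \<bullet> T x = x \<bullet> (Q (T (Q x)) - Q (T (P (S (P (T (Q x))))))) + P (y x) \<bullet> T (P (y x))"
proof -
  note sT = self_adjointD[OF sa(1)] and sP = self_adjointD[OF sa(2)] and sQ = self_adjointD[OF sa(3)]
  define t where "t = S (P (T (Q x)))"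
  have "x \<bullet> T x = (P x + Q x) \<bullet> T (P x + Q x)"
    by (simp add: PQ)
  also have "\<dots> = P x \<bullet> T (P x) + 2 * (P x \<bullet> T (Q x)) + Q x \<bullet> T (Q x)"
    using sT[of "Q x" "P x"] by (simp add: blinfun.add_right inner_simps inner_commute)
  finally have 1: "x \<bullet> T x = P x \<bullet> T (P x) + 2 * (P x \<bullet> T (Q x)) + Q x \<bullet> T (Q x)" .
  have "P (y x) \<bullet> T (P (y x)) = P x \<bullet> T (P x) + 2 * (P x \<bullet> T (P t)) + P t \<bullet> T (P t)"
    using sT[of "P t" "P x"] by (simp add: y_def t_def blinfun.add_right inner_simps inner_commute)
  moreover have "P x \<bullet> T (P t) = P x \<bullet> T (Q x)"
    using sP[of x "T (P t)"] sP[of x "T (Q x)"] S[of x] by (simp add: t_def)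
  moreover have "P t \<bullet> T (P t) = P t \<bullet> T (Q x)"
    using sP[of t "T (P t)"] sP[of t "T (Q x)"] S[of x] by (simp add: t_def)
  moreover have "x \<bullet> Q (T (Q x)) = Q x \<bullet> T (Q x)"
    using sQ[of x "T (Q x)"] by simp
  moreover have "x \<bullet> Q (T (P t)) = P t \<bullet> T (Q x)"
    using sQ[of x "T (P t)"] sT[of "Q x" "P t"] by (simp add: inner_commute)
  ultimately show ?thesis
    using 1 by (simp add: inner_diff_right t_def)
qed

lemma schur11_apply:
  fixes x :: "'h::{real_inner,banach} ^ 'n"
  defines "P \<equiv> orth_proj (Omega :: ('h ^ 'n) set)" and "Q \<equiv> orth_proj ((Omega :: ('h ^ 'n) set)\<^sup>\<bottom>)"
  shows "schur11 T x = Q (T (Q x)) - Q (T (P (pseudo_inverse (blk11 T) (P (T (Q x))))))"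
  by (simp add: schur11_def blk22_def blk21_def blk12_def P_def Q_def blinfun.diff_left)

lemma schur22_apply:
  fixes x :: "'h::{real_inner,banach} ^ 'n"
  defines "P \<equiv> orth_proj (Omega :: ('h ^ 'n) set)" and "Q \<equiv> orth_proj ((Omega :: ('h ^ 'n) set)\<^sup>\<bottom>)"
  shows "schur22 T x = P (T (P x)) - P (T (Q (pseudo_inverse (blk22 T) (Q (T (P x))))))"
  by (simp add: schur22_def blk11_def blk21_def blk12_def P_def Q_def blinfun.diff_left)

lemma orth_proj_Omega_decomp: "orth_proj Omega x + blinfun_apply (orth_proj (Omega\<^sup>\<bottom>)) x = x"
  by (simp add: orth_proj_Omega_orth)

lemma blk11_pseudo_inverse:
  fixes T :: "('h::{real_inner,banach} ^ 'n) \<Rightarrow>\<^sub>L ('h ^ 'n)"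
  assumes T: "self_adjoint T" and mono: "strongly_monotone_on Omega (blk11 T)"
  shows "self_adjoint (pseudo_inverse (blk11 T))"
    and "y \<in> Omega \<Longrightarrow> blk11 T (pseudo_inverse (blk11 T) y) = y"
proof -
  obtain \<alpha> where \<alpha>: "\<alpha> > 0" "\<And>x. x \<in> Omega \<Longrightarrow> blk11 T x \<bullet> x \<ge> \<alpha> * (norm x)\<^sup>2"
    using mono by (auto simp: strongly_monotone_on_def)
  have sa: "self_adjoint (blk11 T)"
    unfolding blk11_def by (intro self_adjoint_conj self_adjoint_orth_proj_Omega T)
  have low: "\<alpha> * norm x \<le> norm (blk11 T x)" if "x \<in> Omega" for x
  proof -
    have "\<alpha> * (norm x)\<^sup>2 \<le> norm (blk11 T x) * norm x"
      using \<alpha>(2)[OF that] norm_cauchy_schwarz[of "blk11 T x" x] by linarith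
    then show ?thesis
      by (cases "x = 0") (auto simp: power2_eq_square)
  qed
  have ker: "kernel (blk11 T) = Omega\<^sup>\<bottom>"
  proof (intro equalityI subsetI)
    fix x assume "x \<in> kernel (blk11 T)"
    then have "blk11 T x = 0" by (simp add: kernel_def)
    moreover have "blk11 T (orth_proj Omega x) = blk11 T x"
      by (simp add: blk11_def orth_proj_Omega_id orth_proj_Omega)
    ultimately have "\<alpha> * norm (orth_proj Omega x) \<le> 0"
      using low[OF orth_proj_Omega(1), of x] by simp
    then have "orth_proj Omega x = 0"
      using \<alpha>(1) by (simp add: mult_le_0_iff)
    then show "x \<in> Omega\<^sup>\<bottom>"
      using orth_proj_Omega(2)[of x] by simp
  qed (simp add: kernel_def blk11_def orth_proj_Omega_0)
  note pi = pseudo_inverse_self_adjoint[OF sa \<alpha>(1), unfolded ker Omega_comp_comp]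
  show "self_adjoint (pseudo_inverse (blk11 T))"
    using low by (rule pi(1))
  show "blk11 T (pseudo_inverse (blk11 T) y) = y" if "y \<in> Omega"
    using pi(2)[OF low, of y] pi(5)[OF low that] by simp
qed

text \<open>Part of the completed square is kept: it is what controls the diagonal component of the \<open>x\<close>-iterates
  in the strongly convergent case.\<close>

lemma inner_schur11_le:
  fixes T :: "('h::{real_inner,banach} ^ 'n) \<Rightarrow>\<^sub>L ('h ^ 'n)"
  assumes T: "self_adjoint T" and mono: "strongly_monotone_on Omega (blk11 T)"
  obtains \<alpha> K where "\<alpha> > 0"
    "\<And>x. x \<bullet> T x \<ge> x \<bullet> schur11 T x
        + \<alpha> * (norm (orth_proj Omega x + blinfun_apply K (orth_proj (Omega\<^sup>\<bottom>) x)))\<^sup>2"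
proof -
  let ?P = "orth_proj Omega :: ('h ^ 'n) \<Rightarrow>\<^sub>L ('h ^ 'n)"
  let ?Q = "orth_proj (Omega\<^sup>\<bottom>) :: ('h ^ 'n) \<Rightarrow>\<^sub>L ('h ^ 'n)"
  define S where "S = pseudo_inverse (blk11 T)"
  obtain \<alpha> where \<alpha>: "\<alpha> > 0" "\<And>x. x \<in> Omega \<Longrightarrow> blk11 T x \<bullet> x \<ge> \<alpha> * (norm x)\<^sup>2"
    using mono by (auto simp: strongly_monotone_on_def)
  have S: "?P (T (?P (S (?P (T (?Q x)))))) = ?P (T (?Q x))" for x
    using blk11_pseudo_inverse(2)[OF T mono orth_proj_Omega(1), of "T (?Q x)"]
    by (simp add: S_def blk11_def)
  define K where "K = ?P o\<^sub>L S o\<^sub>L ?P o\<^sub>L T"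
  show thesis
  proof (rule that[OF \<alpha>(1)])
    fix x
    define y where "y = ?P (x + S (?P (T (?Q x))))"
    have "y \<in> Omega" by (simp add: y_def orth_proj_Omega)
    then have "blk11 T y \<bullet> y = y \<bullet> T y"
      using self_adjointD[OF self_adjoint_orth_proj_Omega(1), of "T y" y]
      by (simp add: blk11_def orth_proj_Omega_id inner_commute)
    then have "y \<bullet> T y \<ge> \<alpha> * (norm y)\<^sup>2"
      using \<alpha>(2)[OF \<open>y \<in> Omega\<close>] by simp
    moreover have "x \<bullet> T x = x \<bullet> schur11 T x + y \<bullet> T y"
      unfolding y_def schur11_apply S_def[symmetric]
      by (rule schur_complete_square[OF T self_adjoint_orth_proj_Omega orth_proj_Omega_decomp S])
    moreover have "y = ?P x + K (?Q x)"
      by (simp add: y_def K_def blinfun.add_right)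
    ultimately show "x \<bullet> T x \<ge> x \<bullet> schur11 T x + \<alpha> * (norm (?P x + K (?Q x)))\<^sup>2"
      by simp
  qed
qed

lemma self_adjoint_schur11:
  fixes T :: "('h::{real_inner,banach} ^ 'n) \<Rightarrow>\<^sub>L ('h ^ 'n)"
  assumes T: "self_adjoint T" and mono: "strongly_monotone_on Omega (blk11 T)"
  shows "self_adjoint (schur11 T)"
  by (intro self_adjointI)
    (simp add: schur11_apply inner_diff_left inner_diff_right self_adjointD[OF T]
      self_adjointD[OF self_adjoint_orth_proj_Omega(1)] self_adjointD[OF self_adjoint_orth_proj_Omega(2)]
      self_adjointD[OF blk11_pseudo_inverse(1)[OF T mono]])

lemma schur11_vec: "schur11 T (vec u) = 0"
  by (simp add: schur11_apply orth_proj_Omega_orth orth_proj_Omega_id)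

lemma schur11_zero: "schur11 0 = 0"
  by (rule blinfun_eqI) (simp add: schur11_apply)

lemma blk22_pseudo_inverse:
  fixes T :: "('h::{real_inner,banach} ^ 'n) \<Rightarrow>\<^sub>L ('h ^ 'n)"
  assumes T: "self_adjoint T" and cl: "closed (ran (blk22 T))"
  shows "self_adjoint (pseudo_inverse (blk22 T))"
    and "y \<in> ran (blk22 T) \<Longrightarrow> blk22 T (pseudo_inverse (blk22 T) y) = y"
proof -
  have sa: "self_adjoint (blk22 T)"
    unfolding blk22_def by (intro self_adjoint_conj self_adjoint_orth_proj_Omega T)
  obtain c where c: "c > 0" "\<And>x. x \<in> (kernel (blk22 T))\<^sup>\<bottom> \<Longrightarrow> c * norm x \<le> norm (blk22 T x)"
    by (rule closed_range_bounded_below[OF sa cl]) blast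
  note pi = pseudo_inverse_self_adjoint[OF sa c]
  show "self_adjoint (pseudo_inverse (blk22 T))"
    by (rule pi(1))
  show "blk22 T (pseudo_inverse (blk22 T) y) = y" if "y \<in> ran (blk22 T)"
    using that pi(2,3) by (auto simp: ran_def)
qed

text \<open>Here the completed square is only known to be nonnegative, and the off-diagonal block is handled by
  the range inclusion instead of invertibility.\<close>

lemma inner_schur22_le:
  fixes T :: "('h::{real_inner,banach} ^ 'n) \<Rightarrow>\<^sub>L ('h ^ 'n)"
  assumes T: "self_adjoint T" and psd: "psd_on (Omega\<^sup>\<bottom>) (blk22 T)"
    and cl: "closed (ran (blk22 T))" and ran: "ran (blk21 T) \<subseteq> ran (blk22 T)"
  shows "x \<bullet> T x \<ge> x \<bullet> schur22 T x"
proof -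
  let ?P = "orth_proj Omega :: ('h ^ 'n) \<Rightarrow>\<^sub>L ('h ^ 'n)"
  let ?Q = "orth_proj (Omega\<^sup>\<bottom>) :: ('h ^ 'n) \<Rightarrow>\<^sub>L ('h ^ 'n)"
  define S where "S = pseudo_inverse (blk22 T)"
  have S: "?Q (T (?Q (S (?Q (T (?P x)))))) = ?Q (T (?P x))" for x
  proof -
    have "blk21 T x \<in> ran (blk22 T)"
      using ran by (auto simp: ran_def)
    then show ?thesis
      using blk22_pseudo_inverse(2)[OF T cl, of "blk21 T x"] by (simp add: S_def blk22_def blk21_def)
  qed
  have QP: "?Q u + ?P u = u" for u
    using orth_proj_Omega_decomp[of u] by (simp add: add.commute)
  define y where "y = ?Q (x + S (?Q (T (?P x))))"
  have y: "y \<in> Omega\<^sup>\<bottom>"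
    unfolding y_def by (simp add: orth_proj subspace_orthogonal_comp closed_orthogonal_comp)
  have "?Q y = y"
    using y by (simp add: orth_proj_Omega_orth orth_proj_Omega_0)
  then have "blk22 T y \<bullet> y = y \<bullet> T y"
    using self_adjointD[OF self_adjoint_orth_proj_Omega(2), of "T y" y]
    by (simp add: blk22_def inner_commute)
  then have "y \<bullet> T y \<ge> 0"
    using psd y unfolding psd_on_def by fastforce
  moreover have "x \<bullet> T x = x \<bullet> schur22 T x + y \<bullet> T y"
    unfolding y_def schur22_apply S_def[symmetric]
    by (rule schur_complete_square[OF T self_adjoint_orth_proj_Omega(2,1) QP S])
  ultimately show ?thesis by simp
qed

lemma inner_schur22_proj:
  fixes T :: "('h::{real_inner,banach} ^ 'n) \<Rightarrow>\<^sub>L ('h ^ 'n)"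
  shows "x \<bullet> schur22 T x = orth_proj Omega x \<bullet> schur22 T (orth_proj Omega x)"
proof -
  let ?P = "orth_proj Omega :: ('h ^ 'n) \<Rightarrow>\<^sub>L ('h ^ 'n)"
  have PP: "?P (?P u) = ?P u" for u
    by (simp add: orth_proj_Omega_id orth_proj_Omega)
  have "schur22 T x = ?P (schur22 T (?P x))"
    by (simp add: schur22_apply PP blinfun.diff_right)
  then show ?thesis
    using self_adjointD[OF self_adjoint_orth_proj_Omega(1), of x "schur22 T (?P x)"] by simp
qed

lemma self_adjoint_schur22:
  fixes T :: "('h::{real_inner,banach} ^ 'n) \<Rightarrow>\<^sub>L ('h ^ 'n)"
  assumes T: "self_adjoint T" and cl: "closed (ran (blk22 T))"
  shows "self_adjoint (schur22 T)"
  by (intro self_adjointI)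
    (simp add: schur22_apply inner_diff_left inner_diff_right self_adjointD[OF T]
      self_adjointD[OF self_adjoint_orth_proj_Omega(1)] self_adjointD[OF self_adjoint_orth_proj_Omega(2)]
      self_adjointD[OF blk22_pseudo_inverse(1)[OF T cl]])

lemma schur22_orth: "w \<in> Omega\<^sup>\<bottom> \<Longrightarrow> schur22 T w = 0"
  by (simp add: schur22_apply orth_proj_Omega_0)

section \<open>Semimonotone and cocoercive operators\<close>

lemma lambda_max_less_imp:
  assumes "lambda_max T < 1"
  obtains c where "c < 1" "\<And>x. blinfun_apply T x \<bullet> x \<le> c * (norm x)\<^sup>2"
proof -
  obtain c where c: "lambda_max T < ereal c" "ereal c < 1"
    using ereal_dense2[OF assms] by blast
  have unit: "T x \<bullet> x \<le> c" if "norm x = 1" for x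
  proof -
    have "ereal (T x \<bullet> x) \<le> lambda_max T"
      unfolding lambda_max_def using that by (intro SUP_upper) simp
    then have "ereal (T x \<bullet> x) < ereal c"
      using c(1) by (rule le_less_trans)
    then show ?thesis by simp
  qed
  have "T x \<bullet> x \<le> c * (norm x)\<^sup>2" for x
  proof (cases "x = 0")
    case False
    have "T (inverse (norm x) *\<^sub>R x) \<bullet> (inverse (norm x) *\<^sub>R x) \<le> c"
      using False by (intro unit) simp
    then show ?thesis
      using False by (simp add: blinfun.scaleR_right power2_eq_square field_simps)
  qed simp
  with c(2) show thesis
    by (intro that[of c]) auto
qed

lemma diag_set_semimonotone:
  assumes "\<And>i. semimonotone (U i) (V i) (A i)" "a \<in> diag_set A x" "a' \<in> diag_set A x'"
  shows "(x - x') \<bullet> (a - a') \<ge> (x - x') \<bullet> diag_op U (x - x') + (a - a') \<bullet> diag_op V (a - a')"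
proof -
  have "(x $ i - x' $ i) \<bullet> (a $ i - a' $ i)
      \<ge> (x $ i - x' $ i) \<bullet> U i (x $ i - x' $ i) + (a $ i - a' $ i) \<bullet> V i (a $ i - a' $ i)" for i
    using assms by (fastforce simp: semimonotone_def diag_set_def graph_def)
  then show ?thesis
    unfolding inner_diag_op by (simp add: inner_vec_def sum_mono flip: sum.distrib)
qed

text \<open>Otherwise adding \<open>(x, a)\<close> to the graph would give a strictly larger semimonotone operator.\<close>

lemma max_semimonotone_violator:
  assumes max: "max_semimonotone U V A" and "a \<notin> A x"
  obtains y v where "v \<in> A y"
    "(x - y) \<bullet> (a - v) < (x - y) \<bullet> blinfun_apply U (x - y) + (a - v) \<bullet> blinfun_apply V (a - v)"
proof -
  define A' where "A' = A(x := insert a (A x))"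
  have gr: "graph A' = insert (x, a) (graph A)"
    by (auto simp: A'_def graph_def split: if_splits)
  have "(x, a) \<notin> graph A"
    using assms(2) by (simp add: graph_def)
  then have "graph A \<subset> graph A'"
    unfolding gr by blast
  then have "\<not> semimonotone U V A'" and sm: "semimonotone U V A"
    using max unfolding max_semimonotone_def by blast+
  let ?gap = "\<lambda>p q p' q'. (p - p') \<bullet> U (p - p') + (q - q') \<bullet> V (q - q') \<le> (p - p') \<bullet> (q - q')"
  have sym: "?gap p q p' q' \<longleftrightarrow> ?gap p' q' p q" for p q p' q'
  proof -
    have "U (p - p') = - U (p' - p)" "V (q - q') = - V (q' - q)"
      by (simp_all flip: blinfun.minus_right)
    then show ?thesis
      by (metis inner_minus_left inner_minus_right minus_diff_eq minus_minus)
  qed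
  note violator = that
  show thesis
  proof (rule ccontr)
    assume no: "\<not> thesis"
    have new: "?gap x a p q" if "q \<in> A p" for p q
      using that no violator by (meson not_less)
    have old: "?gap p q p' q'" if "q \<in> A p" "q' \<in> A p'" for p q p' q'
      using sm that unfolding semimonotone_def graph_def by blast
    have "semimonotone U V A'"
      unfolding semimonotone_def gr
    proof (intro ballI, clarify)
      fix p q p' q'
      assume "(p, q) \<in> insert (x, a) (graph A)" "(p', q') \<in> insert (x, a) (graph A)"
      then consider "p = x" "q = a" "p' = x" "q' = a" | "p = x" "q = a" "q' \<in> A p'"
        | "q \<in> A p" "p' = x" "q' = a" | "q \<in> A p" "q' \<in> A p'"
        by (auto simp: graph_def)
      then show "?gap p q p' q'"
      proof cases
        case 1
        then show ?thesis by simp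
      next
        case 2
        then show ?thesis using new by blast
      next
        case 3
        then show ?thesis using new sym by blast
      next
        case 4
        then show ?thesis using old by blast
      qed
    qed
    with \<open>\<not> semimonotone U V A'\<close> show False by simp
  qed
qed

text \<open>Maximality passes to the product: were some component of \<open>a\<close> outside its graph,
  choose a violating pair in each such component and \<open>(x\<^sub>i, a\<^sub>i)\<close> itself in all others. The gaps then add up to
  a negative number.\<close>

lemma diag_set_maximal:
  fixes x a :: "'h::{real_inner,banach} ^ 'n"
  assumes max: "\<And>i. max_semimonotone (U i) (V i) (A i)"
    and rel: "\<And>y v. v \<in> diag_set A y \<Longrightarrow>
      (x - y) \<bullet> (a - v) \<ge> (x - y) \<bullet> diag_op U (x - y) + (a - v) \<bullet> diag_op V (a - v)"
  shows "a \<in> diag_set A x"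
proof (rule ccontr)
  assume "a \<notin> diag_set A x"
  then obtain i0 where i0: "a $ i0 \<notin> A i0 (x $ i0)"
    by (auto simp: diag_set_def)
  define gap where "gap i y v = (x $ i - y) \<bullet> (a $ i - v)
      - ((x $ i - y) \<bullet> U i (x $ i - y) + (a $ i - v) \<bullet> V i (a $ i - v))" for i y v
  have "\<exists>y v. v \<in> A i y \<and> gap i y v \<le> 0 \<and> (a $ i \<notin> A i (x $ i) \<longrightarrow> gap i y v < 0)" for i
  proof (cases "a $ i \<in> A i (x $ i)")
    case True
    then show ?thesis
      by (intro exI[of _ "x $ i"] exI[of _ "a $ i"]) (simp add: gap_def)
  next
    case False
    then obtain y v where "v \<in> A i y" "gap i y v < 0"
      using max_semimonotone_violator[OF max False] unfolding gap_def by (metis diff_less_0_iff_less)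
    then show ?thesis by (meson less_imp_le)
  qed
  then obtain y v where yv: "\<And>i. v i \<in> A i (y i)" "\<And>i. gap i (y i) (v i) \<le> 0"
    "\<And>i. a $ i \<notin> A i (x $ i) \<Longrightarrow> gap i (y i) (v i) < 0"
    by metis
  have "(\<Sum>i\<in>UNIV. gap i (y i) (v i)) < (\<Sum>i\<in>(UNIV :: 'n set). 0)"
    using yv i0 by (intro sum_strict_mono_ex1) auto
  moreover have "0 \<le> (\<Sum>i\<in>UNIV. gap i (y i) (v i))"
  proof -
    have "vec_lambda v \<in> diag_set A (vec_lambda y)"
      using yv(1) by (simp add: diag_set_def)
    from rel[OF this] show ?thesis
      unfolding inner_diag_op by (simp add: inner_vec_def gap_def sum_subtractf sum.distrib)
  qed
  ultimately show False by simp
qed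

text \<open>The first part is Young's inequality with weights \<open>W\<^sup>-\<^sup>1\<close> and \<open>W\<close>: for \<open>B u - B v = W e\<close> it says that the form
  of \<open>W\<close> is nonnegative at \<open>e + d / 2\<close>. The second part is used where only Lipschitz continuity and a quantitative
  convergence of the values of \<open>B\<close> matter.\<close>

lemma cocoercive_inverse:
  assumes W: "self_adjoint W" "strongly_monotone_on UNIV W"
    and B: "cocoercive (inv (blinfun_apply W)) B"
  shows "- (d \<bullet> (B u - B v)) \<le> (u - v) \<bullet> (B u - B v) + (1/4) * (d \<bullet> W d)"
    and "\<exists>c>0. \<forall>u v. (u - v) \<bullet> (B u - B v) \<ge> c * (norm (B u - B v))\<^sup>2"
proof -
  obtain \<alpha> where \<alpha>: "\<alpha> > 0" "\<And>x. W x \<bullet> x \<ge> \<alpha> * (norm x)\<^sup>2"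
    using W(2) by (auto simp: strongly_monotone_on_def)
  have surj: "W (inv (blinfun_apply W) y) = y" for y
    using strongly_monotone_bij[OF W(2)] by (simp add: bij_is_surj surj_f_inv_f)
  show "- (d \<bullet> (B u - B v)) \<le> (u - v) \<bullet> (B u - B v) + (1/4) * (d \<bullet> W d)"
  proof -
    define e where "e = inv (blinfun_apply W) (B u - B v)"
    have We: "W e = B u - B v" by (simp add: e_def surj)
    have "0 \<le> W (e + (1/2) *\<^sub>R d) \<bullet> (e + (1/2) *\<^sub>R d)"
      using \<alpha> by (metis mult_nonneg_nonneg less_imp_le order_trans zero_le_power2)
    also have "\<dots> = W e \<bullet> e + d \<bullet> W e + (1/4) * (d \<bullet> W d)"
      using self_adjointD[OF W(1), of d e]
      by (simp add: blinfun.bilinear_simps inner_simps inner_commute algebra_simps)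
    finally have "0 \<le> W e \<bullet> e + d \<bullet> W e + (1/4) * (d \<bullet> W d)" .
    moreover have "W e \<bullet> e \<le> (u - v) \<bullet> (B u - B v)"
      using B unfolding cocoercive_def We by (simp add: e_def)
    ultimately show ?thesis
      by (simp add: We)
  qed
  define K where "K = norm W + 1"
  have K: "K > 0" by (simp add: K_def add_nonneg_pos)
  show "\<exists>c>0. \<forall>u v. (u - v) \<bullet> (B u - B v) \<ge> c * (norm (B u - B v))\<^sup>2"
  proof (intro exI[of _ "\<alpha> / K\<^sup>2"] conjI allI)
    fix u v
    define e where "e = inv (blinfun_apply W) (B u - B v)"
    have We: "W e = B u - B v" by (simp add: e_def surj)
    have "norm (W e) \<le> K * norm e"
      using norm_blinfun[of W e] by (simp add: K_def distrib_right add_increasing2)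
    then have "(norm (W e))\<^sup>2 \<le> K\<^sup>2 * (norm e)\<^sup>2"
      by (metis norm_ge_zero power_mono power_mult_distrib)
    then have "\<alpha> / K\<^sup>2 * (norm (W e))\<^sup>2 \<le> \<alpha> * (norm e)\<^sup>2"
      using \<alpha>(1) K by (simp add: field_simps)
    also have "\<dots> \<le> W e \<bullet> e" by (rule \<alpha>(2))
    also have "\<dots> \<le> (u - v) \<bullet> (B u - B v)"
      using B unfolding cocoercive_def We by (simp add: e_def)
    finally show "\<alpha> / K\<^sup>2 * (norm (B u - B v))\<^sup>2 \<le> (u - v) \<bullet> (B u - B v)"
      by (simp add: We)
  qed (use \<alpha> K in simp)
qed

section \<open>Explicit forms of the inclusions\<close>

lemma P1_solutions_iff:
  "u \<in> P1_solutions A B \<longleftrightarrow> (\<exists>a. (\<forall>i. a i \<in> A i u) \<and> (\<Sum>i\<in>UNIV. a i) + (\<Sum>j\<in>UNIV. B j u) = 0)"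
  by (auto simp: P1_solutions_def zer_def set_plus_def set_sum_alt)

lemma Phi_iff:
  "x \<in> Phi A B P R L \<gamma> w \<longleftrightarrow>
    (\<exists>a\<in>diag_set A x. w = \<gamma> *\<^sub>R a + \<gamma> *\<^sub>R P (diag_fun B (R x)) + L x)"
  by (auto simp: Phi_def inv_op_def set_plus_def)

text \<open>Multiplying the resolvent inclusion by \<open>D\<close> removes the inverses from the \<open>x\<close>-update.\<close>

lemma J_scaled_mem:
  assumes D: "strongly_monotone_on UNIV D" and "x \<in> J_scaled \<gamma> D A (inv (blinfun_apply D) v)"
  obtains a where "a \<in> A x" "v = D x + \<gamma> *\<^sub>R a"
proof -
  have surj: "D (inv (blinfun_apply D) y) = y" for y
    using strongly_monotone_bij[OF D] by (simp add: bij_is_surj surj_f_inv_f)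
  obtain a where a: "a \<in> A x" "inv (blinfun_apply D) v = x + \<gamma> *\<^sub>R inv (blinfun_apply D) a"
    using assms(2) by (auto simp: J_scaled_def resolvent_def inv_op_def set_plus_def)
  then have "v = D (x + \<gamma> *\<^sub>R inv (blinfun_apply D) a)"
    by (metis surj)
  then show thesis
    using a(1) by (intro that) (auto simp: blinfun.add_right blinfun.scaleR_right surj)
qed

lemma block_N_entries:
  fixes L :: "'n::finite \<Rightarrow> 'n \<Rightarrow> ('h::real_normed_vector \<Rightarrow>\<^sub>L 'h)" and x :: "'h ^ 'n"
  shows "(\<Sum>j\<in>UNIV. blinfun_apply (N_entries L i j) (x $ j)) = L i i (x $ i) - block L x $ i"
proof -
  have "(\<Sum>j\<in>UNIV. blinfun_apply (diag_entries (\<lambda>i. L i i) i j) (x $ j)) = L i i (x $ i)"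
    using diag_op_nth[of "\<lambda>i. L i i" x i] by (simp add: diag_op_def block_nth)
  then show ?thesis
    by (simp add: N_entries_def blinfun.diff_left sum_subtractf block_nth)
qed

section \<open>The splitting framework\<close>

text \<open>The standing hypotheses with \<open>P\<close>, \<open>R\<close>, \<open>L\<close>, \<open>M\<close> as operators on the product spaces. The assumption
  \<open>L_vec\<close> is \<open>\<Sum>\<^sub>i\<^sub>j L\<^sub>i\<^sub>j = 0\<close> in terms of the block operator.\<close>

locale splitting =
  fixes A :: "'n::finite \<Rightarrow> 'h::{real_inner,banach} \<Rightarrow> 'h set"
    and B :: "'p::finite \<Rightarrow> 'h \<Rightarrow> 'h"
    and U V :: "'n \<Rightarrow> ('h \<Rightarrow>\<^sub>L 'h)"
    and W :: "'p \<Rightarrow> ('h \<Rightarrow>\<^sub>L 'h)"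
    and P :: "('h ^ 'p) \<Rightarrow>\<^sub>L ('h ^ 'n)"
    and R :: "('h ^ 'n) \<Rightarrow>\<^sub>L ('h ^ 'p)"
    and L :: "('h ^ 'n) \<Rightarrow>\<^sub>L ('h ^ 'n)"
    and M :: "('h ^ 'm::finite) \<Rightarrow>\<^sub>L ('h ^ 'n)"
    and \<Theta> :: "real \<Rightarrow> (('h ^ 'n) \<Rightarrow>\<^sub>L ('h ^ 'n))"
    and \<gamma> :: real
  assumes solvable: "P1_solutions A B \<noteq> {}"
    and P_vec: "adjoint_op P (vec u) = vec u"
    and R_vec: "R (vec u) = vec u"
    and U_sa: "self_adjoint (U i)" and V_sa: "self_adjoint (V i)"
    and A_max: "max_semimonotone (U i) (V i) (A i)"
    and W_sa: "self_adjoint (W j)" and W_mono: "strongly_monotone_on UNIV (W j)"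
    and B_coco: "cocoercive (inv (blinfun_apply (W j))) (B j)"
    and kernel_M: "kernel (adjoint_op M) = Omega"
    and closed_M: "closed (ran M)"
    and L_vec: "L (vec u) \<in> Omega\<^sup>\<bottom>"
    and kernel_L: "kernel (sym_part L) = Omega"
    and L_mono: "strongly_monotone_on (Omega\<^sup>\<bottom>) (sym_part L)"
    and U_cases: "diag_op U = 0 \<or> strongly_monotone_on Omega (blk11 (diag_op U))"
    and V_cases: "(caseI V \<and> \<Theta> = Theta_I P R (diag_op W)) \<or> (caseII B V \<and> \<Theta> = Theta_II L (diag_op V))"
    and \<gamma>: "\<gamma> \<in> Lambda_set A B P R L" "\<gamma> \<in> Gamma_set L \<Theta> (diag_op U)"
begin

abbreviation Q :: "('h ^ 'n) \<Rightarrow>\<^sub>L ('h ^ 'n)" where "Q \<equiv> orth_proj (Omega\<^sup>\<bottom>)"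
abbreviation Pr :: "('h ^ 'n) \<Rightarrow>\<^sub>L ('h ^ 'n)" where "Pr \<equiv> orth_proj Omega"
abbreviation \<Phi> :: "'h ^ 'n \<Rightarrow> ('h ^ 'n) set" where "\<Phi> \<equiv> Phi A B P R L \<gamma>"
definition \<Xi> :: "('h ^ 'n) \<Rightarrow>\<^sub>L ('h ^ 'n)" where "\<Xi> = Xi_hat L \<Theta> (diag_op U) \<gamma>"

lemma \<gamma>_pos: "\<gamma> > 0"
  using \<gamma>(1) by (simp add: Lambda_set_def)

lemma Phi_singleton: "w \<in> Omega\<^sup>\<bottom> \<Longrightarrow> \<exists>x. \<Phi> w = {x}"
  using \<gamma>(1) by (simp add: Lambda_set_def)

lemma Q_mem: "Q x \<in> Omega\<^sup>\<bottom>"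
  by (simp add: orth_proj subspace_orthogonal_comp closed_orthogonal_comp)

lemma diag_U_sa: "self_adjoint (diag_op U)" and diag_V_sa: "self_adjoint (diag_op V)"
  and diag_W_sa: "self_adjoint (diag_op W)"
  by (simp_all add: self_adjoint_diag_op U_sa V_sa W_sa)

lemma A_semimonotone: "semimonotone (U i) (V i) (A i)"
  using A_max[of i] by (simp add: max_semimonotone_def)

lemma L_sum: "(\<Sum>i\<in>UNIV. L (vec u) $ i) = 0"
  using L_vec[of u] by (simp add: Omega_orth_iff)

lemma sym_L_vec: "sym_part L (vec u) = 0"
  using kernel_L vec_in_Omega[of u] unfolding kernel_def by blast

section \<open>The basic estimate\<close>

lemma inner_B_le:
  "- (d \<bullet> (diag_fun B r - diag_fun B s))
    \<le> (r - s) \<bullet> (diag_fun B r - diag_fun B s) + (1/4) * (d \<bullet> diag_op W d)"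
proof -
  have "- (\<Sum>j\<in>UNIV. d $ j \<bullet> (B j (r $ j) - B j (s $ j)))
      \<le> (\<Sum>j\<in>UNIV. (r $ j - s $ j) \<bullet> (B j (r $ j) - B j (s $ j)) + (1/4) * (d $ j \<bullet> W j (d $ j)))"
    unfolding sum_negf[symmetric]
    by (intro sum_mono cocoercive_inverse(1) W_sa W_mono B_coco)
  then show ?thesis
    unfolding inner_diag_op by (simp add: inner_vec_def diag_fun_def sum.distrib sum_divide_distrib)
qed

lemma B_uniformly_cocoercive:
  obtains c where "c > 0"
    "\<And>r s. (r - s) \<bullet> (diag_fun B r - diag_fun B s) \<ge> c * (norm (diag_fun B r - diag_fun B s))\<^sup>2"
proof -
  have "\<exists>c. c > 0 \<and> (\<forall>u v. (u - v) \<bullet> (B j u - B j v) \<ge> c * (norm (B j u - B j v))\<^sup>2)" for j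
    using cocoercive_inverse(2)[OF W_sa W_mono B_coco] by blast
  then obtain c where c: "\<And>j. c j > 0"
    "\<And>j u v. (u - v) \<bullet> (B j u - B j v) \<ge> c j * (norm (B j u - B j v))\<^sup>2"
    by metis
  define m where "m = Min (range c)"
  have "m > 0" "\<And>j. m \<le> c j"
    using c(1) by (auto simp: m_def)
  show thesis
  proof (rule that[OF \<open>m > 0\<close>])
    fix r s :: "'h ^ 'p"
    have "m * (norm (B j (r $ j) - B j (s $ j)))\<^sup>2 \<le> (r $ j - s $ j) \<bullet> (B j (r $ j) - B j (s $ j))" for j
      using c(2)[of j] mult_right_mono[OF \<open>m \<le> c j\<close>, of "(norm (B j (r $ j) - B j (s $ j)))\<^sup>2"]
      by (meson order_trans zero_le_power2)
    then have "(\<Sum>j\<in>UNIV. m * (norm (B j (r $ j) - B j (s $ j)))\<^sup>2)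
        \<le> (\<Sum>j\<in>UNIV. (r $ j - s $ j) \<bullet> (B j (r $ j) - B j (s $ j)))"
      by (rule sum_mono)
    then show "(r - s) \<bullet> (diag_fun B r - diag_fun B s) \<ge> m * (norm (diag_fun B r - diag_fun B s))\<^sup>2"
      unfolding power2_norm_eq_inner by (simp add: inner_vec_def diag_fun_def sum_distrib_left)
  qed
qed

text \<open>The basic inequality before the term in \<open>U\<close> is reduced to a Schur complement; \<open>\<Theta>\<close> is what the forward
  operator (Case I) or the outputs of \<open>A\<close> (Case II) can cost at most.\<close>

lemma resolvent_estimate:
  assumes x: "x \<in> \<Phi> w" "w \<in> Omega\<^sup>\<bottom>" and x': "x' \<in> \<Phi> w'" "w' \<in> Omega\<^sup>\<bottom>"
  shows "(x - x') \<bullet> (w - w') \<ge> (x - x') \<bullet> (sym_part L - \<Theta> \<gamma>) (x - x') + \<gamma> * ((x - x') \<bullet> diag_op U (x - x'))"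
proof -
  obtain a where a: "a \<in> diag_set A x" "w = \<gamma> *\<^sub>R a + \<gamma> *\<^sub>R P (diag_fun B (R x)) + L x"
    using x(1) by (auto simp: Phi_iff)
  obtain a' where a': "a' \<in> diag_set A x'" "w' = \<gamma> *\<^sub>R a' + \<gamma> *\<^sub>R P (diag_fun B (R x')) + L x'"
    using x'(1) by (auto simp: Phi_iff)
  define d where "d = x - x'"
  define e where "e = a - a'"
  define b where "b = diag_fun B (R x) - diag_fun B (R x')"
  have w: "w - w' = \<gamma> *\<^sub>R e + \<gamma> *\<^sub>R P b + L d"
    by (simp add: a a' d_def e_def b_def blinfun.diff_right algebra_simps)
  have semi: "d \<bullet> e \<ge> d \<bullet> diag_op U d + e \<bullet> diag_op V e"
    unfolding d_def e_def by (rule diag_set_semimonotone[OF A_semimonotone a(1) a'(1)])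
  have dw: "d \<bullet> (w - w') = \<gamma> * (d \<bullet> e) + \<gamma> * (d \<bullet> P b) + d \<bullet> sym_part L d"
    unfolding w inner_sym_part by (simp add: inner_add_right)
  have main: "\<gamma> * (d \<bullet> e) + \<gamma> * (d \<bullet> P b) \<ge> \<gamma> * (d \<bullet> diag_op U d) - d \<bullet> \<Theta> \<gamma> d"
    using V_cases
  proof
    assume I: "caseI V \<and> \<Theta> = Theta_I P R (diag_op W)"
    \<comment> \<open>\<open>B\<close> is cocoercive along \<open>R d\<close> but is paired with \<open>P\<^sup>* d\<close>; \<open>q\<close> is the discrepancy\<close>
    define q where "q = adjoint_op P d - R d"
    have "d \<bullet> \<Theta> \<gamma> d = (\<gamma> / 4) * (d \<bullet> (P (diag_op W q) - adjoint_op R (diag_op W q)))"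
      using I by (simp add: Theta_I_def q_def blinfun.scaleR_left blinfun.diff_left)
    also have "\<dots> = (\<gamma> / 4) * (q \<bullet> diag_op W q)"
      by (simp add: q_def inner_diff_right inner_diff_left adjoint_op_inner adjoint_op_inner')
    finally have \<Theta>: "d \<bullet> \<Theta> \<gamma> d = (\<gamma> / 4) * (q \<bullet> diag_op W q)" .
    have "- (q \<bullet> b) \<le> R d \<bullet> b + (1/4) * (q \<bullet> diag_op W q)"
      using inner_B_le[of q "R x" "R x'"] by (simp add: b_def d_def blinfun.diff_right)
    moreover have "d \<bullet> P b = q \<bullet> b + R d \<bullet> b"
      by (simp add: q_def inner_diff_left adjoint_op_inner)
    ultimately have "- ((1/4) * (q \<bullet> diag_op W q)) \<le> d \<bullet> P b"
      by linarith
    moreover have "d \<bullet> diag_op U d \<le> d \<bullet> e"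
      using semi I by (simp add: caseI_def)
    ultimately have "\<gamma> * (d \<bullet> diag_op U d + - ((1/4) * (q \<bullet> diag_op W q))) \<le> \<gamma> * (d \<bullet> e + d \<bullet> P b)"
      using \<gamma>_pos by (intro mult_left_mono add_mono) auto
    then show ?thesis
      unfolding \<Theta> by (simp add: algebra_simps)
  next
    assume II: "caseII B V \<and> \<Theta> = Theta_II L (diag_op V)"
    then have "b = 0" by (simp add: b_def caseII_def)
    let ?S = "schur22 (diag_op V)"
    \<comment> \<open>the diagonal component of \<open>\<gamma> e = (w - w') - L d\<close> does not involve \<open>w - w'\<close>\<close>
    have "L d \<bullet> ?S (L d) = Pr (L d) \<bullet> ?S (Pr (L d))"
      by (rule inner_schur22_proj)
    also have "Pr (L d) = - (\<gamma> *\<^sub>R Pr e)"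
    proof -
      have "Pr (w - w') = 0"
        using x(2) x'(2) by (intro orth_proj_Omega_0 subspace_diff subspace_orthogonal_comp)
      then show ?thesis
        unfolding w \<open>b = 0\<close> by (simp add: blinfun.bilinear_simps add_eq_0_iff)
    qed
    also have "- (\<gamma> *\<^sub>R Pr e) \<bullet> ?S (- (\<gamma> *\<^sub>R Pr e)) = \<gamma> * (\<gamma> * (e \<bullet> ?S e))"
      unfolding inner_schur22_proj[of e] by (simp add: blinfun.minus_right blinfun.scaleR_right)
    finally have "(1 / \<gamma>) * (L d \<bullet> ?S (L d)) = \<gamma> * (e \<bullet> ?S e)"
      using \<gamma>_pos by simp
    moreover have "e \<bullet> ?S e \<le> e \<bullet> diag_op V e"
      using II by (intro inner_schur22_le diag_V_sa) (auto simp: caseII_def)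
    moreover have "d \<bullet> \<Theta> \<gamma> d = - ((1 / \<gamma>) * (L d \<bullet> ?S (L d)))"
      using II by (simp add: Theta_II_def blinfun.minus_left blinfun.scaleR_left adjoint_op_inner')
    moreover have "\<gamma> * (d \<bullet> diag_op U d + e \<bullet> ?S e) \<le> \<gamma> * (d \<bullet> e)"
      using semi \<open>e \<bullet> ?S e \<le> e \<bullet> diag_op V e\<close> \<gamma>_pos by (intro mult_left_mono) linarith+
    ultimately show ?thesis
      by (simp add: \<open>b = 0\<close> distrib_left)
  qed
  have "d \<bullet> (sym_part L - \<Theta> \<gamma>) d = d \<bullet> sym_part L d - d \<bullet> \<Theta> \<gamma> d"
    by (simp add: blinfun.diff_left inner_diff_right)
  then show ?thesis
    unfolding d_def[symmetric] dw using main by linarith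
qed

section \<open>The preconditioner\<close>

lemma \<Theta>_sa: "self_adjoint (\<Theta> \<gamma>)"
  using V_cases
proof
  assume I: "caseI V \<and> \<Theta> = Theta_I P R (diag_op W)"
  have form: "((P - adjoint_op R) o\<^sub>L diag_op W o\<^sub>L (adjoint_op P - R)) y \<bullet> x
      = diag_op W ((adjoint_op P - R) y) \<bullet> (adjoint_op P - R) x" for x y
    by (simp add: blinfun.diff_left inner_diff_left inner_diff_right adjoint_op_inner adjoint_op_inner')
  have "self_adjoint ((P - adjoint_op R) o\<^sub>L diag_op W o\<^sub>L (adjoint_op P - R))"
    by (rule self_adjointI) (metis form inner_commute self_adjointD[OF diag_W_sa])
  with I show ?thesis
    by (simp add: Theta_I_def self_adjoint_scaleR)
next
  assume II: "caseII B V \<and> \<Theta> = Theta_II L (diag_op V)"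
  have sa: "self_adjoint (schur22 (diag_op V))"
    using II by (intro self_adjoint_schur22 diag_V_sa) (simp add: caseII_def)
  have form: "(adjoint_op L o\<^sub>L schur22 (diag_op V) o\<^sub>L L) y \<bullet> x = schur22 (diag_op V) (L y) \<bullet> L x" for x y
    by (simp add: adjoint_op_inner)
  have "self_adjoint (adjoint_op L o\<^sub>L schur22 (diag_op V) o\<^sub>L L)"
    by (rule self_adjointI) (metis form inner_commute self_adjointD[OF sa])
  then have "self_adjoint ((- 1 / \<gamma>) *\<^sub>R (adjoint_op L o\<^sub>L schur22 (diag_op V) o\<^sub>L L))"
    by (rule self_adjoint_scaleR)
  with II show ?thesis
    by (simp add: Theta_II_def)
qed

lemma \<Theta>_vec: "\<Theta> \<gamma> (vec u) = 0"
  using V_cases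
  by (auto simp: Theta_I_def Theta_II_def blinfun.bilinear_simps P_vec R_vec schur22_orth[OF L_vec])

lemma schur11_U_sa: "self_adjoint (schur11 (diag_op U))"
  using U_cases by (auto simp: schur11_zero self_adjoint_zero intro: self_adjoint_schur11 diag_U_sa)

lemma \<Xi>_sa: "self_adjoint \<Xi>"
  unfolding \<Xi>_def Xi_hat_def
  by (intro self_adjoint_add self_adjoint_diff self_adjoint_scaleR self_adjoint_sym_part \<Theta>_sa schur11_U_sa)

lemma \<Xi>_vec: "\<Xi> (vec u) = 0"
  by (simp add: \<Xi>_def Xi_hat_def blinfun.bilinear_simps sym_L_vec \<Theta>_vec schur11_vec)

lemma sym_L_psd: "psd_on UNIV (sym_part L)"
  unfolding psd_on_def
proof
  fix x
  obtain \<alpha> where \<alpha>: "\<alpha> > 0" "\<And>x. x \<in> Omega\<^sup>\<bottom> \<Longrightarrow> sym_part L x \<bullet> x \<ge> \<alpha> * (norm x)\<^sup>2"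
    using L_mono by (auto simp: strongly_monotone_on_def)
  have "0 \<le> \<alpha> * (norm (Q x))\<^sup>2"
    using \<alpha>(1) by simp
  then show "0 \<le> sym_part L x \<bullet> x"
    using \<alpha>(2)[OF Q_mem, of x] form_vanishing_on_Omega(2)[OF self_adjoint_sym_part sym_L_vec, of x]
    by (simp add: inner_commute)
qed

text \<open>For \<open>x\<close> orthogonal to the diagonal, \<open>x = (L\<^sub>s\<^sup>1\<^sup>/\<^sup>2)\<^sup>\<dagger> L\<^sub>s\<^sup>1\<^sup>/\<^sup>2 x\<close>, so the bound on \<open>\<lambda>\<^sub>m\<^sub>a\<^sub>x\<close> reads
  \<open>\<langle>x, (\<Theta> - \<gamma> X) x\<rangle> \<le> c \<langle>x, L\<^sub>s x\<rangle>\<close> with \<open>c < 1\<close>.\<close>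

lemma \<Xi>_mono:
  obtains \<kappa> where "\<kappa> > 0" "\<And>x. x \<bullet> \<Xi> x \<ge> \<kappa> * (norm (Q x))\<^sup>2"
proof -
  obtain \<alpha> where \<alpha>: "\<alpha> > 0" "\<And>x. x \<in> Omega\<^sup>\<bottom> \<Longrightarrow> sym_part L x \<bullet> x \<ge> \<alpha> * (norm x)\<^sup>2"
    using L_mono by (auto simp: strongly_monotone_on_def)
  define E where "E = \<Theta> \<gamma> - \<gamma> *\<^sub>R schur11 (diag_op U)"
  define S where "S = sqrt_op (sym_part L)"
  define T where "T = pseudo_inverse S"
  note pi = pseudo_inverse_sqrt_op[OF self_adjoint_sym_part sym_L_psd, unfolded kernel_L, OF L_mono, folded S_def, folded T_def]
  have "lambda_max (T o\<^sub>L E o\<^sub>L T) < 1"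
    using \<gamma>(2) by (simp add: Gamma_set_def T_def S_def E_def)
  then obtain c where c: "c < 1" "\<And>x. (T o\<^sub>L E o\<^sub>L T) x \<bullet> x \<le> c * (norm x)\<^sup>2"
    by (rule lambda_max_less_imp) blast
  have "x \<bullet> \<Xi> x \<ge> (1 - c) * \<alpha> * (norm x)\<^sup>2" if x: "x \<in> Omega\<^sup>\<bottom>" for x
  proof -
    have "E x \<bullet> x = (T o\<^sub>L E o\<^sub>L T) (S x) \<bullet> S x"
      using self_adjointD[OF pi(1), of "E x" "S x"] by (simp add: pi(2)[OF x])
    also have "\<dots> \<le> c * (sym_part L x \<bullet> x)"
      using c(2)[of "S x"] by (simp add: S_def norm_sqrt_op[OF self_adjoint_sym_part sym_L_psd])
    finally have "E x \<bullet> x \<le> c * (sym_part L x \<bullet> x)" .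
    moreover have "x \<bullet> \<Xi> x = sym_part L x \<bullet> x - E x \<bullet> x"
      by (simp add: \<Xi>_def Xi_hat_def E_def blinfun.bilinear_simps inner_simps inner_commute)
    moreover have "(1 - c) * (\<alpha> * (norm x)\<^sup>2) \<le> (1 - c) * (sym_part L x \<bullet> x)"
      using \<alpha>(2)[OF x] c(1) by (intro mult_left_mono) auto
    ultimately show ?thesis
      by (simp add: algebra_simps)
  qed
  from this[OF Q_mem] have "x \<bullet> \<Xi> x \<ge> (1 - c) * \<alpha> * (norm (Q x))\<^sup>2" for x
    using form_vanishing_on_Omega(2)[OF \<Xi>_sa \<Xi>_vec, of x] by simp
  then show thesis
    using c(1) \<alpha>(1) by (intro that[of "(1 - c) * \<alpha>"]) auto
qed

lemma \<Xi>_psd: "psd_on UNIV \<Xi>"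
proof -
  obtain \<kappa> where \<kappa>: "\<kappa> > 0" "\<And>x. x \<bullet> \<Xi> x \<ge> \<kappa> * (norm (Q x))\<^sup>2"
    by (rule \<Xi>_mono) blast
  have "0 \<le> \<Xi> x \<bullet> x" for x
  proof -
    have "0 \<le> \<kappa> * (norm (Q x))\<^sup>2" using \<kappa>(1) by simp
    then show ?thesis using \<kappa>(2)[of x] by (simp add: inner_commute)
  qed
  then show ?thesis by (simp add: psd_on_def)
qed

lemma Q_id: "x \<in> Omega\<^sup>\<bottom> \<Longrightarrow> Q x = x"
  by (simp add: orth_proj_Omega_orth orth_proj_Omega_0)

lemma kernel_\<Xi>: "kernel \<Xi> = Omega"
proof (intro equalityI subsetI)
  obtain \<kappa> where \<kappa>: "\<kappa> > 0" "\<And>x. x \<bullet> \<Xi> x \<ge> \<kappa> * (norm (Q x))\<^sup>2"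
    by (rule \<Xi>_mono) blast
  fix x assume "x \<in> kernel \<Xi>"
  then have "\<kappa> * (norm (Q x))\<^sup>2 \<le> 0"
    using \<kappa>(2)[of x] by (simp add: kernel_def)
  then have "Q x = 0"
    using \<kappa>(1) by (simp add: mult_le_0_iff)
  then have "x = Pr x"
    by (simp add: orth_proj_Omega_orth)
  then show "x \<in> Omega"
    using orth_proj_Omega(1)[of x] by simp
qed (auto simp: kernel_def \<Xi>_vec elim: OmegaE)

lemma \<Xi>_strongly_monotone: "strongly_monotone_on (Omega\<^sup>\<bottom>) \<Xi>"
proof -
  obtain \<kappa> where \<kappa>: "\<kappa> > 0" "\<And>x. x \<bullet> \<Xi> x \<ge> \<kappa> * (norm (Q x))\<^sup>2"
    by (rule \<Xi>_mono) blast
  have "\<Xi> x \<bullet> x \<ge> \<kappa> * (norm x)\<^sup>2" if "x \<in> Omega\<^sup>\<bottom>" for x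
    using \<kappa>(2)[of x] that by (simp add: Q_id inner_commute)
  with \<kappa>(1) show ?thesis
    by (auto simp: strongly_monotone_on_def)
qed

lemma resolvent_estimate_\<Xi>:
  assumes "x \<in> \<Phi> w" "w \<in> Omega\<^sup>\<bottom>" "x' \<in> \<Phi> w'" "w' \<in> Omega\<^sup>\<bottom>"
  shows "(x - x') \<bullet> (w - w') \<ge> (x - x') \<bullet> \<Xi> (x - x')
      + \<gamma> * ((x - x') \<bullet> diag_op U (x - x') - (x - x') \<bullet> schur11 (diag_op U) (x - x'))"
    and "(x - x') \<bullet> (w - w') \<ge> (x - x') \<bullet> \<Xi> (x - x')"
proof -
  show 1: "(x - x') \<bullet> (w - w') \<ge> (x - x') \<bullet> \<Xi> (x - x')
      + \<gamma> * ((x - x') \<bullet> diag_op U (x - x') - (x - x') \<bullet> schur11 (diag_op U) (x - x'))"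
  proof -
    have "d \<bullet> \<Xi> d = d \<bullet> (sym_part L - \<Theta> \<gamma>) d + \<gamma> * (d \<bullet> schur11 (diag_op U) d)" for d
      by (simp add: \<Xi>_def Xi_hat_def blinfun.add_left blinfun.scaleR_left inner_add_right)
    then show ?thesis
      using resolvent_estimate[OF assms] by (simp only: right_diff_distrib)
  qed
  have "d \<bullet> schur11 (diag_op U) d \<le> d \<bullet> diag_op U d" for d
    using U_cases
  proof
    assume "diag_op U = 0"
    then show ?thesis by (simp add: schur11_zero)
  next
    assume "strongly_monotone_on Omega (blk11 (diag_op U))"
    then obtain \<alpha> K where K: "\<alpha> > 0" "\<And>x. x \<bullet> diag_op U x \<ge> x \<bullet> schur11 (diag_op U) x
        + \<alpha> * (norm (Pr x + blinfun_apply K (Q x)))\<^sup>2"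
      by (rule inner_schur11_le[OF diag_U_sa]) blast
    have "0 \<le> \<alpha> * (norm (Pr d + blinfun_apply K (Q d)))\<^sup>2"
      using K(1) by simp
    then show ?thesis using K(2)[of d] by linarith
  qed
  then have "0 \<le> \<gamma> * ((x - x') \<bullet> diag_op U (x - x') - (x - x') \<bullet> schur11 (diag_op U) (x - x'))"
    using \<gamma>_pos by simp
  with 1 show "(x - x') \<bullet> (w - w') \<ge> (x - x') \<bullet> \<Xi> (x - x')" by linarith
qed

section \<open>Zeros and cocoercivity of the reduced operator\<close>

lemma adjoint_M_0_iff: "adjoint_op M x = 0 \<longleftrightarrow> x \<in> Omega"
  using kernel_M unfolding kernel_def by blast

lemma M_mem: "M z \<in> Omega\<^sup>\<bottom>"
proof -
  have "adjoint_op M u \<bullet> z = 0" if "u \<in> Omega" for u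
    using that by (simp add: adjoint_M_0_iff[THEN iffD2])
  then show ?thesis
    by (simp add: orthogonal_comp_iff adjoint_op_inner)
qed

lemma M_surj: "w \<in> Omega\<^sup>\<bottom> \<Longrightarrow> \<exists>z. w = M z"
proof -
  have "(ran M)\<^sup>\<bottom> = kernel (adjoint_op M)"
  proof -
    have "x \<in> (ran M)\<^sup>\<bottom> \<longleftrightarrow> (\<forall>z. z \<bullet> adjoint_op M x = 0)" for x
      by (simp add: orthogonal_comp_iff ran_def adjoint_op_inner')
    then show ?thesis
      by (auto simp: kernel_def) (metis inner_eq_zero_iff)
  qed
  then have "ran M = Omega\<^sup>\<bottom>"
    using orthogonal_comp_comp[OF subspace_ran closed_M] by (simp add: kernel_M)
  then show "w \<in> Omega\<^sup>\<bottom> \<Longrightarrow> \<exists>z. w = M z"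
    by (auto simp: ran_def)
qed

text \<open>\<open>M\<^sup>*\<close> kills the diagonal, and the orthogonal part of \<open>d\<close> is recovered from \<open>\<Xi>\<^sup>1\<^sup>/\<^sup>2 d\<close> by the pseudo-inverse.
  Hence \<open>\<parallel>M\<^sup>* d\<parallel> \<le> N \<parallel>\<Xi>\<^sup>1\<^sup>/\<^sup>2 d\<parallel>\<close>, where \<open>N\<^sup>-\<^sup>2 = \<beta>\<^sub>\<gamma>\<close>. The inequality is stated without dividing by \<open>N\<close>,
  so that it remains meaningful for \<open>M = 0\<close>.\<close>

lemma Psi_cocoercive:
  assumes "x \<in> \<Phi> (M z)" "x' \<in> \<Phi> (M z')"
  shows "(norm (adjoint_op M x - adjoint_op M x'))\<^sup>2
    \<le> (norm (pseudo_inverse (sqrt_op \<Xi>) o\<^sub>L M))\<^sup>2 * ((z - z') \<bullet> (adjoint_op M x - adjoint_op M x'))"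
proof -
  define d where "d = x - x'"
  define v where "v = adjoint_op M d"
  define S where "S = sqrt_op \<Xi>"
  define T where "T = pseudo_inverse S"
  define N where "N = norm (T o\<^sub>L M)"
  note pi = pseudo_inverse_sqrt_op[OF \<Xi>_sa \<Xi>_psd, unfolded kernel_\<Xi>, OF \<Xi>_strongly_monotone, folded S_def, folded T_def]
  have "Pr d \<in> Omega" by (rule orth_proj_Omega(1))
  then have "adjoint_op M (Pr d) = 0" by (simp add: adjoint_M_0_iff)
  then have v: "v = adjoint_op M (Q d)"
    by (simp add: v_def orth_proj_Omega_orth blinfun.diff_right)
  have "v \<bullet> v = Q d \<bullet> M v"
    using adjoint_op_inner[of M "Q d" v] by (simp add: v)
  also have "\<dots> = T (S (Q d)) \<bullet> M v"
    by (simp add: pi(2)[OF Q_mem])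
  also have "\<dots> = S (Q d) \<bullet> (T o\<^sub>L M) v"
    using self_adjointD[OF pi(1)] by simp
  also have "\<dots> \<le> norm (S (Q d)) * (N * norm v)"
    unfolding N_def by (intro order_trans[OF norm_cauchy_schwarz] mult_left_mono norm_blinfun) simp
  finally have "norm v * norm v \<le> (norm (S (Q d)) * N) * norm v"
    by (simp add: power2_norm_eq_inner[symmetric] power2_eq_square mult.assoc)
  then have "norm v \<le> norm (S (Q d)) * N"
    by (cases "v = 0") (auto simp: N_def)
  then have "(norm v)\<^sup>2 \<le> N\<^sup>2 * (norm (S (Q d)))\<^sup>2"
    using power_mono[of "norm v" "norm (S (Q d)) * N" 2] by (simp add: power_mult_distrib mult.commute)
  also have "(norm (S (Q d)))\<^sup>2 = d \<bullet> \<Xi> d"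
    unfolding S_def norm_sqrt_op[OF \<Xi>_sa \<Xi>_psd] form_vanishing_on_Omega(2)[OF \<Xi>_sa \<Xi>_vec, of d]
    by (rule inner_commute)
  also have "N\<^sup>2 * (d \<bullet> \<Xi> d) \<le> N\<^sup>2 * (d \<bullet> (M z - M z'))"
    using resolvent_estimate_\<Xi>(2)[OF assms(1) M_mem assms(2) M_mem]
    by (intro mult_left_mono) (simp_all add: d_def)
  also have "d \<bullet> (M z - M z') = (z - z') \<bullet> v"
    using adjoint_op_inner[of M d "z - z'"] by (simp add: v_def blinfun.diff_right inner_commute)
  finally show ?thesis
    by (simp add: v_def d_def N_def T_def S_def blinfun.diff_right)
qed

lemma P_sum: "(\<Sum>i\<in>UNIV. P b $ i) = (\<Sum>j\<in>UNIV. b $ j)"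
proof (rule vector_eq_ldot[THEN iffD1], rule allI)
  fix u
  have "vec u \<bullet> P b = vec u \<bullet> b"
    using adjoint_op_inner[of P "vec u" b] by (simp add: P_vec)
  then show "u \<bullet> (\<Sum>i\<in>UNIV. P b $ i) = u \<bullet> (\<Sum>j\<in>UNIV. b $ j)"
    by (simp add: inner_vec_left)
qed

lemma Phi_vec_sum:
  "(\<Sum>i\<in>UNIV. (\<gamma> *\<^sub>R a + \<gamma> *\<^sub>R P (diag_fun B (R (vec u))) + L (vec u)) $ i)
    = \<gamma> *\<^sub>R ((\<Sum>i\<in>UNIV. a $ i) + (\<Sum>j\<in>UNIV. B j u))"
  by (simp add: sum.distrib L_sum R_vec P_sum flip: scaleR_sum_right)
    (simp add: diag_fun_def scaleR_add_right)

lemma Phi_vec_imp_solution: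
  assumes "vec u \<in> \<Phi> w" "w \<in> Omega\<^sup>\<bottom>"
  shows "u \<in> P1_solutions A B"
proof -
  obtain a where a: "a \<in> diag_set A (vec u)" "w = \<gamma> *\<^sub>R a + \<gamma> *\<^sub>R P (diag_fun B (R (vec u))) + L (vec u)"
    using assms(1) by (auto simp: Phi_iff)
  have "\<gamma> *\<^sub>R ((\<Sum>i\<in>UNIV. a $ i) + (\<Sum>j\<in>UNIV. B j u)) = 0"
    using assms(2) unfolding a(2) Omega_orth_iff Phi_vec_sum .
  then have "(\<Sum>i\<in>UNIV. a $ i) + (\<Sum>j\<in>UNIV. B j u) = 0"
    using \<gamma>_pos by simp
  then show ?thesis
    using a(1) by (auto simp: P1_solutions_iff diag_set_def intro!: exI[of _ "vec_nth a"])
qed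

text \<open>For a solution \<open>u\<close>, the element of the inclusion at \<open>(u, \<dots>, u)\<close> has components summing to zero, hence lies in
  \<open>\<Omega>\<^sup>\<bottom> = ran M\<close>. This is where closedness of the range of \<open>M\<close> is used.\<close>

lemma zero_exists: obtains z u where "vec u \<in> \<Phi> (M z)"
proof -
  obtain u a where a: "\<And>i. a i \<in> A i u" "(\<Sum>i\<in>UNIV. a i) + (\<Sum>j\<in>UNIV. B j u) = 0"
    using solvable by (auto simp: P1_solutions_iff ex_in_conv[symmetric])
  define w where "w = \<gamma> *\<^sub>R vec_lambda a + \<gamma> *\<^sub>R P (diag_fun B (R (vec u))) + L (vec u)"
  have "w \<in> Omega\<^sup>\<bottom>"
    unfolding Omega_orth_iff w_def Phi_vec_sum using a(2) by simp
  then obtain z where "w = M z" using M_surj by blast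
  have "vec_lambda a \<in> diag_set A (vec u)"
    using a(1) by (simp add: diag_set_def)
  then have "vec u \<in> \<Phi> w"
    by (auto simp: Phi_iff w_def)
  with \<open>w = M z\<close> show thesis
    by (intro that) simp
qed

section \<open>Weak closedness of the resolvent\<close>

lemma L_form_orth: "x \<bullet> L x = Q x \<bullet> sym_part L (Q x)"
  using form_vanishing_on_Omega(2)[OF self_adjoint_sym_part sym_L_vec, of x] by (simp add: inner_sym_part)

lemma weak_limit_in_Omega:
  assumes G: "G \<noteq> bot" and weak: "\<And>y. ((\<lambda>k. x k \<bullet> y) \<longlongrightarrow> x' \<bullet> y) G"
    and Qx: "((\<lambda>k. Q (x k)) \<longlongrightarrow> 0) G"
  shows "x' \<in> Omega"
proof -
  have "y \<bullet> x' = 0" if y: "y \<in> Omega\<^sup>\<bottom>" for y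
  proof -
    have "((\<lambda>k. Q (x k) \<bullet> y) \<longlongrightarrow> 0 \<bullet> y) G"
      by (intro tendsto_intros Qx)
    moreover have "Q (x k) \<bullet> y = x k \<bullet> y" for k
      using self_adjointD[OF self_adjoint_orth_proj_Omega(2), of "x k" y] by (simp add: Q_id[OF y])
    ultimately have "((\<lambda>k. x k \<bullet> y) \<longlongrightarrow> 0) G"
      by simp
    then have "x' \<bullet> y = 0"
      using tendsto_unique[OF G weak] by blast
    then show ?thesis
      by (simp add: inner_commute)
  qed
  then have "x' \<in> (Omega :: ('h ^ 'n) set)\<^sup>\<bottom>\<^sup>\<bottom>"
    by (simp add: orthogonal_comp_iff)
  then show ?thesis
    by (simp add: Omega_comp_comp)
qed

text \<open>In Case II the form of \<open>V\<close> may be indefinite, yet it is weakly lower semicontinuous along \<open>a\<close>: its block on \<open>\<Omega>\<^sup>\<bottom>\<close> is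
  nonnegative, and every other term contains a diagonal component, which converges strongly. The minorant \<open>g\<close>
  drops the nonnegative part.\<close>

lemma V_form_lsc:
  assumes G: "G \<noteq> bot" and bd: "bounded (range a)"
    and weak: "\<And>y. ((\<lambda>k. a k \<bullet> y) \<longlongrightarrow> a' \<bullet> y) G"
    and Pr: "caseII B V \<Longrightarrow> ((\<lambda>k. Pr (a k)) \<longlongrightarrow> Pr a') G"
  shows "\<exists>g. (g \<longlongrightarrow> (a' - v) \<bullet> diag_op V (a' - v)) G
           \<and> (\<forall>k. (a k - v) \<bullet> diag_op V (a k - v) \<ge> g k)"
  using V_cases
proof
  assume "caseI V \<and> \<Theta> = Theta_I P R (diag_op W)"
  then have "diag_op V = 0" by (simp add: caseI_def)
  then show ?thesis
    by (intro exI[of _ "\<lambda>_. 0"]) simp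
next
  assume II: "caseII B V \<and> \<Theta> = Theta_II L (diag_op V)"
  let ?V = "diag_op V"
  define d where "d k = a k - a'" for k
  define p where "p k = Pr (d k)" for k
  have p0: "(p \<longlongrightarrow> 0) G"
  proof -
    have "((\<lambda>k. Pr (a k) - Pr a') \<longlongrightarrow> Pr a' - Pr a') G"
      using II by (intro tendsto_intros Pr) simp
    then show ?thesis
      by (simp add: p_def[abs_def] d_def blinfun.diff_right)
  qed
  have bdd: "bounded (range d)"
    using bounded_range_add[OF bd, of "\<lambda>_. - a'"] by (simp add: d_def[abs_def])
  have dweak: "((\<lambda>k. d k \<bullet> y) \<longlongrightarrow> 0 \<bullet> y) G" for y
    using tendsto_diff[OF weak[of y] tendsto_const[of "a' \<bullet> y"]]
    by (simp add: d_def[abs_def] inner_diff_left)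
  define g where "g k = (a' - v) \<bullet> ?V (a' - v) + 2 * (d k \<bullet> ?V (a' - v))
      + (2 * (d k \<bullet> ?V (p k)) - p k \<bullet> ?V (p k))" for k
  have "(g \<longlongrightarrow> (a' - v) \<bullet> ?V (a' - v) + 2 * (0 \<bullet> ?V (a' - v))
      + (2 * (0 \<bullet> ?V 0) - 0 \<bullet> ?V 0)) G"
    unfolding g_def by (intro tendsto_intros dweak tendsto_inner_weak_strong[OF bdd dweak] p0)
  then have "(g \<longlongrightarrow> (a' - v) \<bullet> ?V (a' - v)) G"
    by simp
  moreover have "g k \<le> (a k - v) \<bullet> ?V (a k - v)" for k
  proof -
    define q where "q = Q (d k)"
    have dk: "d k = p k + q"
      by (simp add: p_def q_def orth_proj_Omega_orth)
    have sym: "q \<bullet> ?V (p k) = p k \<bullet> ?V q"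
      using self_adjointD[OF diag_V_sa, of q "p k"] by (simp add: inner_commute)
    have sym': "(a' - v) \<bullet> ?V (d k) = d k \<bullet> ?V (a' - v)"
      using self_adjointD[OF diag_V_sa, of "a' - v" "d k"] by (simp add: inner_commute)
    have "q \<bullet> ?V q \<ge> 0"
    proof -
      have "0 \<le> blk22 ?V q \<bullet> q"
        using II Q_mem unfolding q_def caseII_def psd_on_def by blast
      also have "\<dots> = q \<bullet> ?V q"
        using self_adjointD[OF self_adjoint_orth_proj_Omega(2), of "?V q" q]
        by (simp add: blk22_def q_def Q_id[OF Q_mem] inner_commute)
      finally show ?thesis .
    qed
    moreover have "a k - v = (a' - v) + d k"
      by (simp add: d_def)
    then have "(a k - v) \<bullet> ?V (a k - v) = (a' - v) \<bullet> ?V (a' - v) + 2 * (d k \<bullet> ?V (a' - v)) + d k \<bullet> ?V (d k)"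
      by (simp only: blinfun.add_right inner_add_left inner_add_right sym')
    moreover have "d k \<bullet> ?V (d k) = 2 * (d k \<bullet> ?V (p k)) - p k \<bullet> ?V (p k) + q \<bullet> ?V q"
      unfolding dk by (simp add: blinfun.add_right inner_add_left inner_add_right sym)
    ultimately show ?thesis
      unfolding g_def by linarith
  qed
  ultimately show ?thesis by blast
qed

text \<open>Cocoercivity implies Lipschitz continuity.\<close>

lemma bounded_diag_fun_B:
  assumes "bounded (range r)"
  shows "bounded (range (\<lambda>k. diag_fun B (r k)))"
proof -
  obtain c where c: "c > 0"
    "\<And>r s. (r - s) \<bullet> (diag_fun B r - diag_fun B s) \<ge> c * (norm (diag_fun B r - diag_fun B s))\<^sup>2"
    by (rule B_uniformly_cocoercive) blast
  obtain C where C: "\<And>k. norm (r k) \<le> C"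
    using assms by (auto simp: bounded_iff)
  have "norm (diag_fun B (r k)) \<le> C / c + norm (diag_fun B 0)" for k
  proof -
    let ?e = "diag_fun B (r k) - diag_fun B 0"
    have "c * (norm ?e)\<^sup>2 \<le> norm (r k) * norm ?e"
      using c(2)[of "r k" 0] norm_cauchy_schwarz[of "r k" ?e] by simp
    then have "c * norm ?e \<le> norm (r k)"
      by (cases "?e = 0") (auto simp: power2_eq_square)
    then have "c * norm ?e \<le> C"
      using C[of k] by linarith
    then have "norm ?e \<le> C / c"
      using c(1) by (simp add: field_simps)
    then show ?thesis
      using norm_triangle_ineq[of ?e "diag_fun B 0"] by simp
  qed
  then show ?thesis
    by (auto simp: bounded_iff)
qed

text \<open>Demiclosedness. Let \<open>a k\<close> and \<open>b k\<close> be the outputs of \<open>A\<close> and \<open>B\<close> that realise \<open>x k \<in> \<Phi> (w k)\<close>, with weak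
  limits \<open>a'\<close> and \<open>b'\<close>. Their joint pairing with the inputs converges to the pairing of the weak limits (both
  are zero), because it involves the \<open>x k\<close> only through their orthogonal parts. The semimonotonicity inequalities
  therefore survive the limit, first giving \<open>a' \<in> A x'\<close> by maximality. Taking this very point for
  comparison afterwards gives \<open>b k \<rightarrow> B (R x')\<close> strongly.\<close>

lemma Phi_weakly_closed:
  fixes x w :: "nat \<Rightarrow> 'h ^ 'n"
  assumes G: "G \<noteq> bot" and U0: "\<And>i. U i = 0"
    and bdx: "bounded (range x)" and bdw: "bounded (range w)"
    and mem: "\<And>k. x k \<in> \<Phi> (w k)" "\<And>k. w k \<in> Omega\<^sup>\<bottom>" and w': "w' \<in> Omega\<^sup>\<bottom>"
    and xweak: "\<And>y. ((\<lambda>k. x k \<bullet> y) \<longlongrightarrow> x' \<bullet> y) G"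
    and wweak: "\<And>y. ((\<lambda>k. w k \<bullet> y) \<longlongrightarrow> w' \<bullet> y) G"
    and Qx: "((\<lambda>k. Q (x k)) \<longlongrightarrow> 0) G"
  shows "x' \<in> \<Phi> w'"
proof -
  define b where "b k = diag_fun B (R (x k))" for k
  have "\<exists>a. \<forall>k. a k \<in> diag_set A (x k) \<and> w k = \<gamma> *\<^sub>R a k + \<gamma> *\<^sub>R P (b k) + L (x k)"
    using mem(1) unfolding Phi_iff b_def by metis
  then obtain a where a: "\<And>k. a k \<in> diag_set A (x k)"
    "\<And>k. w k = \<gamma> *\<^sub>R a k + \<gamma> *\<^sub>R P (b k) + L (x k)"
    by blast
  have a_eq: "a k = (1 / \<gamma>) *\<^sub>R (w k + - 1 *\<^sub>R L (x k)) + - 1 *\<^sub>R P (b k)" for k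
    using \<gamma>_pos by (simp add: a(2) scaleR_add_right)
  obtain \<xi> where \<xi>: "x' = vec \<xi>"
    using weak_limit_in_Omega[OF G xweak Qx] by (rule OmegaE)
  have bdb: "bounded (range b)"
    unfolding b_def by (intro bounded_diag_fun_B bounded_range_blinfun bdx)
  have bda: "bounded (range a)"
    unfolding a_eq by (intro bounded_range_add bounded_range_scaleR bounded_range_blinfun bdx bdw bdb)
  obtain H b' where H: "H \<noteq> bot" "H \<le> G" "\<And>y. ((\<lambda>k. b k \<bullet> y) \<longlongrightarrow> b' \<bullet> y) H"
    by (rule bounded_weak_cluster_point[OF G bdb]) blast
  have xH: "((\<lambda>k. x k \<bullet> y) \<longlongrightarrow> x' \<bullet> y) H" and wH: "((\<lambda>k. w k \<bullet> y) \<longlongrightarrow> w' \<bullet> y) H" for y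
    by (rule tendsto_mono[OF H(2) xweak], rule tendsto_mono[OF H(2) wweak])
  have QH: "((\<lambda>k. Q (x k)) \<longlongrightarrow> 0) H"
    by (rule tendsto_mono[OF H(2) Qx])
  define a' where "a' = (1 / \<gamma>) *\<^sub>R (w' + - 1 *\<^sub>R L x') + - 1 *\<^sub>R P b'"
  have aH: "((\<lambda>k. a k \<bullet> y) \<longlongrightarrow> a' \<bullet> y) H" for y
    unfolding a_eq a'_def inner_add_left inner_scaleR_left
    by (intro tendsto_intros tendsto_inner_blinfun xH wH H(3))
  have RH: "((\<lambda>k. R (x k) \<bullet> y) \<longlongrightarrow> R x' \<bullet> y) H" for y
    by (intro tendsto_inner_blinfun xH)
  \<comment> \<open>the diagonal part of \<open>x k\<close> contributes nothing: \<open>w k\<close> is orthogonal to it, the form of \<open>L\<close> vanishes on it,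
    and \<open>R\<close> and \<open>P\<^sup>*\<close> agree on it\<close>
  have pairing: "((\<lambda>k. x k \<bullet> a k + R (x k) \<bullet> b k) \<longlongrightarrow> 0) H"
  proof -
    have eq: "x k \<bullet> a k + R (x k) \<bullet> b k
        = (1 / \<gamma>) * (w k \<bullet> Q (x k) - Q (x k) \<bullet> sym_part L (Q (x k))) + b k \<bullet> (R (Q (x k)) - adjoint_op P (Q (x k)))" for k
    proof -
      have "x k \<bullet> w k = w k \<bullet> Q (x k)"
        using self_adjointD[OF self_adjoint_orth_proj_Omega(2), of "w k" "x k"]
        by (simp add: Q_id[OF mem(2)] inner_commute)
      moreover have "R (x k) - adjoint_op P (x k) = R (Q (x k)) - adjoint_op P (Q (x k))"
      proof -
        obtain u where "Pr (x k) = vec u"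
          using orth_proj_Omega(1) by (rule OmegaE)
        then have "R (Pr (x k)) - adjoint_op P (Pr (x k)) = 0"
          by (simp add: R_vec P_vec)
        then show ?thesis
          by (simp add: orth_proj_Omega_orth blinfun.diff_right algebra_simps)
      qed
      then have "R (x k) \<bullet> b k - x k \<bullet> P (b k) = b k \<bullet> (R (Q (x k)) - adjoint_op P (Q (x k)))"
        by (metis adjoint_op_inner inner_commute inner_diff_left)
      ultimately show ?thesis
        unfolding a_eq by (simp add: inner_add_right inner_diff_right L_form_orth)
    qed
    have "((\<lambda>k. (1 / \<gamma>) * (w k \<bullet> Q (x k) - Q (x k) \<bullet> sym_part L (Q (x k))) + b k \<bullet> (R (Q (x k)) - adjoint_op P (Q (x k))))
        \<longlongrightarrow> (1 / \<gamma>) * (w' \<bullet> 0 - 0 \<bullet> sym_part L 0) + b' \<bullet> (R 0 - adjoint_op P 0)) H"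
      by (intro tendsto_intros tendsto_inner_weak_strong[OF bdw wH] tendsto_inner_weak_strong[OF bdb H(3)] QH)
    then show ?thesis
      unfolding eq by simp
  qed
  have pairing': "x' \<bullet> a' + R x' \<bullet> b' = 0"
  proof -
    have "x' \<bullet> w' = 0"
      using w' unfolding \<xi> by (simp add: orthogonal_comp_iff)
    moreover have "x' \<bullet> L x' = 0"
      using L_vec[of \<xi>] unfolding \<xi> by (simp add: orthogonal_comp_iff)
    moreover have "x' \<bullet> P b' = R x' \<bullet> b'"
      using adjoint_op_inner[of P x' b'] unfolding \<xi> by (simp add: P_vec R_vec)
    ultimately show ?thesis
      by (simp add: a'_def inner_add_right inner_diff_right)
  qed
  \<comment> \<open>the comparison point for \<open>B\<close> is the limit \<open>R x'\<close> itself, so that \<open>B\<close> contributes nothing in the limit\<close>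
  have gap_lim: "((\<lambda>k. (x k - y) \<bullet> (a k - v) + (R (x k) - R x') \<bullet> (b k - diag_fun B (R x')))
      \<longlongrightarrow> (x' - y) \<bullet> (a' - v)) H" for y v
  proof -
    let ?s = "R x'" and ?t = "diag_fun B (R x')"
    have eq: "(x k - y) \<bullet> (a k - v) + (R (x k) - ?s) \<bullet> (b k - ?t)
        = (x k \<bullet> a k + R (x k) \<bullet> b k) - x k \<bullet> v - a k \<bullet> y + y \<bullet> v - R (x k) \<bullet> ?t - b k \<bullet> ?s + ?s \<bullet> ?t" for k
      by (simp add: inner_diff_left inner_diff_right inner_commute)
    have "((\<lambda>k. (x k \<bullet> a k + R (x k) \<bullet> b k) - x k \<bullet> v - a k \<bullet> y + y \<bullet> v - R (x k) \<bullet> ?t - b k \<bullet> ?s + ?s \<bullet> ?t)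
        \<longlongrightarrow> 0 - x' \<bullet> v - a' \<bullet> y + y \<bullet> v - ?s \<bullet> ?t - b' \<bullet> ?s + ?s \<bullet> ?t) H"
      by (intro tendsto_intros pairing xH aH RH H(3))
    moreover have "0 - x' \<bullet> v - a' \<bullet> y + y \<bullet> v - ?s \<bullet> ?t - b' \<bullet> ?s + ?s \<bullet> ?t = (x' - y) \<bullet> (a' - v)"
      using pairing' by (simp add: inner_diff_left inner_diff_right inner_commute)
    ultimately show ?thesis
      unfolding eq by simp
  qed
  have PrH: "((\<lambda>k. Pr (a k)) \<longlongrightarrow> Pr a') H" if II: "caseII B V"
  proof -
    have b0: "b k = 0" for k
      using II by (simp add: b_def caseII_def)
    then have "((\<lambda>k. 0) \<longlongrightarrow> b' \<bullet> b') H"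
      using H(3)[of b'] by simp
    then have "b' \<bullet> b' = 0"
      using tendsto_unique[OF H(1) _ tendsto_const] by blast
    then have "b' = 0" by simp
    have PrL: "Pr (L y) = Pr (L (Q y))" for y
    proof -
      obtain u where "Pr y = vec u"
        using orth_proj_Omega(1) by (rule OmegaE)
      then have "Pr (L (Pr y)) = 0"
        by (simp add: orth_proj_Omega_0[OF L_vec])
      then show ?thesis
        by (simp add: orth_proj_Omega_orth blinfun.diff_right)
    qed
    have "Pr (a k) = (1 / \<gamma>) *\<^sub>R (- Pr (L (Q (x k))))" for k
      unfolding a_eq using orth_proj_Omega_0[OF mem(2), of k]
      by (simp add: b0 blinfun.bilinear_simps PrL[symmetric])
    moreover have "Pr a' = (1 / \<gamma>) *\<^sub>R (- Pr (L 0))"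
      unfolding a'_def using orth_proj_Omega_0[OF w'] orth_proj_Omega_0[OF L_vec, of \<xi>]
      by (simp add: \<open>b' = 0\<close> \<xi> blinfun.bilinear_simps)
    moreover have "((\<lambda>k. (1 / \<gamma>) *\<^sub>R (- Pr (L (Q (x k))))) \<longlongrightarrow> (1 / \<gamma>) *\<^sub>R (- Pr (L 0))) H"
      by (intro tendsto_intros QH)
    ultimately show ?thesis by simp
  qed
  obtain c where c: "c > 0"
    "\<And>r s. (r - s) \<bullet> (diag_fun B r - diag_fun B s) \<ge> c * (norm (diag_fun B r - diag_fun B s))\<^sup>2"
    by (rule B_uniformly_cocoercive) blast
  have U0': "diag_op U = 0"
    by (intro blinfun_eqI) (simp add: vec_eq_iff diag_op_nth U0)
  have gap: "(x k - y) \<bullet> (a k - v) \<ge> (a k - v) \<bullet> diag_op V (a k - v)" if "v \<in> diag_set A y" for y v k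
    using diag_set_semimonotone[OF A_semimonotone a(1) that, of k] by (simp add: U0')
  have gapB: "(R (x k) - R x') \<bullet> (b k - diag_fun B (R x')) \<ge> c * (norm (b k - diag_fun B (R x')))\<^sup>2" for k
    unfolding b_def by (rule c(2))
  have a'_mem: "a' \<in> diag_set A x'"
  proof (rule diag_set_maximal[OF A_max])
    fix y v assume v: "v \<in> diag_set A y"
    obtain g where g: "(g \<longlongrightarrow> (a' - v) \<bullet> diag_op V (a' - v)) H"
      "\<And>k. g k \<le> (a k - v) \<bullet> diag_op V (a k - v)"
      using V_form_lsc[OF H(1) bda aH PrH, of v] by blast
    have "g k \<le> (x k - y) \<bullet> (a k - v) + (R (x k) - R x') \<bullet> (b k - diag_fun B (R x'))" for k
    proof -
      have "0 \<le> c * (norm (b k - diag_fun B (R x')))\<^sup>2"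
        using c(1) by simp
      then show ?thesis
        using g(2)[of k] gap[OF v, of k] gapB[of k] by linarith
    qed
    then have "(a' - v) \<bullet> diag_op V (a' - v) \<le> (x' - y) \<bullet> (a' - v)"
      by (intro tendsto_le[OF H(1) gap_lim g(1)]) simp
    then show "(x' - y) \<bullet> (a' - v) \<ge> (x' - y) \<bullet> diag_op U (x' - y) + (a' - v) \<bullet> diag_op V (a' - v)"
      by (simp add: U0')
  qed
  have "b' = diag_fun B (R x')"
  proof -
    obtain g where g: "(g \<longlongrightarrow> (a' - a') \<bullet> diag_op V (a' - a')) H"
      "\<And>k. g k \<le> (a k - a') \<bullet> diag_op V (a k - a')"
      using V_form_lsc[OF H(1) bda aH PrH, of a'] by blast
    let ?gap = "\<lambda>k. (x k - x') \<bullet> (a k - a') + (R (x k) - R x') \<bullet> (b k - diag_fun B (R x'))"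
    have "((\<lambda>k. ?gap k - g k) \<longlongrightarrow> (x' - x') \<bullet> (a' - a') - (a' - a') \<bullet> diag_op V (a' - a')) H"
      by (intro tendsto_diff gap_lim g(1))
    then have lim: "((\<lambda>k. ?gap k - g k) \<longlongrightarrow> 0) H"
      by simp
    have le: "c * (norm (b k - diag_fun B (R x')))\<^sup>2 \<le> ?gap k - g k" for k
      using g(2)[of k] gap[OF a'_mem, of k] gapB[of k] by linarith
    have b0: "((\<lambda>k. b k - diag_fun B (R x')) \<longlongrightarrow> 0) H"
      by (rule tendsto_zero_of_norm_sq[OF c(1) le lim])
    have "b' \<bullet> y = diag_fun B (R x') \<bullet> y" for y
    proof -
      have "((\<lambda>k. (b k - diag_fun B (R x')) \<bullet> y + diag_fun B (R x') \<bullet> y) \<longlongrightarrow> 0 \<bullet> y + diag_fun B (R x') \<bullet> y) H"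
        by (intro tendsto_intros b0)
      then have "((\<lambda>k. b k \<bullet> y) \<longlongrightarrow> diag_fun B (R x') \<bullet> y) H"
        by (simp add: inner_diff_left)
      then show ?thesis
        using tendsto_unique[OF H(1) H(3)] by blast
    qed
    then show ?thesis
      using vector_eq_rdot by blast
  qed
  moreover have "w' = \<gamma> *\<^sub>R a' + \<gamma> *\<^sub>R P b' + L x'"
    using \<gamma>_pos by (simp add: a'_def scaleR_add_right scaleR_diff_right)
  ultimately show ?thesis
    using a'_mem by (auto simp: Phi_iff)
qed

section \<open>Convergence of the iteration\<close>

definition \<phi> :: "'h ^ 'n \<Rightarrow> 'h ^ 'n" where "\<phi> w = (THE x. x \<in> \<Phi> w)"

lemma Phi_eq: "w \<in> Omega\<^sup>\<bottom> \<Longrightarrow> \<Phi> w = {\<phi> w}"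
  using Phi_singleton[of w] by (auto simp: \<phi>_def)

text \<open>Brings the extended-real hypotheses on the relaxation parameters into the form in which
  \<open>cocoercive_iteration_weakly_converges\<close> expects them, for finite \<open>\<beta>\<^sub>\<gamma> = 1 / N\<^sup>2\<close>.\<close>

lemma relaxation_parameters_real:
  assumes N: "N > 0" and lam: "\<And>k. 0 \<le> lam k" "\<And>k. ereal (lam k) \<le> 2 * (1 / ereal (N\<^sup>2))"
    and div: "(\<Sum>k. ereal (lam k) * (2 * (1 / ereal (N\<^sup>2)) - ereal (lam k))) = \<infinity>"
  shows "lam k \<le> 2 * (1 / N\<^sup>2)" and "\<not> summable (\<lambda>k. lam k * (2 * (1 / N\<^sup>2) - lam k))"
proof -
  have e: "2 * (1 / ereal (N\<^sup>2)) = ereal (2 * (1 / N\<^sup>2))"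
    using N by (simp add: one_ereal_def divide_ereal_def flip: numeral_eq_ereal) (simp add: inverse_eq_divide)
  show le: "lam k \<le> 2 * (1 / N\<^sup>2)" for k
    using lam(2)[of k] unfolding e by simp
  show "\<not> summable (\<lambda>k. lam k * (2 * (1 / N\<^sup>2) - lam k))"
  proof
    assume "summable (\<lambda>k. lam k * (2 * (1 / N\<^sup>2) - lam k))"
    then have "(\<lambda>k. ereal (lam k * (2 * (1 / N\<^sup>2) - lam k))) sums ereal (\<Sum>k. lam k * (2 * (1 / N\<^sup>2) - lam k))"
      by (simp add: sums_ereal summable_sums)
    then have "(\<Sum>k. ereal (lam k * (2 * (1 / N\<^sup>2) - lam k))) = ereal (\<Sum>k. lam k * (2 * (1 / N\<^sup>2) - lam k))"
      by (rule sums_unique[symmetric])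
    with div show False
      unfolding e by simp
  qed
qed

lemma iteration_converges:
  assumes lam: "\<And>k. 0 \<le> lam k" "\<And>k. ereal (lam k) \<le> 2 * beta \<Xi> M"
      "(\<Sum>k. ereal (lam k) * (2 * beta \<Xi> M - ereal (lam k))) = \<infinity>"
    and x: "\<And>k. x k \<in> \<Phi> (M (z k))"
    and z: "\<And>k. z (Suc k) = z k - lam k *\<^sub>R adjoint_op M (x k)"
  shows "bounded (range z)" "(\<lambda>k. adjoint_op M (x k)) \<longlonglongrightarrow> 0"
    "\<exists>l. adjoint_op M (\<phi> (M l)) = 0 \<and> weakly_converges z l"
proof -
  define T where "T z = adjoint_op M (\<phi> (M z))" for z
  define N where "N = norm (pseudo_inverse (sqrt_op \<Xi>) o\<^sub>L M)"
  have \<phi>: "\<phi> (M z) \<in> \<Phi> (M z)" for z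
    by (simp add: Phi_eq M_mem)
  have xk: "x k = \<phi> (M (z k))" for k
    using x[of k] by (simp add: Phi_eq M_mem)
  have coco: "(norm (T u - T v))\<^sup>2 \<le> N\<^sup>2 * ((u - v) \<bullet> (T u - T v))" for u v
    unfolding T_def N_def by (rule Psi_cocoercive[OF \<phi> \<phi>])
  obtain p u where "vec u \<in> \<Phi> (M p)"
    by (rule zero_exists)
  then have "\<phi> (M p) = vec u"
    by (simp add: Phi_eq M_mem)
  then have p: "T p = 0"
    by (simp add: T_def adjoint_M_0_iff)
  have step: "z (Suc k) = z k - lam k *\<^sub>R T (z k)" for k
    by (simp add: z T_def xk)
  have "bounded (range z) \<and> (\<lambda>k. T (z k)) \<longlonglongrightarrow> 0 \<and> (\<exists>l. T l = 0 \<and> weakly_converges z l)"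
  \<comment> \<open>for \<open>N = 0\<close>, that is \<open>\<beta>\<^sub>\<gamma> = \<infinity>\<close>, the map \<open>T\<close> vanishes identically and \<open>z\<close> is constant\<close>
  proof (cases "N = 0")
    case True
    then have T0: "T v = 0" for v
      using coco[of v p] p by simp
    then have zc: "z k = z 0" for k
      by (induction k) (simp_all add: step)
    have zr: "range z = {z 0}"
      using zc by (metis UNIV_not_empty image_constant_conv image_cong)
    have "weakly_converges z (z 0)"
      unfolding weakly_converges_def by (subst zc) simp
    then show ?thesis
      using zr by (auto simp: T0)
  next
    case False
    then have N: "N > 0" by (simp add: N_def)
    have lam': "\<And>k. lam k \<le> 2 * (1 / N\<^sup>2)" "\<not> summable (\<lambda>k. lam k * (2 * (1 / N\<^sup>2) - lam k))"
      using relaxation_parameters_real[OF N, of lam, OF lam(1) lam(2,3)[unfolded beta_def, folded N_def]] by blast+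
    have \<beta>: "1 / N\<^sup>2 > 0" using N by simp
    have coco': "(1 / N\<^sup>2) * (norm (T u - T v))\<^sup>2 \<le> (u - v) \<bullet> (T u - T v)" for u v
      using coco[of u v] N by (simp add: field_simps)
    show ?thesis
      using cocoercive_iteration_weakly_converges[where T = T and z = z, OF \<beta> coco' step lam(1) lam' p] by blast
  qed
  then show "bounded (range z)" "(\<lambda>k. adjoint_op M (x k)) \<longlonglongrightarrow> 0"
    "\<exists>l. adjoint_op M (\<phi> (M l)) = 0 \<and> weakly_converges z l"
    by (simp_all add: T_def xk)
qed

text \<open>Since \<open>M\<^sup>* (u, \<dots>, u) = 0\<close>, the pairing with \<open>M z\<^sup>k - M l\<close> equals \<open>\<langle>M\<^sup>* x\<^sup>k, z\<^sup>k - l\<rangle>\<close>, a null sequence times a bounded one;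
  it dominates the orthogonal part of \<open>x\<^sup>k\<close> through \<open>\<Xi>\<close>.\<close>

lemma orthogonal_part_converges:
  assumes x: "\<And>k. x k \<in> \<Phi> (M (z k))" and bd: "bounded (range z)"
    and M0: "(\<lambda>k. adjoint_op M (x k)) \<longlonglongrightarrow> 0" and l: "vec u \<in> \<Phi> (M l)"
  shows "(\<lambda>k. (x k - vec u) \<bullet> (M (z k) - M l)) \<longlonglongrightarrow> 0" and "(\<lambda>k. Q (x k)) \<longlonglongrightarrow> 0"
proof -
  have eq: "(x k - vec u) \<bullet> (M (z k) - M l) = adjoint_op M (x k) \<bullet> (z k - l)" for k
  proof -
    have "adjoint_op M (vec u) = 0" by (simp add: adjoint_M_0_iff)
    then show ?thesis
      using adjoint_op_inner[of M "x k - vec u" "z k - l"] by (simp add: blinfun.diff_right)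
  qed
  show 1: "(\<lambda>k. (x k - vec u) \<bullet> (M (z k) - M l)) \<longlonglongrightarrow> 0"
  proof -
    obtain C where C: "\<And>k. norm (z k) \<le> C"
      using bd by (auto simp: bounded_iff)
    have "\<bar>adjoint_op M (x k) \<bullet> (z k - l)\<bar> \<le> norm (adjoint_op M (x k)) * (C + norm l)" for k
      using C[of k] norm_triangle_ineq4[of "z k" l]
      by (intro order_trans[OF Cauchy_Schwarz_ineq2] mult_left_mono) auto
    then have "\<forall>\<^sub>F k in sequentially. norm (adjoint_op M (x k) \<bullet> (z k - l)) \<le> norm (adjoint_op M (x k)) * (C + norm l)"
      by simp
    moreover have "(\<lambda>k. norm (adjoint_op M (x k)) * (C + norm l)) \<longlonglongrightarrow> 0"
      using tendsto_mult[OF tendsto_norm[OF M0] tendsto_const[of "C + norm l"]] by simp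
    ultimately show ?thesis
      unfolding eq by (rule Lim_null_comparison)
  qed
  obtain \<kappa> where \<kappa>: "\<kappa> > 0" "\<And>x. x \<bullet> \<Xi> x \<ge> \<kappa> * (norm (Q x))\<^sup>2"
    by (rule \<Xi>_mono) blast
  have "\<kappa> * (norm (Q (x k)))\<^sup>2 \<le> (x k - vec u) \<bullet> (M (z k) - M l)" for k
  proof -
    have "Q (x k - vec u) = Q (x k)"
      by (simp add: blinfun.diff_right orth_proj_Omega_orth orth_proj_Omega_id)
    then show ?thesis
      using \<kappa>(2)[of "x k - vec u"] resolvent_estimate_\<Xi>(2)[OF x M_mem l M_mem, of k] by simp
  qed
  then show "(\<lambda>k. Q (x k)) \<longlonglongrightarrow> 0"
    by (rule tendsto_zero_of_norm_sq[OF \<kappa>(1) _ 1])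
qed

text \<open>The square kept in \<open>inner_schur11_le\<close> tends to zero together with the orthogonal part, and hence so
  does the diagonal part.\<close>

lemma strong_convergence:
  assumes mono: "strongly_monotone_on Omega (diag_op U)"
    and x: "\<And>k. x k \<in> \<Phi> (M (z k))" and bd: "bounded (range z)"
    and M0: "(\<lambda>k. adjoint_op M (x k)) \<longlonglongrightarrow> 0" and l: "vec u \<in> \<Phi> (M l)"
  shows "x \<longlonglongrightarrow> vec u"
proof -
  have "strongly_monotone_on Omega (blk11 (diag_op U))"
  proof -
    have "blk11 (diag_op U) y \<bullet> y = diag_op U y \<bullet> y" if "y \<in> Omega" for y
      using self_adjointD[OF self_adjoint_orth_proj_Omega(1), of "diag_op U y" y] that
      by (simp add: blk11_def orth_proj_Omega_id)
    with mono show ?thesis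
      by (simp add: strongly_monotone_on_def)
  qed
  then obtain \<alpha> K where K: "\<alpha> > 0" "\<And>x. x \<bullet> diag_op U x \<ge> x \<bullet> schur11 (diag_op U) x
      + \<alpha> * (norm (Pr x + blinfun_apply K (Q x)))\<^sup>2"
    by (rule inner_schur11_le[OF diag_U_sa]) blast
  note lim = orthogonal_part_converges[OF x bd M0 l]
  define d where "d k = x k - vec u" for k
  have Qd: "Q (d k) = Q (x k)" for k
    by (simp add: d_def blinfun.diff_right orth_proj_Omega_orth orth_proj_Omega_id)
  have "(\<gamma> * \<alpha>) * (norm (Pr (d k) + K (Q (d k))))\<^sup>2 \<le> (x k - vec u) \<bullet> (M (z k) - M l)" for k
  proof -
    have "\<gamma> * (\<alpha> * (norm (Pr (d k) + K (Q (d k))))\<^sup>2)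
        \<le> \<gamma> * (d k \<bullet> diag_op U (d k) - d k \<bullet> schur11 (diag_op U) (d k))"
      using K(2)[of "d k"] \<gamma>_pos by (intro mult_left_mono) auto
    moreover have "0 \<le> d k \<bullet> \<Xi> (d k)"
      using \<Xi>_psd by (simp add: psd_on_def inner_commute)
    ultimately show ?thesis
      using resolvent_estimate_\<Xi>(1)[OF x M_mem l M_mem, of k] unfolding d_def by (simp add: mult.assoc)
  qed
  then have 1: "(\<lambda>k. Pr (d k) + K (Q (d k))) \<longlonglongrightarrow> 0"
    by (intro tendsto_zero_of_norm_sq[of "\<gamma> * \<alpha>", OF _ _ lim(1)]) (simp_all add: \<gamma>_pos K(1))
  have 2: "(\<lambda>k. Q (d k)) \<longlonglongrightarrow> 0"
    unfolding Qd by (rule lim(2))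
  have "(\<lambda>k. (Pr (d k) + K (Q (d k))) - K (Q (d k)) + Q (d k) + vec u) \<longlonglongrightarrow> 0 - K 0 + 0 + vec u"
    by (intro tendsto_intros 1 2)
  moreover have "(Pr (d k) + K (Q (d k))) - K (Q (d k)) + Q (d k) + vec u = x k" for k
    by (simp add: orth_proj_Omega_orth d_def)
  ultimately show ?thesis by simp
qed

lemma weak_convergence:
  assumes U0: "\<And>i. U i = 0" and bdx: "bounded (range x)"
    and x: "\<And>k. x k \<in> \<Phi> (M (z k))" and bd: "bounded (range z)"
    and M0: "(\<lambda>k. adjoint_op M (x k)) \<longlonglongrightarrow> 0" and l: "vec u \<in> \<Phi> (M l)"
    and zl: "weakly_converges z l"
  shows "weakly_converges x (vec u)"
proof (rule weakly_converges_of_unique_cluster_point[OF bdx])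
  fix G x' assume G: "G \<noteq> bot" "G \<le> sequentially" "\<And>y. ((\<lambda>k. x k \<bullet> y) \<longlongrightarrow> x' \<bullet> y) G"
  have "x' \<in> \<Phi> (M l)"
  proof (rule Phi_weakly_closed[OF G(1) U0 bdx bounded_range_blinfun[OF bd] x M_mem M_mem G(3)])
    show "((\<lambda>k. M (z k) \<bullet> y) \<longlongrightarrow> M l \<bullet> y) G" for y
      using zl unfolding weakly_converges_def
      by (intro tendsto_inner_blinfun tendsto_mono[OF G(2)]) blast
    show "((\<lambda>k. Q (x k)) \<longlongrightarrow> 0) G"
      by (rule tendsto_mono[OF G(2) orthogonal_part_converges(2)[OF x bd M0 l]])
  qed
  with l show "x' = vec u"
    by (simp add: Phi_eq[OF M_mem])
qed

text \<open>The diagonal part of \<open>x k\<close> can be read off from any single component once the orthogonal part is known.\<close>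

lemma bounded_of_component:
  assumes comp: "bounded (range (\<lambda>k. x k $ i))" and Qx: "bounded (range (\<lambda>k. Q (x k)))"
  shows "bounded (range x)"
proof -
  obtain C D where C: "\<And>k. norm (x k $ i) \<le> C" and D: "\<And>k. norm (Q (x k)) \<le> D"
    using comp Qx by (auto simp: bounded_iff)
  have "norm (x k) \<le> (\<Sum>j\<in>(UNIV :: 'n set). C + D) + D" for k
  proof -
    obtain u where u: "Pr (x k) = vec u"
      using orth_proj_Omega(1) by (rule OmegaE)
    have xk: "x k = vec u + Q (x k)"
      by (simp add: orth_proj_Omega_orth u)
    then have "u = x k $ i - Q (x k) $ i"
      by (metis add_diff_cancel_right' vec_component vector_add_component)
    then have "norm u \<le> norm (x k $ i) + norm (Q (x k) $ i)"
      using norm_triangle_ineq4 by blast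
    also have "\<dots> \<le> C + D"
      using C[of k] D[of k] Finite_Cartesian_Product.norm_nth_le[of "Q (x k)" i] by linarith
    finally have "norm u \<le> C + D" .
    then have "norm (vec u :: 'h ^ 'n) \<le> (\<Sum>j\<in>(UNIV :: 'n set). C + D)"
      unfolding norm_vec_def
      by (intro order_trans[OF L2_set_le_sum] sum_mono) auto
    then show ?thesis
      using norm_triangle_ineq[of "vec u" "Q (x k)"] D[of k] xk by simp
  qed
  then show ?thesis
    by (auto simp: bounded_iff)
qed

end

section \<open>Convergence of the preconditioned splitting method\<close>

theorem theorem4p3:
  fixes A :: "'n::finite \<Rightarrow> 'h::{real_inner,banach} \<Rightarrow> 'h set"
    and B :: "'p::finite \<Rightarrow> 'h \<Rightarrow> 'h"
    and U V :: "'n \<Rightarrow> ('h \<Rightarrow>\<^sub>L 'h)"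
    and W :: "'p \<Rightarrow> ('h \<Rightarrow>\<^sub>L 'h)"
    and P :: "'n \<Rightarrow> 'p \<Rightarrow> ('h \<Rightarrow>\<^sub>L 'h)"
    and R :: "'p \<Rightarrow> 'n \<Rightarrow> ('h \<Rightarrow>\<^sub>L 'h)"
    and M :: "'n \<Rightarrow> 'm::finite \<Rightarrow> ('h \<Rightarrow>\<^sub>L 'h)"
    and L :: "'n \<Rightarrow> 'n \<Rightarrow> ('h \<Rightarrow>\<^sub>L 'h)"
    and \<Theta> :: "real \<Rightarrow> (('h ^ 'n) \<Rightarrow>\<^sub>L ('h ^ 'n))"
    and \<gamma> :: real
    and lam :: "nat \<Rightarrow> real"
    and x :: "nat \<Rightarrow> 'h ^ 'n"
    and z :: "nat \<Rightarrow> 'h ^ 'm"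
    and first :: 'n
  assumes solvable: "P1_solutions A B \<noteq> {}"
    and PR: "\<And>u. blinfun_apply (adjoint_op (block P)) (vec u) = vec u"
            "\<And>u. blinfun_apply (block R) (vec u) = vec u"
    and m_ge: "CARD('m) \<ge> CARD('n) - 1"
    and D: "\<And>i. self_adjoint (L i i)" "\<And>i. strongly_monotone_on UNIV (L i i)"
    and a_UV: "\<And>i. self_adjoint (U i)" "\<And>i. self_adjoint (V i)"
    and a_A: "\<And>i. max_semimonotone (U i) (V i) (A i)"
    and a_W: "\<And>j. self_adjoint (W j)" "\<And>j. strongly_monotone_on UNIV (W j)"
    and a_B: "\<And>j. cocoercive (inv (blinfun_apply (W j))) (B j)"
    and b: "kernel (adjoint_op (block M)) = Omega"
           "closed (ran (block M))"
           "(\<Sum>i\<in>UNIV. \<Sum>j\<in>UNIV. L i j) = 0"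
    and c: "kernel (sym_part (block L)) = Omega"
           "strongly_monotone_on (Omega\<^sup>\<bottom>) (sym_part (block L))"
    and d_U: "diag_op U = 0 \<or> strongly_monotone_on Omega (blk11 (diag_op U))"
    and d_cases: "(caseI V \<and> \<Theta> = Theta_I (block P) (block R) (diag_op W)) \<or>
                  (caseII B V \<and> \<Theta> = Theta_II (block L) (diag_op V))"
    and \<gamma>: "\<gamma> \<in> Lambda_set A B (block P) (block R) (block L) \<inter> Gamma_set (block L) \<Theta> (diag_op U)"
    and lam: "\<And>k. 0 \<le> lam k"
             "\<And>k. ereal (lam k) \<le> 2 * beta (Xi_hat (block L) \<Theta> (diag_op U) \<gamma>) (block M)"
             "(\<Sum>k. ereal (lam k) *
                (2 * beta (Xi_hat (block L) \<Theta> (diag_op U) \<gamma>) (block M) - ereal (lam k))) = \<infinity>"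
    and x_step: "\<And>k i. x k $ i \<in> J_scaled \<gamma> (L i i) (A i)
          (inv (blinfun_apply (L i i)) (\<Sum>j\<in>UNIV. blinfun_apply (M i j) (z k $ j))
           + inv (blinfun_apply (L i i)) (\<Sum>j\<in>UNIV. blinfun_apply (N_entries L i j) (x k $ j))
           - \<gamma> *\<^sub>R inv (blinfun_apply (L i i))
               (\<Sum>j\<in>UNIV. blinfun_apply (P i j) (B j (\<Sum>l\<in>UNIV. blinfun_apply (R j l) (x k $ l)))))"
    and z_step: "\<And>k i. z (Suc k) $ i =
          z k $ i - lam k *\<^sub>R (\<Sum>j\<in>UNIV. blinfun_apply (adjoint_op (M j i)) (x k $ j))"
  shows
    "(bounded (range z) \<and>
        (\<exists>zs\<in>zer (Psi A B (block P) (block R) (block L) (block M) \<gamma>). weakly_converges z zs))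
     \<and>
     ((\<forall>i. max_comonotone (V i) (A i) \<and> U i = 0) \<longrightarrow>
        (bounded (range x) \<longrightarrow>
           (\<exists>xs\<in>P1_solutions A B. \<forall>i. weakly_converges (\<lambda>k. x k $ i) xs)) \<and>
        ((\<forall>j. N_entries L first j = 0) \<and> (\<forall>j. P first j = 0) \<and>
           lipschitz_op (J_scaled \<gamma> (L first first) (A first)) \<longrightarrow> bounded (range x)))
     \<and>
     (strongly_monotone_on Omega (diag_op U) \<longrightarrow>
        (\<exists>xs\<in>P1_solutions A B. \<forall>i. (\<lambda>k. x k $ i) \<longlonglongrightarrow> xs))"
proof -
  have L_vec: "block L (vec u) \<in> Omega\<^sup>\<bottom>" for u
  proof -
    have "(\<Sum>i\<in>UNIV. \<Sum>j\<in>UNIV. L i j u) = (\<Sum>i\<in>UNIV. \<Sum>j\<in>UNIV. L i j) u"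
      by (simp add: blinfun.sum_left)
    then show ?thesis
      by (simp add: Omega_orth_iff block_nth b(3))
  qed
  have \<gamma>1: "\<gamma> \<in> Lambda_set A B (block P) (block R) (block L)"
    and \<gamma>2: "\<gamma> \<in> Gamma_set (block L) \<Theta> (diag_op U)"
    using \<gamma> by simp_all
  interpret splitting A B U V W "block P" "block R" "block L" "block M" \<Theta> \<gamma>
    by (rule splitting.intro[OF solvable PR a_UV a_A a_W a_B b(1,2) L_vec c d_U d_cases \<gamma>1 \<gamma>2])
  have x: "x k \<in> \<Phi> (block M (z k))" for k
  proof -
    define bk where "bk = diag_fun B (block R (x k))"
    \<comment> \<open>\<open>D\<^sub>i\<close> times the argument of the resolvent in the \<open>x\<close>-update\<close>
    define v where "v i = block M (z k) $ i + (L i i (x k $ i) - block L (x k) $ i) - \<gamma> *\<^sub>R block P bk $ i" for i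
    have "\<exists>a. a \<in> A i (x k $ i) \<and> v i = L i i (x k $ i) + \<gamma> *\<^sub>R a" for i
    proof -
      obtain G where G: "blinfun_apply G = inv (blinfun_apply (L i i))"
        by (rule strongly_monotone_inverse[OF D(2)[of i]])
      have "x k $ i \<in> J_scaled \<gamma> (L i i) (A i) (G (v i))"
        using x_step[of k i] unfolding block_N_entries G[symmetric] v_def
        by (simp add: block_nth bk_def diag_fun_def blinfun.bilinear_simps)
      then show ?thesis
        unfolding G by (rule J_scaled_mem[OF D(2)]) blast
    qed
    then obtain a where a: "\<And>i. a i \<in> A i (x k $ i)" "\<And>i. v i = L i i (x k $ i) + \<gamma> *\<^sub>R a i"
      by metis
    have "block M (z k) = \<gamma> *\<^sub>R vec_lambda a + \<gamma> *\<^sub>R block P bk + block L (x k)"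
      using a(2) unfolding v_def by (simp add: vec_eq_iff algebra_simps)
    moreover have "vec_lambda a \<in> diag_set A (x k)"
      using a(1) by (simp add: diag_set_def)
    ultimately show ?thesis
      unfolding Phi_iff bk_def by blast
  qed
  have z: "z (Suc k) = z k - lam k *\<^sub>R adjoint_op (block M) (x k)" for k
    by (simp add: vec_eq_iff z_step adjoint_block block_nth)
  note iter = iteration_converges[OF lam[folded \<Xi>_def] x z]
  obtain l where l: "adjoint_op (block M) (\<phi> (block M l)) = 0" "weakly_converges z l"
    using iter(3) by blast
  obtain u where "\<phi> (block M l) = vec u"
    using l(1) unfolding adjoint_M_0_iff by (rule OmegaE)
  then have \<Phi>l: "\<Phi> (block M l) = {vec u}"
    using Phi_eq[OF M_mem, of l] by simp
  then have u: "vec u \<in> \<Phi> (block M l)" by simp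
  have sol: "u \<in> P1_solutions A B"
    by (rule Phi_vec_imp_solution[OF u M_mem])
  have "0 \<in> adjoint_op (block M) ` \<Phi> (block M l)"
    unfolding \<Phi>l using adjoint_M_0_iff[THEN iffD2, OF vec_in_Omega, of u] by (intro image_eqI[of _ _ "vec u"]) simp_all
  then have zer: "l \<in> zer (Psi A B (block P) (block R) (block L) (block M) \<gamma>)"
    by (simp add: zer_def Psi_def)
  note conv = x iter(1,2) u
  have ii: "\<exists>xs\<in>P1_solutions A B. \<forall>i. weakly_converges (\<lambda>k. x k $ i) xs"
    if U0: "\<And>i. U i = 0" and bdx: "bounded (range x)"
  proof (intro bexI[OF _ sol] allI)
    fix i
    have w: "weakly_converges x (vec u)"
      by (rule weak_convergence[OF U0 bdx conv l(2)])
    show "weakly_converges (\<lambda>k. x k $ i) u"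
      unfolding weakly_converges_def
    proof
      fix y
      have "(\<lambda>k. x k \<bullet> axis i y) \<longlonglongrightarrow> vec u \<bullet> axis i y"
        using w by (simp add: weakly_converges_def)
      then show "(\<lambda>k. x k $ i \<bullet> y) \<longlonglongrightarrow> u \<bullet> y"
        by (simp add: inner_axis)
    qed
  qed
  have bdx: "bounded (range x)"
    if N0: "\<And>j. N_entries L first j = 0" and P0: "\<And>j. P first j = 0"
      and lip: "lipschitz_op (J_scaled \<gamma> (L first first) (A first))"
  proof -
    obtain G where G: "blinfun_apply G = inv (blinfun_apply (L first first))"
      by (rule strongly_monotone_inverse[OF D(2)[of first]])
    define v where "v k = G (block M (z k) $ first)" for k
    have mem: "x k $ first \<in> J_scaled \<gamma> (L first first) (A first) (v k)" for k
      using x_step[of k first] unfolding G[symmetric] v_def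
      by (simp add: N0 P0 block_nth)
    obtain C where C: "C \<ge> 0" "\<And>s t s' t'. t \<in> J_scaled \<gamma> (L first first) (A first) s \<Longrightarrow>
        t' \<in> J_scaled \<gamma> (L first first) (A first) s' \<Longrightarrow> dist t t' \<le> C * dist s s'"
      using lip unfolding lipschitz_op_def graph_def by blast
    have "bounded (range (\<lambda>k. block M (z k)))"
      by (rule bounded_range_blinfun[OF iter(1)])
    then obtain E where E: "\<And>k. norm (block M (z k)) \<le> E"
      by (auto simp: bounded_iff)
    have "norm (block M (z k) $ first) \<le> E" for k
      using E[of k] Finite_Cartesian_Product.norm_nth_le[of "block M (z k)" first] by linarith
    then have "bounded (range (\<lambda>k. block M (z k) $ first))"
      by (auto simp: bounded_iff)
    then have "bounded (range v)"
      unfolding v_def by (rule bounded_range_blinfun)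
    then obtain F where F: "\<And>k. norm (v k) \<le> F"
      by (auto simp: bounded_iff)
    have "norm (x k $ first) \<le> C * (F + F) + norm (x 0 $ first)" for k
    proof -
      have "norm (x k $ first - x 0 $ first) \<le> C * norm (v k - v 0)"
        using C(2)[OF mem mem, of k 0] by (simp add: dist_norm)
      also have "\<dots> \<le> C * (F + F)"
        using F[of k] F[of 0] norm_triangle_ineq4[of "v k" "v 0"] C(1)
        by (intro mult_left_mono) auto
      finally show ?thesis
        using norm_triangle_sub[of "x k $ first" "x 0 $ first"] by linarith
    qed
    then have "bounded (range (\<lambda>k. x k $ first))"
      by (auto simp: bounded_iff)
    moreover have "bounded (range (\<lambda>k. Q (x k)))"
      using orthogonal_part_converges(2)[OF conv] convergent_imp_bounded by blast
    ultimately show ?thesis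
      by (rule bounded_of_component)
  qed
  have iii: "\<exists>xs\<in>P1_solutions A B. \<forall>i. (\<lambda>k. x k $ i) \<longlonglongrightarrow> xs"
    if "strongly_monotone_on Omega (diag_op U)"
  proof (intro bexI[OF _ sol] allI)
    fix i
    from tendsto_vec_nth[OF strong_convergence[OF that conv], of i]
    show "(\<lambda>k. x k $ i) \<longlonglongrightarrow> u" by simp
  qed
  show ?thesis
    using iter(1) zer l(2) ii bdx iii by blast
qed

end
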